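(* Let $n\ge1$. For every lattice $\Gamma\subset\mathbb{R}^n$ and every $\epsilon>0$ there is an $\epsilon$-perturbation $\Lambda$ of $\Gamma$ such that (i) $\Lambda$ is a stable sampling set for $PW_S$ for each compact set $S\subset\mathbb{R}^n$ of positive measure with $|S|<D(\Lambda)(2\pi)^n$; (ii) $\Lambda$ is an interpolation set for $PW_S$ for each bounded open set $S\subset\mathbb{R}^n$ with $|S|>D(\Lambda)(2\pi)^n$. Here $D(\Lambda)$ is the uniform density of $\Lambda$.
   Context: A lattice is a set $\Gamma=T\mathbb{Z}^n$ with $T:\mathbb{R}^n\to\mathbb{R}^n$ an invertible linear operator. Given countable sets $\Lambda,\Lambda'\subset\mathbb{R}^n$, $\Lambda'$ is an $\epsilon$-perturbation of $\Lambda$ if, for some enumerations $\Lambda=\{\lambda(k)\}$ and $\Lambda'=\{\lambda'(k)\}$, $\sup_k|\lambda(k)-\lambda'(k)|<\epsilon$. $|S|$ denotes Lebesgue measure. With $B$ the closed Euclidean unit ball, a set $\Lambda$ possesses a uniform density $D(\Lambda)$ if $\#(\Lambda\cap(x+rB))/|rB|=D(\Lambda)(1+o(1))$ as $r\to\infty$, uniformly in $x\in\mathbb{R}^n$. For a bounded set $S\subset\mathbb{R}^n$ of positive measure, the Paley--Wiener space $PW_S$ consists of all Fourier transforms $\hat F(t)=(2\pi)^{-n/2}\int_{\mathbb{R}^n}e^{-it\cdot x}F(x)\,dx$ of functions $F\in L^2(\mathbb{R}^n)$ vanishing a.e. outside $S$ (its elements are continuous functions). $\Lambda$ is a stable sampling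 set for $PW_S$ if there is a constant $C$ with $\int_{\mathbb{R}^n}|f|^2\,dt\le C\sum_{\lambda\in\Lambda}|f(\lambda)|^2$ for all $f\in PW_S$. A countable set $\Lambda$ is an interpolation set for $PW_S$ if for every $c\in\ell^2(\Lambda)$ there is $f\in PW_S$ with $f(\lambda)=c(\lambda)$ for all $\lambda\in\Lambda$. *)

theory Defs
  imports "HOL-Analysis.Analysis"
begin

definition is_lattice :: "(real ^ 'n) set \<Rightarrow> bool" where
  "is_lattice \<Gamma> \<longleftrightarrow> (\<exists>T :: real ^ 'n \<Rightarrow> real ^ 'n.
     linear T \<and> bij T \<and> \<Gamma> = T ` {z. \<forall>i. z $ i \<in> \<int>})"

(* Enumerations are without repetition.  The common index set I allows finite as well as
   infinite countable sets; the supremum is extended-valued, so an unbounded displacement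
   is not a perturbation. *)
definition eps_perturbation :: "real \<Rightarrow> (real ^ 'n) set \<Rightarrow> (real ^ 'n) set \<Rightarrow> bool" where
  "eps_perturbation \<epsilon> \<Lambda> \<Lambda>' \<longleftrightarrow> (\<exists>(I :: nat set) l l'.
     bij_betw l I \<Lambda> \<and> bij_betw l' I \<Lambda>' \<and>
     (SUP k\<in>I. ereal (norm (l k - l' k))) < ereal \<epsilon>)"

(* The function e is the o(1) term.  Finiteness is explicit because card is 0 on infinite sets. *)
definition has_uniform_density :: "(real ^ 'n) set \<Rightarrow> real \<Rightarrow> bool" where
  "has_uniform_density \<Lambda> D \<longleftrightarrow>
     (\<exists>e :: real \<Rightarrow> real ^ 'n \<Rightarrow> real.
        uniform_limit UNIV e (\<lambda>_. 0) at_top \<and>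
        (\<forall>\<^sub>F r in at_top. \<forall>x. finite (\<Lambda> \<inter> cball x r) \<and>
           real (card (\<Lambda> \<inter> cball x r)) / measure lebesgue (cball (0 :: real ^ 'n) r)
             = D * (1 + e r x)))"

definition fourier_transform :: "(real ^ 'n \<Rightarrow> complex) \<Rightarrow> real ^ 'n \<Rightarrow> complex" where
  "fourier_transform F t =
     complex_of_real ((2 * pi) powr (- real CARD('n) / 2)) *
     (LINT x|lebesgue. exp (- \<i> * complex_of_real (t \<bullet> x)) * F x)"

(* Meant for bounded S: then F is also in L1, so the Bochner integral in the Fourier transform
   exists for every t and each element of the space is a genuine (continuous) function,
   with well-defined point values. *)
definition paley_wiener :: "(real ^ 'n) set \<Rightarrow> (real ^ 'n \<Rightarrow> complex) set" where
  "paley_wiener S =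
     {fourier_transform F | F.
        F \<in> borel_measurable lebesgue \<and>
        integrable lebesgue (\<lambda>x. (cmod (F x))\<^sup>2) \<and>
        (AE x in lebesgue. x \<notin> S \<longrightarrow> F x = 0)}"

(* Both sides take values in [0, \<infinity>], so the inequality is not affected by the
   convention that a divergent real-valued sum is 0. *)
definition stable_sampling_set :: "(real ^ 'n) set \<Rightarrow> (real ^ 'n) set \<Rightarrow> bool" where
  "stable_sampling_set S \<Lambda> \<longleftrightarrow>
     (\<exists>C::real. C > 0 \<and> (\<forall>f\<in>paley_wiener S.
        (\<integral>\<^sup>+ t. ennreal ((cmod (f t))\<^sup>2) \<partial>lebesgue)
          \<le> ennreal C * (\<Sum>\<^sub>\<infinity>x\<in>\<Lambda>. ennreal ((cmod (f x))\<^sup>2))))"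

definition interpolation_set :: "(real ^ 'n) set \<Rightarrow> (real ^ 'n) set \<Rightarrow> bool" where
  "interpolation_set S \<Lambda> \<longleftrightarrow> countable \<Lambda> \<and>
     (\<forall>c :: real ^ 'n \<Rightarrow> complex. (\<lambda>x. (cmod (c x))\<^sup>2) summable_on \<Lambda> \<longrightarrow>
        (\<exists>f\<in>paley_wiener S. \<forall>x\<in>\<Lambda>. f x = c x))"

end

theory Submission
  imports Defs
begin

text \<open>
  After a linear change of variables the lattice is the integer lattice, the Fourier transform is
  the integral of \<open>exp (-2 \<pi> i t \<bullet> y) G y\<close>, and the critical measure of the spectrum is 1. The
  required set consists of points \<open>p z\<close> close to the integer vectors \<open>z\<close>, where \<open>p\<close> is the limit of
  maps that are periodic with the periods \<open>N = 2 ^ m\<close>.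

  Periodic point sets. Let the spectrum be a union of exactly \<open>N ^ n\<close> cubes of side \<open>1 / N\<close>
  of the grid with mesh \<open>1 / N\<close>. Samples at the points \<open>p r + N k\<close>, with \<open>k\<close> running through the integer
  vectors, are Fourier coefficients of a single function on one cube: the spectrum is folded onto
  that cube, and the part of \<open>G\<close> on the cube with corner \<open>a / N\<close> enters with the weight
  \<open>exp (-2 \<pi> i p r \<bullet> a / N)\<close>, up to a factor that does not depend on \<open>a\<close> (\<open>ft_fold\<close>). By the Parseval identity on the cube, sampling and
  interpolation both follow once the square matrix of these weights is invertible; \<open>r\<close> runs
  through the \<open>N ^ n\<close> residues modulo \<open>N\<close> (\<open>stable_tile\<close>, \<open>solvable_tile\<close>). A finite exponential sum
  with a nonzero coefficient does not vanish on any ball. Therefore arbitrarily small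
  displacements of the points \<open>p r\<close> make the matrices for all
  such unions inside a large box invertible at the same time (\<open>generic_points\<close>).

  The limit. The displacement made at stage \<open>m + 1\<close> is chosen after the stability constants
  of stage \<open>m\<close> are known, and so small that the sampling operator from \<open>L2\<close> to \<open>l2\<close> changes by a small
  fraction of those constants (\<open>refine_stage\<close>). Hence the limit has the sampling property of
  every stage with a smaller constant, and it solves each finitely supported interpolation problem up to a
  fixed small relative error (\<open>universal_points\<close>). Repeated correction of the error gives exact
  interpolation of all \<open>l2\<close> data (\<open>approx_solvable_imp_solvable\<close>).

  Conclusion. A compact set of measure less than 1 lies in such a union of cubes, and a bounded open set
  of measure greater than 1 contains one (\<open>compact_in_tiles\<close>, \<open>open_contains_tiles\<close>). Sampling is
  inherited by smaller spectra and interpolation by larger ones. For a general lattice \<open>T\<close>, the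
  map from the given spectra to the normalized ones is the adjoint of \<open>T\<close> divided by \<open>2 \<pi>\<close>. As \<open>T\<close>
  and its adjoint multiply volumes by the same factor (\<open>linear_scaling\<close>), and the density is the
  reciprocal of this factor (\<open>uniform_density_perturbed\<close>), the critical measure becomes 1.
\<close>

section \<open>Density of a bounded function algebra in the square-integrable functions\<close>

text \<open>
  The trigonometric polynomials on a half-open cube will be the example. The last assumption is the measure-theoretic
  counterpart of the separation of points in the Stone-Weierstrass theorem; it holds on the half-open cube, which
  contains only one of any two points that the trigonometric polynomials cannot distinguish.
\<close>

locale bounded_function_algebra = finite_measure M for M :: "'a measure" +
  fixes T :: "('a \<Rightarrow> real) set"
  assumes meas: "f \<in> T \<Longrightarrow> f \<in> borel_measurable M"
    and bdd: "f \<in> T \<Longrightarrow> \<exists>B. \<forall>x\<in>space M. \<bar>f x\<bar> \<le> B"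
    and const: "(\<lambda>_. c) \<in> T"
    and add: "f \<in> T \<Longrightarrow> g \<in> T \<Longrightarrow> (\<lambda>x. f x + g x) \<in> T"
    and mult: "f \<in> T \<Longrightarrow> g \<in> T \<Longrightarrow> (\<lambda>x. f x * g x) \<in> T"
    and gen: "A \<in> sets M \<Longrightarrow> A \<in> sigma_sets (space M) {{x \<in> space M. a < f x} | f a. f \<in> T}"
begin

text \<open>
  The squared \<open>L2\<close> distance. Squares are kept throughout, because the inequality
  \<open>(a + b)\<^sup>2 \<le> 2 * a\<^sup>2 + 2 * b\<^sup>2\<close> replaces the triangle inequality.
\<close>

definition dist2 :: "('a \<Rightarrow> real) \<Rightarrow> ('a \<Rightarrow> real) \<Rightarrow> ennreal" where
  "dist2 f g = (\<integral>\<^sup>+x. ennreal ((f x - g x)\<^sup>2) \<partial>M)"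

definition approximable :: "('a \<Rightarrow> real) \<Rightarrow> bool" where
  "approximable g \<longleftrightarrow> g \<in> borel_measurable M \<and> (\<forall>e>0. \<exists>f\<in>T. dist2 g f < ennreal e)"

lemma two_plus_two_less:
  assumes "a < ennreal (e/5)" "b < ennreal (e/5)" "e > 0"
  shows "2 * a + 2 * b < ennreal e"
proof -
  have "2 * a + 2 * b \<le> 2 * ennreal (e/5) + 2 * ennreal (e/5)"
    using assms by (intro add_mono mult_left_mono) auto
  also have "\<dots> = ennreal (4 * (e/5))"
    using assms(3) by (simp flip: ennreal_plus ennreal_mult' ennreal_numeral)
  also have "\<dots> < ennreal e" using assms(3) by (intro ennreal_lessI) auto
  finally show ?thesis .
qed

lemma dist2_triangle:
  assumes [measurable]: "f \<in> borel_measurable M" "g \<in> borel_measurable M" "h \<in> borel_measurable M"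
  shows "dist2 f h \<le> 2 * dist2 f g + 2 * dist2 g h"
proof -
  have "ennreal ((f x - h x)\<^sup>2) \<le> 2 * ennreal ((f x - g x)\<^sup>2) + 2 * ennreal ((g x - h x)\<^sup>2)" for x
  proof -
    have "(f x - h x)\<^sup>2 \<le> 2 * (f x - g x)\<^sup>2 + 2 * (g x - h x)\<^sup>2"
      using zero_le_power2[of "(f x - g x) - (g x - h x)"] by (simp add: power2_eq_square algebra_simps)
    then have "ennreal ((f x - h x)\<^sup>2) \<le> ennreal (2 * (f x - g x)\<^sup>2 + 2 * (g x - h x)\<^sup>2)"
      by (rule ennreal_leI)
    then show ?thesis by (simp add: ennreal_mult')
  qed
  then have "dist2 f h \<le> (\<integral>\<^sup>+x. 2 * ennreal ((f x - g x)\<^sup>2) + 2 * ennreal ((g x - h x)\<^sup>2) \<partial>M)"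
    unfolding dist2_def by (intro nn_integral_mono)
  also have "\<dots> = 2 * dist2 f g + 2 * dist2 g h"
    unfolding dist2_def by (simp add: nn_integral_add nn_integral_cmult)
  finally show ?thesis .
qed

lemma approximable_measurable: "approximable g \<Longrightarrow> g \<in> borel_measurable M"
  by (simp add: approximable_def)

lemma approximable_T: "f \<in> T \<Longrightarrow> approximable f"
  unfolding approximable_def using meas by (auto intro!: bexI[of _ f] simp: dist2_def)

lemma approximable_closed:
  assumes m: "g \<in> borel_measurable M" and *: "\<And>e. e > 0 \<Longrightarrow> \<exists>h. approximable h \<and> dist2 g h < ennreal e"
  shows "approximable g"
  unfolding approximable_def
proof (intro conjI allI impI m)
  fix e :: real assume "e > 0"
  then obtain h where h: "approximable h" "dist2 g h < ennreal (e/5)" using *[of "e/5"] by auto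
  then obtain f where f: "f \<in> T" "dist2 h f < ennreal (e/5)" using \<open>e > 0\<close>
    unfolding approximable_def by (auto dest!: spec[of _ "e/5"])
  have "dist2 g f \<le> 2 * dist2 g h + 2 * dist2 h f"
    using dist2_triangle m h(1) meas[OF f(1)] approximable_measurable by blast
  also have "\<dots> < ennreal e" by (rule two_plus_two_less[OF h(2) f(2) \<open>e > 0\<close>])
  finally show "\<exists>f\<in>T. dist2 g f < ennreal e" using f by blast
qed

lemma approximable_cong: "(\<And>x. x \<in> space M \<Longrightarrow> f x = g x) \<Longrightarrow> approximable f = approximable g"
proof -
  assume *: "\<And>x. x \<in> space M \<Longrightarrow> f x = g x"
  then have "dist2 f h = dist2 g h" for h
    unfolding dist2_def by (intro nn_integral_cong) auto
  then show ?thesis unfolding approximable_def using measurable_cong[of M f g borel] * by auto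
qed

lemma approximable_add:
  assumes "approximable f" "approximable g" shows "approximable (\<lambda>x. f x + g x)"
  unfolding approximable_def
proof (intro conjI allI impI)
  have [measurable]: "f \<in> borel_measurable M" "g \<in> borel_measurable M"
    using assms approximable_measurable by auto
  show "(\<lambda>x. f x + g x) \<in> borel_measurable M" by simp
  fix e :: real assume "e > 0"
  obtain p where p: "p \<in> T" "dist2 f p < ennreal (e/5)"
    using assms \<open>e > 0\<close> unfolding approximable_def by (auto dest!: spec[of _ "e/5"])
  obtain q where q: "q \<in> T" "dist2 g q < ennreal (e/5)"
    using assms \<open>e > 0\<close> unfolding approximable_def by (auto dest!: spec[of _ "e/5"])
  have [measurable]: "p \<in> borel_measurable M" "q \<in> borel_measurable M" using p q meas by auto
  have "dist2 (\<lambda>x. f x + g x) (\<lambda>x. p x + q x)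
     \<le> 2 * dist2 (\<lambda>x. f x + g x) (\<lambda>x. p x + g x) + 2 * dist2 (\<lambda>x. p x + g x) (\<lambda>x. p x + q x)"
    by (rule dist2_triangle) auto
  also have "\<dots> = 2 * dist2 f p + 2 * dist2 g q" by (simp add: dist2_def)
  also have "\<dots> < ennreal e" by (rule two_plus_two_less[OF p(2) q(2) \<open>e > 0\<close>])
  finally show "\<exists>f'\<in>T. dist2 (\<lambda>x. f x + g x) f' < ennreal e" using p q add by blast
qed

lemma dist2_mult_bound:
  assumes "\<And>x. x \<in> space M \<Longrightarrow> \<bar>b x\<bar> \<le> B"
    and [measurable]: "f \<in> borel_measurable M" "g \<in> borel_measurable M"
  shows "dist2 (\<lambda>x. f x * b x) (\<lambda>x. g x * b x) \<le> ennreal (B\<^sup>2) * dist2 f g"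
proof -
  have "ennreal ((f x * b x - g x * b x)\<^sup>2) \<le> ennreal (B\<^sup>2) * ennreal ((f x - g x)\<^sup>2)"
    if "x \<in> space M" for x
  proof -
    have "(f x * b x - g x * b x)\<^sup>2 = (b x)\<^sup>2 * (f x - g x)\<^sup>2"
      by (simp add: power2_eq_square algebra_simps)
    also have "\<dots> \<le> B\<^sup>2 * (f x - g x)\<^sup>2"
      using assms(1)[OF that] by (intro mult_right_mono) (auto simp: abs_le_square_iff[symmetric])
    finally show ?thesis by (simp flip: ennreal_mult' add: ennreal_leI)
  qed
  then have "dist2 (\<lambda>x. f x * b x) (\<lambda>x. g x * b x) \<le> (\<integral>\<^sup>+x. ennreal (B\<^sup>2) * ennreal ((f x - g x)\<^sup>2) \<partial>M)"
    unfolding dist2_def by (intro nn_integral_mono)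
  also have "\<dots> = ennreal (B\<^sup>2) * dist2 f g"
    unfolding dist2_def by (simp add: nn_integral_cmult)
  finally show ?thesis .
qed

text \<open>
  The approximants of \<open>f\<close> need not be uniformly bounded, but multiplication by the bounded function \<open>b\<close>
  is continuous in \<open>L2\<close>. Two applications of this observation handle a product of
  approximable functions, one of which is bounded.
\<close>

lemma approximable_mult_aux:
  assumes b: "\<And>x. x \<in> space M \<Longrightarrow> \<bar>b x\<bar> \<le> B" and [measurable]: "b \<in> borel_measurable M"
    and f: "approximable f" and T: "\<And>p. p \<in> T \<Longrightarrow> approximable (\<lambda>x. p x * b x)"
  shows "approximable (\<lambda>x. f x * b x)"
proof (rule approximable_closed)
  have [measurable]: "f \<in> borel_measurable M" using f approximable_measurable by auto
  show "(\<lambda>x. f x * b x) \<in> borel_measurable M" by simp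
  fix e :: real assume "e > 0"
  then have "e / (B\<^sup>2 + 1) > 0" by (simp add: add_nonneg_pos)
  then obtain p where p: "p \<in> T" "dist2 f p < ennreal (e / (B\<^sup>2 + 1))"
    using f unfolding approximable_def by blast
  have "dist2 (\<lambda>x. f x * b x) (\<lambda>x. p x * b x) \<le> ennreal (B\<^sup>2) * dist2 f p"
    using meas[OF p(1)] by (intro dist2_mult_bound b) auto
  also have "\<dots> \<le> ennreal (B\<^sup>2) * ennreal (e / (B\<^sup>2 + 1))"
    using p by (intro mult_left_mono) auto
  also have "\<dots> < ennreal e"
    using \<open>e > 0\<close> by (simp flip: ennreal_mult' add: ennreal_less_iff divide_simps add_nonneg_pos)
  finally show "\<exists>h. approximable h \<and> dist2 (\<lambda>x. f x * b x) h < ennreal e" using T[OF p(1)] by blast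
qed

lemma approximable_mult:
  assumes "approximable f" "approximable g" and g: "\<And>x. x \<in> space M \<Longrightarrow> \<bar>g x\<bar> \<le> B"
  shows "approximable (\<lambda>x. f x * g x)"
proof (rule approximable_mult_aux[OF g _ assms(1)])
  fix p assume p: "p \<in> T"
  then obtain C where C: "\<And>x. x \<in> space M \<Longrightarrow> \<bar>p x\<bar> \<le> C" using bdd by blast
  have "approximable (\<lambda>x. g x * p x)"
    by (rule approximable_mult_aux[OF C meas[OF p] assms(2)]) (auto intro: approximable_T mult p)
  then show "approximable (\<lambda>x. p x * g x)" by (simp add: mult.commute)
qed (use assms approximable_measurable in auto)

lemma approximable_dominated:
  assumes H: "\<And>n. approximable (H n)" and [measurable]: "g \<in> borel_measurable M" "w \<in> borel_measurable M"
    and w: "(\<integral>\<^sup>+x. ennreal (w x) \<partial>M) < \<infinity>"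
    and le: "\<And>n x. x \<in> space M \<Longrightarrow> (H n x - g x)\<^sup>2 \<le> w x"
    and lim: "\<And>x. x \<in> space M \<Longrightarrow> (\<lambda>n. H n x) \<longlonglongrightarrow> g x"
  shows "approximable g"
proof (rule approximable_closed)
  have [measurable]: "H n \<in> borel_measurable M" for n using H approximable_measurable by auto
  fix e :: real assume "e > 0"
  have "(\<lambda>n. \<integral>\<^sup>+x. ennreal ((g x - H n x)\<^sup>2) \<partial>M) \<longlonglongrightarrow> (\<integral>\<^sup>+x. 0 \<partial>M)"
  proof (rule nn_integral_dominated_convergence[where w="\<lambda>x. ennreal (w x)"])
    show "AE x in M. ennreal ((g x - H n x)\<^sup>2) \<le> ennreal (w x)" for n
      using le by (auto intro!: AE_I2 ennreal_leI simp: power2_commute)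
    have "(\<lambda>n. ennreal ((g x - H n x)\<^sup>2)) \<longlonglongrightarrow> ennreal ((g x - g x)\<^sup>2)" if "x \<in> space M" for x
      by (intro tendsto_intros lim that)
    then show "AE x in M. (\<lambda>n. ennreal ((g x - H n x)\<^sup>2)) \<longlonglongrightarrow> 0" by (intro AE_I2) simp
  qed (use w in auto)
  then have "(\<lambda>n. dist2 g (H n)) \<longlonglongrightarrow> 0" unfolding dist2_def by simp
  then have "eventually (\<lambda>n. dist2 g (H n) < ennreal e) sequentially"
    using \<open>e > 0\<close> by (intro order_tendstoD(2)) auto
  then show "\<exists>h. approximable h \<and> dist2 g h < ennreal e"
    using H by (auto simp: eventually_sequentially)
qed fact

lemma approximable_bounded_limit:
  assumes H: "\<And>n. approximable (H n)" 
    and le: "\<And>n x. x \<in> space M \<Longrightarrow> \<bar>H n x\<bar> \<le> B"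
    and lim: "\<And>x. x \<in> space M \<Longrightarrow> (\<lambda>n. H n x) \<longlonglongrightarrow> g x"
  shows "approximable g"
proof (rule approximable_dominated[OF H _ _ _ _ lim, where w="\<lambda>_. (2*B)\<^sup>2"])
  show "g \<in> borel_measurable M"
    by (rule borel_measurable_LIMSEQ_metric[OF _ lim]) (use H approximable_measurable in auto)
  fix n x assume x: "x \<in> space M"
  have "\<bar>g x\<bar> \<le> B"
    using tendsto_upperbound[OF tendsto_rabs[OF lim[OF x]], of B] le[OF x] by simp
  then have "\<bar>H n x - g x\<bar> \<le> 2 * B" using le[OF x, of n] by linarith
  then show "(H n x - g x)\<^sup>2 \<le> (2*B)\<^sup>2" by (simp only: abs_le_square_iff[symmetric])
qed (auto simp: ennreal_mult_less_top less_top emeasure_eq_measure)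

lemma approximable_sum: "(\<And>i. i \<in> I \<Longrightarrow> approximable (f i)) \<Longrightarrow> approximable (\<lambda>x. \<Sum>i\<in>I. f i x)"
  by (induction I rule: infinite_finite_induct) (auto intro: approximable_add approximable_T const)

lemma approximable_cmult: "approximable f \<Longrightarrow> approximable (\<lambda>x. c * f x)"
  using approximable_mult[of f "\<lambda>_. c" "\<bar>c\<bar>"] approximable_T[OF const[of c]] by (simp add: mult.commute)

lemma polynomial_comp: "real_polynomial_function p \<Longrightarrow> f \<in> T \<Longrightarrow> (\<lambda>x. p (f x)) \<in> T"
proof (induction p rule: real_polynomial_function.induct)
  case (linear p)
  have "p x = p 1 * x" for x
    using linear_cmul[OF bounded_linear.linear[OF linear(1)], of x 1] by (simp add: mult.commute)
  then have "(\<lambda>x. p (f x)) = (\<lambda>x. p 1 * f x)" by (intro ext)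
  also have "\<dots> \<in> T" by (rule mult[OF const linear(2)])
  finally show ?case .
qed (auto intro: const add mult)

lemma approximable_continuous:
  assumes f: "f \<in> T" and \<phi>: "continuous_on UNIV (\<phi> :: real \<Rightarrow> real)"
  shows "approximable (\<lambda>x. \<phi> (f x))"
proof (rule approximable_closed)
  have [measurable]: "f \<in> borel_measurable M" "\<phi> \<in> borel_measurable borel"
    using f meas \<phi> borel_measurable_continuous_onI by auto
  show "(\<lambda>x. \<phi> (f x)) \<in> borel_measurable M" by simp
  fix e :: real assume "e > 0"
  obtain B where B: "\<And>x. x \<in> space M \<Longrightarrow> \<bar>f x\<bar> \<le> B" using bdd[OF f] by blast
  define d where "d = sqrt (e / (2 * (measure M (space M) + 1)))"
  have mp: "measure M (space M) + 1 > 0" by (simp add: add_nonneg_pos)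
  have d: "d > 0" "d\<^sup>2 = e / (2 * (measure M (space M) + 1))"
    using \<open>e > 0\<close> mp by (auto simp: d_def)
  obtain p where p: "real_polynomial_function p" "\<And>t. t \<in> {-B..B} \<Longrightarrow> \<bar>\<phi> t - p t\<bar> < d"
    by (rule Stone_Weierstrass_real_polynomial_function[OF compact_Icc continuous_on_subset[OF \<phi>] d(1)]) auto
  have "dist2 (\<lambda>x. \<phi> (f x)) (\<lambda>x. p (f x)) \<le> (\<integral>\<^sup>+x. ennreal (d\<^sup>2) \<partial>M)"
    unfolding dist2_def
  proof (intro nn_integral_mono ennreal_leI)
    fix x assume "x \<in> space M"
    then have "f x \<in> {-B..B}" using B[of x] by auto
    from p(2)[OF this] have "\<bar>\<phi> (f x) - p (f x)\<bar> \<le> \<bar>d\<bar>" by linarith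
    then show "(\<phi> (f x) - p (f x))\<^sup>2 \<le> d\<^sup>2" by (simp only: abs_le_square_iff)
  qed
  also have "\<dots> = ennreal (d\<^sup>2 * measure M (space M))"
    by (simp add: emeasure_eq_measure ennreal_mult')
  also have "\<dots> < ennreal e"
  proof (intro ennreal_lessI)
    have "d\<^sup>2 * measure M (space M) \<le> d\<^sup>2 * (measure M (space M) + 1)"
      by (simp add: mult_left_mono)
    also have "\<dots> = e / 2" using mp unfolding d(2) by (simp add: field_simps)
    finally show "d\<^sup>2 * measure M (space M) < e" using \<open>e > 0\<close> by linarith
  qed fact
  finally show "\<exists>h. approximable h \<and> dist2 (\<lambda>x. \<phi> (f x)) h < ennreal e"
    using approximable_T[OF polynomial_comp[OF p(1) f]] by blast
qed

text \<open>
  Continuous functions of \<open>f\<close> are approximable by the Weierstrass theorem on the range of \<open>f\<close>, and the ramps of slope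
  \<open>n\<close> that start at \<open>a\<close> converge boundedly to the indicator of \<open>{t. a < t}\<close>.
\<close>

lemma approximable_indicator_superlevel:
  assumes f: "f \<in> T" shows "approximable (indicator {x \<in> space M. a < f x})"
proof -
  let ?\<phi> = "\<lambda>(n::nat) (t::real). min 1 (max 0 (of_nat n * (t - a)))"
  have 1: "approximable (\<lambda>x. ?\<phi> n (f x))" for n
    by (rule approximable_continuous[OF f]) (intro continuous_intros)
  have 2: "\<bar>?\<phi> n (f x)\<bar> \<le> 1" for n x by auto
  have 3: "(\<lambda>n. ?\<phi> n (f x)) \<longlonglongrightarrow> indicator {x \<in> space M. a < f x} x" if x: "x \<in> space M" for x
  proof (cases "a < f x")
    case True
    obtain k :: nat where k: "1 / (f x - a) < real k" using reals_Archimedean2 by blast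
    have "?\<phi> n (f x) = 1" if "n \<ge> k" for n
    proof -
      have "1 < real k * (f x - a)" using k True by (simp add: field_simps)
      also have "\<dots> \<le> real n * (f x - a)" using that True by (intro mult_right_mono) auto
      finally show ?thesis by simp
    qed
    then have "eventually (\<lambda>n. ?\<phi> n (f x) = 1) sequentially"
      by (auto simp: eventually_sequentially)
    then show ?thesis using True x by (simp add: tendsto_eventually)
  next
    case False
    then have "real n * (f x - a) \<le> 0" for n by (intro mult_nonneg_nonpos) auto
    then have "?\<phi> n (f x) = 0" for n by (simp add: max_absorb1)
    then show ?thesis using False by simp
  qed
  show ?thesis by (rule approximable_bounded_limit[OF 1 2 3])
qed

text \<open>
  The sets with approximable indicator form a \<open>\<sigma>\<close>-algebra: complements and finite unions come from
  sums and products, countable unions from bounded limits.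
\<close>

lemma approximable_indicator: 
  assumes A: "A \<in> sets M" shows "approximable (indicator A)"
  using gen[OF A]
proof (induction rule: sigma_sets.induct)
  case (Basic A)
  then show ?case using approximable_indicator_superlevel by auto
next
  case Empty
  then show ?case using approximable_T[OF const[of 0]] by (simp add: indicator_def)
next
  case (Compl A)
  have "approximable (\<lambda>x. 1 + (-1) * indicator A x)"
    by (intro approximable_add approximable_cmult Compl approximable_T const)
  also have "approximable (\<lambda>x. 1 + (-1) * indicator A x) = approximable (indicator (space M - A))"
    by (rule approximable_cong) (auto simp: indicator_def)
  finally show ?case .
next
  case (Union A)
  have fin: "approximable (indicator (\<Union>i<n. A i))" for n
  proof (induction n)
    case 0 then show ?case using approximable_T[OF const[of 0]] by (simp add: indicator_def)
  next
    case (Suc n)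
    have "approximable (\<lambda>x. indicator (\<Union>i<n. A i) x + (indicator (A n) x + (-1) * (indicator (\<Union>i<n. A i) x * indicator (A n) x)))"
      by (intro approximable_add approximable_cmult Suc Union approximable_mult[where B=1]) (auto simp: indicator_def)
    also have "(\<lambda>x. indicator (\<Union>i<n. A i) x + (indicator (A n) x + (-1) * (indicator (\<Union>i<n. A i) x * indicator (A n) x)))
       = (indicator (\<Union>i<Suc n. A i) :: 'a \<Rightarrow> real)"
      by (auto simp: fun_eq_iff indicator_def less_Suc_eq)
    finally show ?case .
  qed
  show ?case
    by (rule approximable_bounded_limit[OF fin, where B=1]) (use LIMSEQ_indicator_UN in \<open>auto simp: indicator_le_1\<close>)
qed

lemma square_integrable_approximable:
  assumes [measurable]: "g \<in> borel_measurable M" and int: "integrable M (\<lambda>x. (g x)\<^sup>2)"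
  shows "approximable g"
proof -
  obtain s where S: "(\<forall>i. simple_function M (s i)) \<and> (\<forall>x\<in>space M. (\<lambda>i. s i x) \<longlonglongrightarrow> g x) \<and>
      (\<forall>i. \<forall>x\<in>space M. dist (s i x) 0 \<le> 2 * dist (g x) 0)"
    using borel_measurable_implies_sequence_metric[OF assms(1), of 0] by (rule exE)
  note s = S[THEN conjunct1, THEN spec] S[THEN conjunct2, THEN conjunct1, THEN bspec]
    S[THEN conjunct2, THEN conjunct2, THEN spec, THEN bspec]
  have simple: "approximable (s i)" for i
  proof -
    have 1: "approximable (\<lambda>x. y * indicator (s i -` {y} \<inter> space M) x)" for y
      by (rule approximable_cmult[OF approximable_indicator[OF simple_functionD(2)[OF s(1)]]])
    have 2: "approximable (\<lambda>x. \<Sum>y\<in>s i ` space M. y * indicator (s i -` {y} \<inter> space M) x)"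
      by (rule approximable_sum[OF 1])
    have 3: "(\<Sum>y\<in>s i ` space M. y * indicator (s i -` {y} \<inter> space M) x) = s i x" if x: "x \<in> space M" for x
    proof -
      have "(\<Sum>y\<in>s i ` space M. y * indicator (s i -` {y} \<inter> space M) x)
          = (\<Sum>y\<in>s i ` space M. if y = s i x then y else 0)"
        using x by (intro sum.cong refl) (auto simp: indicator_def)
      also have "\<dots> = s i x"
        using x simple_functionD(1)[OF s(1)] by (subst sum.delta) auto
      finally show ?thesis .
    qed
    have "approximable (\<lambda>x. \<Sum>y\<in>s i ` space M. y * indicator (s i -` {y} \<inter> space M) x) = approximable (s i)"
      by (rule approximable_cong) (rule 3)
    with 2 show ?thesis by simp
  qed
  show ?thesis
  proof (rule approximable_dominated[OF simple _ _ _ _ s(2), where w="\<lambda>x. 9 * (g x)\<^sup>2"])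
    show "(\<integral>\<^sup>+x. ennreal (9 * (g x)\<^sup>2) \<partial>M) < \<infinity>"
      using int by (subst nn_integral_eq_integral) auto
    fix i x assume "x \<in> space M"
    from s(3)[OF this, of i] have "\<bar>s i x - g x\<bar> \<le> \<bar>3 * g x\<bar>" by (simp add: dist_norm)
    then have "(s i x - g x)\<^sup>2 \<le> (3 * g x)\<^sup>2" by (simp only: abs_le_square_iff)
    then show "(s i x - g x)\<^sup>2 \<le> 9 * (g x)\<^sup>2" by (simp add: power_mult_distrib)
  qed auto
qed

end

section \<open>Characters, square-integrable functions and the exponentials on a small cube\<close>

text \<open>
  The normalization with \<open>2 \<pi>\<close> in the exponent makes \<open>E (ivec k) (ivec l) = 1\<close>.
\<close>

definition E :: "real ^ 'n \<Rightarrow> real ^ 'n \<Rightarrow> complex" where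
  "E t y = cis (- 2 * pi * (t \<bullet> y))"

lemma E_add_left: "E (s + t) y = E s y * E t y"
  by (simp add: E_def cis_mult inner_add_left algebra_simps)

lemma E_add_right: "E t (x + y) = E t x * E t y"
  by (simp add: E_def cis_mult inner_add_right algebra_simps)

lemma E_zero [simp]: "E 0 y = 1" "E t 0 = 1"
  by (simp_all add: E_def)

lemma norm_E [simp]: "cmod (E t y) = 1"
  by (simp add: E_def)

lemma cnj_E: "cnj (E t y) = E (- t) y"
  by (simp add: E_def cis_cnj)

lemma E_minus_mult: "E (- t) y * E t y = 1" "E t y * E (- t) y = 1"
  by (simp_all flip: E_add_left)

lemma continuous_E [continuous_intros]:
  "continuous_on S f \<Longrightarrow> continuous_on S g \<Longrightarrow> continuous_on S (\<lambda>x. E (f x) (g x))"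
  unfolding E_def cis_conv_exp by (intro continuous_intros)

lemma measurable_E [measurable (raw)]:
  "f \<in> borel_measurable M \<Longrightarrow> g \<in> borel_measurable M \<Longrightarrow> (\<lambda>x. E (f x) (g x)) \<in> borel_measurable M"
  by (rule borel_measurable_continuous_Pair) (auto intro!: continuous_intros)

definition ivec :: "int ^ 'n \<Rightarrow> real ^ 'n" where
  "ivec k = (\<chi> i. of_int (k $ i))"

lemma ivec_simps [simp]:
  "ivec k $ i = of_int (k $ i)" "ivec 0 = 0" "ivec (- k) = - ivec k"
  "ivec (k + l) = ivec k + ivec l" "ivec (k - l) = ivec k - ivec l"
  by (simp_all add: ivec_def vec_eq_iff)

lemma ivec_inj [simp]: "ivec k = ivec l \<longleftrightarrow> k = l"
  by (simp add: vec_eq_iff)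

lemma E_ivec_ivec [simp]: "E (ivec k) (ivec l) = 1"
proof -
  have "ivec k \<bullet> ivec l = of_int (\<Sum>i\<in>UNIV. k $ i * l $ i)"
    by (simp add: inner_vec_def)
  then have "E (ivec k) (ivec l) = cis (2 * pi * of_int (- (\<Sum>i\<in>UNIV. k $ i * l $ i)))"
    unfolding E_def by (simp add: algebra_simps)
  also have "\<dots> = 1" by (rule cis_multiple_2pi) (rule Ints_of_int)
  finally show ?thesis .
qed

text \<open>
  The functions vanish outside \<open>S\<close> everywhere, not only almost everywhere; this makes sums over
  translates of \<open>S\<close> pointwise identities.
\<close>

definition L2on :: "(real ^ 'n) set \<Rightarrow> (real ^ 'n \<Rightarrow> complex) \<Rightarrow> bool" where
  "L2on S G \<longleftrightarrow> G \<in> borel_measurable borel \<and> integrable lborel (\<lambda>x. (cmod (G x))\<^sup>2) \<and> (\<forall>x. x \<notin> S \<longrightarrow> G x = 0)"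

definition sq_norm :: "(real ^ 'n \<Rightarrow> complex) \<Rightarrow> real" where
  "sq_norm G = (LINT x|lborel. (cmod (G x))\<^sup>2)"

lemma sq_norm_nonneg [simp]: "sq_norm G \<ge> 0"
  by (simp add: sq_norm_def)

lemma L2onD:
  assumes "L2on S G"
  shows "G \<in> borel_measurable borel" "integrable lborel (\<lambda>x. (cmod (G x))\<^sup>2)" "x \<notin> S \<Longrightarrow> G x = 0"
  using assms by (auto simp: L2on_def)

lemma L2on_mono: "L2on S G \<Longrightarrow> S \<subseteq> T \<Longrightarrow> L2on T G"
  by (auto simp: L2on_def)

lemma sum_sq_le: "(cmod (a + b))\<^sup>2 \<le> 2 * (cmod a)\<^sup>2 + 2 * (cmod b)\<^sup>2"
proof -
  have "(cmod (a + b))\<^sup>2 \<le> (cmod a + cmod b)\<^sup>2"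
    by (intro power_mono norm_triangle_ineq) auto
  also have "\<dots> \<le> 2 * (cmod a)\<^sup>2 + 2 * (cmod b)\<^sup>2"
    using zero_le_power2[of "cmod a - cmod b"] by (simp add: power2_eq_square algebra_simps)
  finally show ?thesis .
qed

lemma L2on_bound:
  assumes "G \<in> borel_measurable borel" "integrable lborel w" "\<And>x. (cmod (G x))\<^sup>2 \<le> w x" "\<And>x. x \<notin> S \<Longrightarrow> G x = 0"
  shows "L2on S G"
  unfolding L2on_def
proof (intro conjI)
  show "integrable lborel (\<lambda>x. (cmod (G x))\<^sup>2)"
    by (rule Bochner_Integration.integrable_bound[OF assms(2)]) 
      (use assms(1,3) in \<open>auto intro!: AE_I2 intro: order_trans[OF _ abs_ge_self]\<close>)
qed (use assms in auto)

lemma L2on_add: "L2on S F \<Longrightarrow> L2on S G \<Longrightarrow> L2on S (\<lambda>x. F x + G x)"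
  by (rule L2on_bound[where w="\<lambda>x. 2 * (cmod (F x))\<^sup>2 + 2 * (cmod (G x))\<^sup>2"])
    (auto simp: L2on_def intro: sum_sq_le)

lemma L2on_mult:
  assumes "L2on S G" "b \<in> borel_measurable borel" "\<And>x. x \<in> S \<Longrightarrow> cmod (b x) \<le> B"
  shows "L2on S (\<lambda>x. b x * G x)" "sq_norm (\<lambda>x. b x * G x) \<le> B\<^sup>2 * sq_norm G"
proof -
  have le: "(cmod (b x * G x))\<^sup>2 \<le> B\<^sup>2 * (cmod (G x))\<^sup>2" for x
  proof (cases "x \<in> S")
    case True
    then show ?thesis using assms(3)[OF True]
      by (simp add: norm_mult power_mult_distrib power_mono mult_right_mono)
  qed (use assms(1) in \<open>auto simp: L2on_def\<close>)
  show L: "L2on S (\<lambda>x. b x * G x)"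
    using assms(1,2) le by (intro L2on_bound[where w="\<lambda>x. B\<^sup>2 * (cmod (G x))\<^sup>2"]) (auto simp: L2on_def)
  have "sq_norm (\<lambda>x. b x * G x) \<le> (LINT x|lborel. B\<^sup>2 * (cmod (G x))\<^sup>2)"
    unfolding sq_norm_def using assms L le by (intro integral_mono) (auto simp: L2on_def)
  then show "sq_norm (\<lambda>x. b x * G x) \<le> B\<^sup>2 * sq_norm G" by (simp add: sq_norm_def)
qed

lemma L2on_zero: "L2on S (\<lambda>_. 0)"
  by (simp add: L2on_def)

lemma L2on_sum: "(\<And>i. i \<in> I \<Longrightarrow> L2on S (F i)) \<Longrightarrow> L2on S (\<lambda>x. \<Sum>i\<in>I. F i x)"
  by (induction I rule: infinite_finite_induct) (auto intro: L2on_add L2on_zero)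

lemma finite_indicator_bounded:
  assumes "S \<in> sets borel" "bounded (S :: (real ^ 'n) set)"
  shows "integrable lborel (indicator S :: _ \<Rightarrow> real)"
proof -
  note emeasure_bounded_finite[OF assms(2)]
  then show ?thesis using assms by (simp add: integrable_indicator_iff)
qed

lemma L2on_integrable:
  assumes "L2on S G" "bounded S"
  shows "integrable lborel G"
proof -
  obtain a b where ab: "S \<subseteq> cbox a b" using assms(2) bounded_subset_cbox_symmetric by metis
  show ?thesis
  proof (rule Bochner_Integration.integrable_bound[where f="\<lambda>x. indicator (cbox a b) x + (cmod (G x))\<^sup>2"])
    show "integrable lborel (\<lambda>x. indicator (cbox a b) x + (cmod (G x))\<^sup>2)"
      using assms(1) finite_indicator_bounded[of "cbox a b"] by (simp add: L2on_def)
    have "cmod (G x) \<le> indicator (cbox a b) x + (cmod (G x))\<^sup>2" for x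
    proof (cases "x \<in> S")
      case True
      have "cmod (G x) \<le> 1 + (cmod (G x))\<^sup>2"
        using zero_le_power2[of "cmod (G x) - 1"] zero_le_power2[of "cmod (G x)"]
        using norm_ge_zero[of "G x"] unfolding power2_diff by (simp del: zero_le_power2 norm_ge_zero)
      then show ?thesis using True ab by (auto simp: indicator_def)
    qed (use assms in \<open>auto simp: L2on_def\<close>)
    then show "AE x in lborel. norm (G x) \<le> norm (indicator (cbox a b) x + (cmod (G x))\<^sup>2)"
      by (intro AE_I2) (metis abs_ge_self order_trans real_norm_def)
  qed (use assms in \<open>auto simp: L2on_def\<close>)
qed

lemma L2on_integrable_mult:
  assumes "L2on S G" "bounded S" "b \<in> borel_measurable borel" "\<And>x. cmod (b x) \<le> B"
  shows "integrable lborel (\<lambda>x. b x * G x)"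
  using L2on_integrable[OF L2on_mult(1)[OF assms(1,3,4)] assms(2)] by simp

definition ft :: "(real ^ 'n \<Rightarrow> complex) \<Rightarrow> real ^ 'n \<Rightarrow> complex" where
  "ft G t = (LINT y|lborel. E t y * G y)"

lemma integrable_E_mult:
  assumes "L2on S G" "bounded S" shows "integrable lborel (\<lambda>y. E t y * G y)"
  by (rule L2on_integrable_mult[OF assms, where B=1]) auto

lemma ft_sum:
  assumes "\<And>i. i \<in> I \<Longrightarrow> L2on S (F i)" "bounded S"
  shows "ft (\<lambda>x. \<Sum>i\<in>I. F i x) t = (\<Sum>i\<in>I. ft (F i) t)"
  unfolding ft_def sum_distrib_left
  by (rule Bochner_Integration.integral_sum) (use integrable_E_mult assms in auto)

definition cube :: "nat \<Rightarrow> (real ^ 'n) set" where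
  "cube N = {u. \<forall>i. 0 \<le> u $ i \<and> u $ i < 1 / real N}"

lemma cube_borel [measurable]: "cube N \<in> sets borel"
proof -
  have "cube N = (\<Inter>i. {u :: real^'n. 0 \<le> u $ i} \<inter> {u. u $ i < 1 / real N})"
    by (auto simp: cube_def)
  also have "\<dots> \<in> sets borel"
    by (intro sets.finite_INT) (auto intro!: borel_closed borel_open closed_Collect_le open_Collect_less continuous_intros)
  finally show ?thesis .
qed

lemma bounded_cube [simp]: "bounded (cube N)"
proof -
  have "cube N \<subseteq> cbox 0 (\<chi> i. 1 / real N)" by (auto simp: cube_def mem_box_cart less_imp_le)
  then show ?thesis using bounded_cbox bounded_subset by blast
qed

lemma vec_Basis: "(Basis :: (real ^ 'n) set) = (\<lambda>i. axis i 1) ` UNIV"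
  by (auto simp: Basis_vec_def)

text \<open>
  Lebesgue measure is the image of the product measure indexed by the standard basis, so this is
  Fubini for a product of functions of one coordinate each.
\<close>

lemma lborel_integral_prod:
  fixes f :: "'n::finite \<Rightarrow> real \<Rightarrow> complex"
  assumes int: "\<And>i. integrable lborel (f i)"
  shows "(LINT x|(lborel :: (real ^ 'n) measure). (\<Prod>i\<in>UNIV. f i (x $ i))) = (\<Prod>i\<in>UNIV. LINT t|lborel. f i t)"
proof -
  interpret product_sigma_finite "\<lambda>_::real ^ 'n. lborel :: real measure" by standard
  let ?B = "Basis :: (real ^ 'n) set"
  let ?g = "\<lambda>b :: real ^ 'n. f (SOME i. b = axis i 1)"
  have inj: "inj (\<lambda>i::'n. axis i (1::real))" by (auto simp: inj_def axis_eq_axis)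
  have g: "?g (axis i 1) = f i" for i by (simp add: axis_eq_axis)
  have meas[measurable]: "f i \<in> borel_measurable borel" for i using int[of i] by auto
  have "(LINT x|(lborel :: (real ^ 'n) measure). (\<Prod>i\<in>UNIV. f i (x $ i))) 
     = (LINT x|distr (\<Pi>\<^sub>M b\<in>?B. lborel) borel (\<lambda>f. \<Sum>b\<in>?B. f b *\<^sub>R b). (\<Prod>i\<in>UNIV. f i (x $ i)))"
    by (subst lborel_eq) simp
  also have "\<dots> = (LINT x|(\<Pi>\<^sub>M b\<in>?B. lborel). (\<Prod>i\<in>UNIV. f i ((\<Sum>b\<in>?B. x b *\<^sub>R b) $ i)))"
    by (rule integral_distr) measurable
  also have "\<dots> = (LINT x|(\<Pi>\<^sub>M b\<in>?B. lborel). (\<Prod>b\<in>?B. ?g b (x b)))"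
  proof (intro Bochner_Integration.integral_cong refl)
    fix x :: "real ^ 'n \<Rightarrow> real"
    have "(\<Sum>b\<in>?B. x b *\<^sub>R b) $ i = x (axis i 1)" for i
      unfolding vec_Basis by (subst sum.reindex[OF inj]) (simp add: axis_def if_distrib cong: if_cong)
    then show "(\<Prod>i\<in>UNIV. f i ((\<Sum>b\<in>?B. x b *\<^sub>R b) $ i)) = (\<Prod>b\<in>?B. ?g b (x b))"
      unfolding vec_Basis by (subst prod.reindex[OF inj]) (simp add: g)
  qed
  also have "\<dots> = (\<Prod>b\<in>?B. LINT t|lborel. ?g b t)"
    by (rule product_integral_prod) (use int in auto)
  also have "\<dots> = (\<Prod>i\<in>UNIV. LINT t|lborel. f i t)"
    unfolding vec_Basis by (subst prod.reindex[OF inj]) (simp add: g)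
  finally show ?thesis .
qed

lemma integral_cis_interval:
  fixes k :: int assumes N: "N > 0"
  shows "(LINT t|lborel. indicator {0..<1 / real N} t *\<^sub>R cis (- 2 * pi * (real N * of_int k * t))) = (if k = 0 then 1 / real N else 0)"
    and "integrable lborel (\<lambda>t. indicator {0..<1 / real N} t *\<^sub>R cis (- 2 * pi * (real N * of_int k * t)))"
proof -
  let ?f = "\<lambda>t. cis (- 2 * pi * (real N * of_int k * t))"
  have cont: "continuous_on S ?f" for S unfolding cis_conv_exp by (intro continuous_intros)
  have int: "integrable lborel (\<lambda>t. indicator {0..1 / real N} t *\<^sub>R ?f t)"
    using borel_integrable_atLeastAtMost'[OF cont] by (simp add: set_integrable_def)
  have m: "(\<lambda>t. indicator A t *\<^sub>R ?f t) \<in> borel_measurable borel" if "A \<in> sets borel" for A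
    by (intro borel_measurable_scaleR borel_measurable_indicator borel_measurable_continuous_onI cont that)
  have AE: "AE t in lborel. indicator {0..<1 / real N} t *\<^sub>R ?f t = indicator {0..1 / real N} t *\<^sub>R ?f t"
    using AE_lborel_singleton[of "1 / real N"] by eventually_elim (auto simp: indicator_def)
  show "integrable lborel (\<lambda>t. indicator {0..<1 / real N} t *\<^sub>R ?f t)"
    by (subst integrable_cong_AE[OF _ _ AE]) (use int m in auto)
  have "(LINT t|lborel. indicator {0..<1 / real N} t *\<^sub>R ?f t) = (LINT t|lborel. indicator {0..1 / real N} t *\<^sub>R ?f t)"
    by (rule integral_cong_AE) (use AE m in auto)
  also have "\<dots> = (if k = 0 then 1 / real N else 0)"
  proof (cases "k = 0")
    case True
    then show ?thesis using N by (simp add: measure_def scaleR_conv_of_real)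
  next
    case False
    define c where "c = - 2 * pi * real N * of_int k"
    have c: "c \<noteq> 0" using False N by (simp add: c_def)
    have f: "?f t = exp (\<i> * of_real (c * t))" for t
      by (simp add: cis_conv_exp c_def mult_ac)
    have der: "((\<lambda>t. exp (\<i> * of_real (c * t)) / (\<i> * of_real c)) has_vector_derivative ?f t) (at t within S)" for t S
      unfolding f using c
      by (auto intro!: derivative_eq_intros has_vector_derivative_real_field simp: field_simps)
    have "(LINT t|lborel. indicator {0..1 / real N} t *\<^sub>R ?f t) 
       = exp (\<i> * of_real (c * (1 / real N))) / (\<i> * of_real c) - exp (\<i> * of_real (c * 0)) / (\<i> * of_real c)"
      by (rule integral_FTC_atLeastAtMost[OF _ der cont]) simp
    also have "exp (\<i> * of_real (c * (1 / real N))) = cis (2 * pi * of_int (- k))"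
      using N by (simp add: cis_conv_exp c_def mult.assoc)
    also have "\<dots> = 1" by (rule cis_multiple_2pi) (rule Ints_of_int)
    finally show ?thesis using False by simp
  qed
  finally show "(LINT t|lborel. indicator {0..<1 / real N} t *\<^sub>R ?f t) = (if k = 0 then 1 / real N else 0)" .
qed

abbreviation fexp :: "nat \<Rightarrow> int ^ 'n \<Rightarrow> real ^ 'n \<Rightarrow> complex" where
  "fexp N k \<equiv> E (real N *\<^sub>R ivec k)"

lemma orthogonality:
  fixes k :: "int ^ 'n"
  assumes N: "N > 0"
  shows "(LINT u|lborel. indicator (cube N) u *\<^sub>R fexp N k u) = (if k = 0 then (1 / real N) ^ CARD('n) else 0)"
proof -
  let ?f = "\<lambda>i t. indicator {0..<1 / real N} t *\<^sub>R cis (- 2 * pi * (real N * of_int (k $ i) * t)) :: complex"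
  have cis_sum: "cis (\<Sum>i\<in>A. g i) = (\<Prod>i\<in>A. cis (g i))" for A :: "'n set" and g
    by (induction A rule: infinite_finite_induct) (auto simp flip: cis_mult)
  have "indicator (cube N) u *\<^sub>R fexp N k u = (\<Prod>i\<in>UNIV. ?f i (u $ i))" for u :: "real ^ 'n"
  proof -
    have "(\<Prod>i\<in>UNIV. ?f i (u $ i)) = (\<Prod>i\<in>UNIV. of_real (indicator {0..<1 / real N} (u $ i))) * 
      (\<Prod>i\<in>UNIV. cis (- 2 * pi * (real N * of_int (k $ i) * u $ i)))"
      by (simp add: scaleR_conv_of_real prod.distrib)
    also have "(\<Prod>i\<in>UNIV. of_real (indicator {0..<1 / real N} (u $ i))) = (of_real (indicator (cube N) u) :: complex)"
    proof (cases "u \<in> cube N")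
      case False
      then obtain i where "\<not> (0 \<le> u $ i \<and> u $ i < 1 / real N)" by (auto simp: cube_def)
      then have "(\<Prod>i\<in>UNIV. of_real (indicator {0..<1 / real N} (u $ i))) = (0::complex)"
        by (intro prod_zero bexI[of _ i]) auto
      then show ?thesis using False by simp
    qed (auto simp: cube_def)
    also have "(\<Prod>i\<in>UNIV. cis (- 2 * pi * (real N * of_int (k $ i) * u $ i))) = fexp N k u"
      by (simp flip: cis_sum add: E_def inner_vec_def sum_distrib_left mult_ac)
    finally show ?thesis by (simp add: scaleR_conv_of_real)
  qed
  then have "(LINT u|lborel. indicator (cube N) u *\<^sub>R fexp N k u) = (\<Prod>i\<in>UNIV. LINT t|lborel. ?f i t)"
    using lborel_integral_prod[of ?f] integral_cis_interval(2)[OF N] by simp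
  also have "\<dots> = (\<Prod>i\<in>UNIV. if k $ i = 0 then 1 / real N else 0)"
    unfolding integral_cis_interval(1)[OF N] of_real_prod by (intro prod.cong) auto
  also have "\<dots> = (if k = 0 then (1 / real N) ^ CARD('n) else 0)"
  proof (cases "k = 0")
    case False
    then obtain i where "k $ i \<noteq> 0" by (auto simp: vec_eq_iff)
    then show ?thesis using False by (auto intro!: prod_zero)
  qed simp
  finally show ?thesis .
qed

section \<open>Trigonometric polynomials are square_integrable_approximable on the cube\<close>

text \<open>
  The inductive definition gives closure under products by two nested inductions. The explicit finite sum is
  recovered in \<open>trig_span_sum\<close>.
\<close>

inductive_set trig_span :: "nat \<Rightarrow> (real ^ 'n \<Rightarrow> complex) set" for N where
  mono: "(\<lambda>u. c * fexp N k u) \<in> trig_span N"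
| add: "p \<in> trig_span N \<Longrightarrow> q \<in> trig_span N \<Longrightarrow> (\<lambda>u. p u + q u) \<in> trig_span N"

lemma trig_span_const: "(\<lambda>u. c) \<in> trig_span N"
  using trig_span.mono[where c=c and k=0 and N=N] by (simp only: ivec_simps scaleR_zero_right E_zero mult_1_right)

lemma trig_span_mult:
  assumes "p \<in> trig_span N" "q \<in> trig_span N"
  shows "(\<lambda>u. p u * q u) \<in> trig_span N"
  using assms(1)
proof (induction p rule: trig_span.induct)
  case (mono c k)
  show ?case using assms(2)
  proof (induction q rule: trig_span.induct)
    case (mono d l)
    have "(\<lambda>u. c * fexp N k u * (d * fexp N l u)) = (\<lambda>u. (c * d) * fexp N (k + l) u)"
      by (simp add: fun_eq_iff E_add_left scaleR_add_right)
    then show ?case using trig_span.mono by metis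
  next
    case (add p q)
    then show ?case using trig_span.add[OF add(3,4)] by (simp add: distrib_left)
  qed
next
  case (add p q)
  then show ?case using trig_span.add[OF add(3,4)] by (simp add: distrib_right)
qed

lemma trig_span_measurable: "p \<in> trig_span N \<Longrightarrow> p \<in> borel_measurable borel"
proof (induction rule: trig_span.induct)
  case (mono c k)
  show ?case by measurable
next
  case (add p q)
  show ?case by (rule borel_measurable_add[OF add(3,4)])
qed

lemma trig_span_bounded: "p \<in> trig_span N \<Longrightarrow> \<exists>B. \<forall>u. cmod (p u) \<le> B"
proof (induction rule: trig_span.induct)
  case (mono c k)
  show ?case by (intro exI[of _ "cmod c"]) (simp add: norm_mult)
next
  case (add p q)
  then obtain B C where "\<And>u. cmod (p u) \<le> B" "\<And>u. cmod (q u) \<le> C" by blast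
  then have "cmod (p u + q u) \<le> B + C" for u by (meson norm_triangle_mono)
  then show ?case by blast
qed

lemma trig_span_sum:
  "p \<in> trig_span N \<Longrightarrow> \<exists>K c. finite K \<and> p = (\<lambda>u. \<Sum>k\<in>K. c k * cnj (fexp N k u))"
proof (induction rule: trig_span.induct)
  case (mono c k)
  show ?case 
    by (intro exI[of _ "{- k}"] exI[of _ "\<lambda>_. c"]) (simp add: cnj_E)
next
  case (add p q)
  obtain K b where p: "finite K" "p = (\<lambda>u. \<Sum>k\<in>K. b k * cnj (fexp N k u))"
    using add(3) by (elim exE conjE)
  obtain L c where q: "finite L" "q = (\<lambda>u. \<Sum>k\<in>L. c k * cnj (fexp N k u))"
    using add(4) by (elim exE conjE)
  let ?d = "\<lambda>k. (if k \<in> K then b k else 0) + (if k \<in> L then c k else 0)"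
  have 1: "p = (\<lambda>u. \<Sum>k\<in>K \<union> L. (if k \<in> K then b k else 0) * cnj (fexp N k u))"
    unfolding p(2) using p(1) q(1) by (intro ext sum.mono_neutral_cong_left) auto
  have 2: "q = (\<lambda>u. \<Sum>k\<in>K \<union> L. (if k \<in> L then c k else 0) * cnj (fexp N k u))"
    unfolding q(2) using p(1) q(1) by (intro ext sum.mono_neutral_cong_left) auto
  have 3: "(\<lambda>u. p u + q u) = (\<lambda>u. \<Sum>k\<in>K \<union> L. ?d k * cnj (fexp N k u))"
    unfolding 1 2 by (simp add: sum.distrib distrib_right)
  show ?case
    by (intro exI[of _ "K \<union> L"] exI[of _ ?d] conjI finite_UnI p(1) q(1) 3)
qed

definition real_trig :: "nat \<Rightarrow> (real ^ 'n \<Rightarrow> real) set" where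
  "real_trig N = {f. (\<lambda>u. of_real (f u)) \<in> trig_span N}"

lemma real_trig_cos_sin:
  fixes i :: "'n::finite"
  shows
  "(\<lambda>u. cos (2 * pi * (real N * u $ i))) \<in> real_trig N" and
  "(\<lambda>u. sin (2 * pi * (real N * u $ i))) \<in> real_trig N"
proof -
  have *: "fexp N (axis i 1) u = cis (- (2 * pi * (real N * u $ i)))"
          "fexp N (- axis i 1) u = cis (2 * pi * (real N * u $ i))" for u :: "real ^ 'n"
  proof -
    have "ivec (axis i 1) \<bullet> u = u $ i"
      by (simp add: inner_vec_def axis_def ivec_def if_distrib[of of_int] if_distrib[of "\<lambda>x. x * _"] cong: if_cong)
    then show "fexp N (axis i 1) u = cis (- (2 * pi * (real N * u $ i)))"
          "fexp N (- axis i 1) u = cis (2 * pi * (real N * u $ i))"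
      by (auto simp: E_def)
  qed
  have "(\<lambda>u. of_real (cos (2 * pi * (real N * u $ i)))) 
     = (\<lambda>u. (1/2) * fexp N (axis i 1) u + (1/2) * fexp N (- axis i 1) u)"
    unfolding * by (auto simp: fun_eq_iff complex_eq_iff)
  moreover have "\<dots> \<in> trig_span N"
    by (rule trig_span.add[OF trig_span.mono trig_span.mono])
  ultimately show "(\<lambda>u. cos (2 * pi * (real N * u $ i))) \<in> real_trig N"
    by (simp add: real_trig_def)
  have "(\<lambda>u. of_real (sin (2 * pi * (real N * u $ i)))) 
     = (\<lambda>u. (\<i>/2) * fexp N (axis i 1) u + (-\<i>/2) * fexp N (- axis i 1) u)"
    unfolding * by (auto simp: fun_eq_iff complex_eq_iff)
  moreover have "\<dots> \<in> trig_span N"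
    by (rule trig_span.add[OF trig_span.mono trig_span.mono])
  ultimately show "(\<lambda>u. sin (2 * pi * (real N * u $ i))) \<in> real_trig N"
    by (simp add: real_trig_def)
qed

text \<open>
  An angle in \<open>[0, 2 \<pi>)\<close> is a Borel function of its cosine and sine. The truncation to
  \<open>[-1, 1]\<close> makes \<open>arccos\<close> continuous on the whole line.
\<close>

lemma angle_from_cos_sin:
  assumes "0 \<le> t" "t < 2 * pi"
  shows "t = (if sin t \<ge> 0 then arccos (max (-1) (min 1 (cos t))) else 2 * pi - arccos (max (-1) (min 1 (cos t))))"
proof -
  have c: "max (-1) (min 1 (cos t)) = cos t" by (simp add: min_absorb2 max_absorb2)
  show ?thesis unfolding c
  proof (cases "t \<le> pi")
    case True
    then show "t = (if sin t \<ge> 0 then arccos (cos t) else 2 * pi - arccos (cos t))"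
      using assms sin_ge_zero[of t] by (simp add: arccos_cos)
  next
    case False
    then have "sin t < 0" using assms sin_lt_zero by simp
    moreover have "arccos (cos t) = 2 * pi - t"
      using False assms arccos_cos[of "2 * pi - t"] by (simp add: cos_diff)
    ultimately show "t = (if sin t \<ge> 0 then arccos (cos t) else 2 * pi - arccos (cos t))" by simp
  qed
qed

text \<open>
  On the half-open cube each coordinate is a Borel function of two trigonometric polynomials,
  its cosine and its sine.
\<close>

lemma real_trig_generates:
  fixes A :: "(real ^ 'n) set"
  assumes N: "N > 0" and A: "A \<in> sets (restrict_space lborel (cube N))"
  shows "A \<in> sigma_sets (cube N) {{x \<in> cube N. a < f x} | f a. f \<in> real_trig N}"
proof -
  let ?G = "{{x \<in> cube N :: (real ^ 'n) set. a < f x} | f a. f \<in> real_trig N}"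
  let ?S = "sigma (cube N) ?G"
  have sub: "?G \<subseteq> Pow (cube N)" by auto
  have space: "space ?S = cube N" using space_measure_of[OF sub] .
  have f: "f \<in> borel_measurable ?S" if "f \<in> real_trig N" for f
  proof (rule borel_measurableI_greater)
    fix a show "{x \<in> space ?S. a < f x} \<in> sets ?S"
      unfolding space using that by (subst sets_measure_of[OF sub]) (auto intro!: sigma_sets.Basic)
  qed
  have arc[measurable]: "(\<lambda>t::real. arccos (max (-1) (min 1 t))) \<in> borel_measurable borel"
    by (intro borel_measurable_continuous_onI continuous_on_arccos continuous_intros) auto
  have id: "(\<lambda>x. x) \<in> measurable ?S (borel :: (real ^ 'n) measure)"
  proof (subst borel_measurable_euclidean_space, rule ballI)
    fix b :: "real ^ 'n" assume "b \<in> Basis"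
    then obtain i where b: "b = axis i 1" by (auto simp: vec_Basis)
    let ?c = "\<lambda>u :: real ^ 'n. cos (2 * pi * (real N * u $ i))"
    let ?s = "\<lambda>u :: real ^ 'n. sin (2 * pi * (real N * u $ i))"
    have [measurable]: "?c \<in> borel_measurable ?S" "?s \<in> borel_measurable ?S"
      using f real_trig_cos_sin by blast+
    let ?h = "\<lambda>u. (if ?s u \<ge> 0 then arccos (max (-1) (min 1 (?c u))) else 2 * pi - arccos (max (-1) (min 1 (?c u)))) / (2 * pi * real N)"
    have "?h \<in> borel_measurable ?S" by measurable
    moreover have "?h x = x \<bullet> b" if "x \<in> space ?S" for x
    proof -
      have "0 \<le> 2 * pi * (real N * x $ i)" "2 * pi * (real N * x $ i) < 2 * pi"
        using that N unfolding space by (auto simp: cube_def field_simps)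
      from angle_from_cos_sin[OF this] show ?thesis
        using N by (simp add: b inner_axis field_simps)
    qed
    ultimately show "(\<lambda>x. x \<bullet> b) \<in> borel_measurable ?S"
      using measurable_cong[of ?S ?h "\<lambda>x. x \<bullet> b" borel] by simp
  qed
  obtain A' where A': "A' \<in> sets borel" "A = A' \<inter> cube N"
    using A by (auto simp: sets_restrict_space)
  have "(\<lambda>x. x) -` A' \<inter> space ?S \<in> sets ?S" by (rule measurable_sets[OF id A'(1)])
  then show ?thesis unfolding space A' using sets_measure_of[OF sub] by simp
qed

lemma real_trig_dense:
  fixes g :: "real ^ 'n \<Rightarrow> real"
  assumes N: "N > 0" and g: "g \<in> borel_measurable borel" "integrable lborel (\<lambda>x. (g x)\<^sup>2)"
    and e: "e > 0"
  shows "\<exists>f\<in>real_trig N. (LINT x|lborel. indicator (cube N) x * (g x - f x)\<^sup>2) < e"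
proof -
  let ?M = "restrict_space lborel (cube N :: (real ^ 'n) set)"
  have M: "space ?M = cube N" by (simp add: space_restrict_space)
  have rt_meas: "f \<in> borel_measurable borel" if "f \<in> real_trig N" for f :: "real ^ 'n \<Rightarrow> real"
  proof -
    have "(\<lambda>u. Re (of_real (f u))) \<in> borel_measurable borel"
      using trig_span_measurable[of "\<lambda>u. complex_of_real (f u)" N] that
      unfolding real_trig_def borel_measurable_complex_iff by auto
    then show ?thesis by simp
  qed
  interpret finite_measure ?M
  proof (rule finite_measureI)
    have "emeasure lborel (cube N :: (real ^ 'n) set) < \<infinity>"
      by (rule emeasure_bounded_finite) simp
    then show "emeasure ?M (space ?M) \<noteq> \<infinity>"
      by (simp add: M emeasure_restrict_space)
  qed
  interpret bounded_function_algebra ?M "real_trig N"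
  proof unfold_locales
    show "f \<in> borel_measurable ?M" if "f \<in> real_trig N" for f
      using rt_meas[OF that] by (intro measurable_restrict_space1) auto
    show "\<exists>B. \<forall>x\<in>space ?M. \<bar>f x\<bar> \<le> B" if "f \<in> real_trig N" for f
      using trig_span_bounded[of "\<lambda>u. of_real (f u)" N] that by (auto simp: real_trig_def)
    show "(\<lambda>_. c) \<in> real_trig N" for c by (simp add: real_trig_def trig_span_const)
    show "(\<lambda>x. f x + g x) \<in> real_trig N" "(\<lambda>x. f x * g x) \<in> real_trig N"
      if "f \<in> real_trig N" "g \<in> real_trig N" for f g
      using that trig_span.add trig_span_mult by (auto simp: real_trig_def)
    show "A \<in> sigma_sets (space ?M) {{x \<in> space ?M. a < f x} |f a. f \<in> real_trig N}" if "A \<in> sets ?M" for A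
      using real_trig_generates[OF N that] by (simp add: M)
  qed
  have "integrable ?M (\<lambda>x. (g x)\<^sup>2)"
    using g integrable_mult_indicator[of "cube N" lborel "\<lambda>x. (g x)\<^sup>2"]
    by (simp add: integrable_restrict_space)
  then have "approximable g" using g(1) by (intro square_integrable_approximable measurable_restrict_space1) auto
  then obtain f where f: "f \<in> real_trig N" "dist2 g f < ennreal e" 
    using e unfolding approximable_def by blast
  have [measurable]: "g \<in> borel_measurable borel" "f \<in> borel_measurable borel" using g f rt_meas by auto
  have "dist2 g f = (\<integral>\<^sup>+x. ennreal (indicator (cube N) x * (g x - f x)\<^sup>2) \<partial>lborel)"
    unfolding dist2_def by (subst nn_integral_restrict_space) (auto intro!: nn_integral_cong simp: indicator_def)
  with f(2) have *: "(\<integral>\<^sup>+x. ennreal (indicator (cube N) x * (g x - f x)\<^sup>2) \<partial>lborel) < ennreal e" by simp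
  have "(LINT x|lborel. indicator (cube N) x * (g x - f x)\<^sup>2) = enn2real (\<integral>\<^sup>+x. ennreal (indicator (cube N) x * (g x - f x)\<^sup>2) \<partial>lborel)"
    by (rule integral_eq_nn_integral) auto
  also have "\<dots> < e" using * e
    by (cases "\<integral>\<^sup>+x. ennreal (indicator (cube N) x * (g x - f x)\<^sup>2) \<partial>lborel") (auto simp: ennreal_less_iff)
  finally show ?thesis using f(1) by blast
qed

section \<open>Bessel and Parseval on the cube\<close>

text \<open>
  Completing the square in the coefficients \<open>b\<close>. With the optimal coefficients it gives the Bessel
  inequality; with the coefficients of a good approximation it gives the Parseval inequality.
\<close>

lemma sq_norm_residual:
  fixes g :: "real ^ 'n \<Rightarrow> complex" and a b :: "int ^ 'n \<Rightarrow> complex"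
  assumes N: "N > 0" and g: "L2on (cube N) g" and K: "finite K"
  defines "a \<equiv> \<lambda>k. ft g (real N *\<^sub>R ivec k)"
  shows "(LINT u|lborel. indicator (cube N) u * (cmod (g u - (\<Sum>k\<in>K. b k * cnj (fexp N k u))))\<^sup>2)
     = sq_norm g - real N ^ CARD('n) * (\<Sum>k\<in>K. (cmod (a k))\<^sup>2) 
       + (\<Sum>k\<in>K. (cmod (b k - real N ^ CARD('n) * a k))\<^sup>2) / real N ^ CARD('n)"
proof -
  define W where "W = real N ^ CARD('n)"
  have W: "W > 0" using N by (simp add: W_def)
  define p where "p = (\<lambda>u. \<Sum>k\<in>K. b k * cnj (fexp N k u))"
  let ?I = "indicator (cube N) :: real ^ 'n \<Rightarrow> real"
  have "L2on (cube N) (\<lambda>u. of_real (?I u))"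
    using finite_indicator_bounded[of "cube N :: (real ^ 'n) set"]
    by (intro L2on_bound[where w="?I"]) (auto simp: indicator_def)
  then have intI: "integrable lborel (\<lambda>u. ?I u *\<^sub>R fexp N k u)" for k
    using integrable_E_mult[of "cube N" "\<lambda>u. of_real (?I u)" "real N *\<^sub>R ivec k"]
    by (simp add: scaleR_conv_of_real mult.commute)
  define s2 where "s2 = (\<lambda>u. (\<Sum>k\<in>K. cnj (b k) * (fexp N k u * g u)))"
  define s3 where "s3 = (\<lambda>u. (\<Sum>k\<in>K. \<Sum>l\<in>K. b k * cnj (b l) * (?I u *\<^sub>R fexp N (l - k) u)))"
  have expand: "?I u * (cmod (g u - p u))\<^sup>2 = (cmod (g u))\<^sup>2 - 2 * Re (s2 u) + Re (s3 u)" for u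
  proof (cases "u \<in> cube N")
    case True
    have 1: "g u * cnj (p u) = (\<Sum>k\<in>K. cnj (b k) * (fexp N k u * g u))"
      by (simp add: p_def sum_distrib_left mult_ac)
    have 2: "p u * cnj (p u) = (\<Sum>k\<in>K. \<Sum>l\<in>K. b k * cnj (b l) * fexp N (l - k) u)"
      unfolding p_def cnj_sum sum_product
      by (intro sum.cong refl) (simp add: cnj_E scaleR_diff_right E_add_left[symmetric] mult_ac flip: E_add_left)
    have "(cmod (g u - p u))\<^sup>2 = (cmod (g u))\<^sup>2 - 2 * Re (g u * cnj (p u)) + Re (p u * cnj (p u))"
      unfolding cmod_power2 by (simp add: power2_eq_square algebra_simps)
    then show ?thesis unfolding 1 2 s2_def s3_def using True by simp
  next
    case False
    then show ?thesis using L2onD(3)[OF g] by (simp add: s2_def s3_def)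
  qed
  have i1: "integrable lborel (\<lambda>u. (cmod (g u))\<^sup>2)" using L2onD(2)[OF g] .
  have i2: "integrable lborel s2"
    unfolding s2_def by (intro Bochner_Integration.integrable_sum integrable_mult_right integrable_E_mult[OF g]) simp
  have i3: "integrable lborel s3"
    unfolding s3_def by (intro Bochner_Integration.integrable_sum integrable_mult_right intI)
  have "(LINT u|lborel. ?I u * (cmod (g u - p u))\<^sup>2) = sq_norm g  - 2 * Re (LINT u|lborel. s2 u) + Re (LINT u|lborel. s3 u)"
    unfolding expand sq_norm_def using i1 integrable_Re[OF i2] integrable_Re[OF i3]
    by (simp add: integral_Re[OF i2] integral_Re[OF i3])
  also have "(LINT u|lborel. s2 u) = (\<Sum>k\<in>K. cnj (b k) * a k)"
    unfolding a_def ft_def s2_def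
    by (subst Bochner_Integration.integral_sum) (auto intro!: integrable_mult_right integrable_E_mult[OF g])
  also have "(LINT u|lborel. s3 u)
     = (\<Sum>k\<in>K. \<Sum>l\<in>K. b k * cnj (b l) * (LINT u|lborel. ?I u *\<^sub>R fexp N (l - k) u))"
  proof -
    have i4: "integrable lborel (\<lambda>u. b k * cnj (b l) * (?I u *\<^sub>R fexp N (l - k) u))" for k l
      by (intro integrable_mult_right intI)
    have "(LINT u|lborel. s3 u) = (\<Sum>k\<in>K. LINT u|lborel. (\<Sum>l\<in>K. b k * cnj (b l) * (?I u *\<^sub>R fexp N (l - k) u)))"
      unfolding s3_def by (rule Bochner_Integration.integral_sum) (intro Bochner_Integration.integrable_sum i4)
    also have "\<dots> = (\<Sum>k\<in>K. \<Sum>l\<in>K. LINT u|lborel. b k * cnj (b l) * (?I u *\<^sub>R fexp N (l - k) u))"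
      by (intro sum.cong refl Bochner_Integration.integral_sum i4)
    also have "\<dots> = (\<Sum>k\<in>K. \<Sum>l\<in>K. b k * cnj (b l) * (LINT u|lborel. ?I u *\<^sub>R fexp N (l - k) u))"
      by (intro sum.cong refl integral_mult_right_zero)
    finally show ?thesis .
  qed
  also have "\<dots> = (\<Sum>k\<in>K. \<Sum>l\<in>K. if l = k then b k * cnj (b k) / W else 0)"
    unfolding orthogonality[OF N] by (intro sum.cong refl) (auto simp: W_def power_one_over)
  also have "\<dots> = (\<Sum>k\<in>K. b k * cnj (b k) / W)" using K by (simp add: sum.delta)
  finally have eq: "(LINT u|lborel. ?I u * (cmod (g u - p u))\<^sup>2) = sq_norm g
      - 2 * Re (\<Sum>k\<in>K. cnj (b k) * a k) + Re (\<Sum>k\<in>K. b k * cnj (b k) / W)" .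
  have tm: "(cmod (b k - W * a k))\<^sup>2 / W = W * (cmod (a k))\<^sup>2 - 2 * Re (cnj (b k) * a k) + Re (b k * cnj (b k) / W)" for k
    using W unfolding cmod_power2 by (simp add: power2_eq_square field_simps)
  have "(\<Sum>k\<in>K. (cmod (b k - W * a k))\<^sup>2) / W = W * (\<Sum>k\<in>K. (cmod (a k))\<^sup>2) - 2 * Re (\<Sum>k\<in>K. cnj (b k) * a k) + Re (\<Sum>k\<in>K. b k * cnj (b k) / W)"
    unfolding sum_divide_distrib tm by (simp add: sum.distrib sum_subtractf sum_distrib_left Re_sum)
  then show ?thesis using eq unfolding p_def W_def[symmetric] by simp
qed

lemma bessel_cube:
  fixes g :: "real ^ 'n \<Rightarrow> complex"
  assumes N: "N > 0" and g: "L2on (cube N) g" and K: "finite K"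
  shows "real N ^ CARD('n) * (\<Sum>k\<in>K. (cmod (ft g (real N *\<^sub>R ivec k)))\<^sup>2) \<le> sq_norm g"
proof -
  have "0 \<le> (LINT u|lborel. indicator (cube N) u * (cmod (g u - (\<Sum>k\<in>K. real N ^ CARD('n) * ft g (real N *\<^sub>R ivec k) * cnj (fexp N k u))))\<^sup>2)"
    by (intro Bochner_Integration.integral_nonneg) auto
  then show ?thesis 
    by (subst (asm) sq_norm_residual[OF N g K, of "\<lambda>k. real N ^ CARD('n) * ft g (real N *\<^sub>R ivec k)"]) simp
qed

text \<open>
  This inequality expresses the completeness of the exponentials and rests on the density of the trigonometric
  polynomials. The sum of the squared coefficients enters through a bound for its finite partial sums.
\<close>

lemma parseval_cube:
  fixes g :: "real ^ 'n \<Rightarrow> complex"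
  assumes N: "N > 0" and g: "L2on (cube N) g" 
    and bound: "\<And>K. finite K \<Longrightarrow> (\<Sum>k\<in>K. (cmod (ft g (real N *\<^sub>R ivec k)))\<^sup>2) \<le> B"
  shows "sq_norm g \<le> real N ^ CARD('n) * B"
proof (rule field_le_epsilon)
  fix e :: real assume "e > 0"
  have meas: "g \<in> borel_measurable borel" using L2onD(1)[OF g] .
  then have [measurable]: "(\<lambda>u. Re (g u)) \<in> borel_measurable borel" "(\<lambda>u. Im (g u)) \<in> borel_measurable borel"
    by (simp_all add: borel_measurable_complex_iff)
  have int: "integrable lborel (\<lambda>u. (Re (g u))\<^sup>2)" "integrable lborel (\<lambda>u. (Im (g u))\<^sup>2)"
    by (rule Bochner_Integration.integrable_bound[OF L2onD(2)[OF g]], simp, simp add: cmod_power2)+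
  obtain p where p: "p \<in> real_trig N" "(LINT x|lborel. indicator (cube N) x * (Re (g x) - p x)\<^sup>2) < e/2"
    using real_trig_dense[OF N _ int(1), of "e/2"] \<open>e > 0\<close> by auto
  obtain q where q: "q \<in> real_trig N" "(LINT x|lborel. indicator (cube N) x * (Im (g x) - q x)\<^sup>2) < e/2"
    using real_trig_dense[OF N _ int(2), of "e/2"] \<open>e > 0\<close> by auto
  have "(\<lambda>u. of_real (p u) + \<i> * of_real (q u)) \<in> trig_span N"
    using p(1) q(1) unfolding real_trig_def by (auto intro!: trig_span.add trig_span_mult trig_span_const)
  from trig_span_sum[OF this] obtain K b where K: "finite K" "(\<lambda>u. of_real (p u) + \<i> * of_real (q u)) = (\<lambda>u. \<Sum>k\<in>K. b k * cnj (fexp N k u))"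
    by (elim exE conjE)
  have K2: "(\<Sum>k\<in>K. b k * cnj (fexp N k u)) = of_real (p u) + \<i> * of_real (q u)" for u
    using fun_cong[OF K(2), of u] by simp
  have bd: "integrable lborel (\<lambda>x. indicator (cube N) x * (f x - r x)\<^sup>2)"
    if r: "r \<in> real_trig N" and f[measurable]: "f \<in> borel_measurable borel" "integrable lborel (\<lambda>x. (f x)\<^sup>2)" for f r :: "real ^ 'n \<Rightarrow> real"
  proof -
    have [measurable]: "r \<in> borel_measurable borel"
      using trig_span_measurable[of "\<lambda>u. complex_of_real (r u)" N] r
      unfolding real_trig_def borel_measurable_complex_iff by auto
    obtain C where C: "\<And>u. \<bar>r u\<bar> \<le> C"
      using trig_span_bounded[of "\<lambda>u. of_real (r u)" N] r by (auto simp: real_trig_def)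
    show ?thesis
    proof (rule Bochner_Integration.integrable_bound[where f="\<lambda>x. 2 * (f x)\<^sup>2 + 2 * C\<^sup>2 * indicator (cube N) x"])
      show "integrable lborel (\<lambda>x. 2 * (f x)\<^sup>2 + 2 * C\<^sup>2 * indicator (cube N) x)"
        using f(2) finite_indicator_bounded[of "cube N"] by auto
      have "indicator (cube N) x * (f x - r x)\<^sup>2 \<le> 2 * (f x)\<^sup>2 + 2 * C\<^sup>2 * indicator (cube N) x" for x
      proof -
        have "(f x - r x)\<^sup>2 \<le> 2 * (f x)\<^sup>2 + 2 * (r x)\<^sup>2"
          using zero_le_power2[of "f x + r x"] by (simp add: power2_eq_square algebra_simps)
        moreover have "(r x)\<^sup>2 \<le> C\<^sup>2" using C[of x] abs_le_square_iff[of "r x" C] by simp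
        ultimately show ?thesis by (auto simp: indicator_def)
      qed
      then show "AE x in lborel. norm (indicator (cube N) x * (f x - r x)\<^sup>2) \<le> norm (2 * (f x)\<^sup>2 + 2 * C\<^sup>2 * indicator (cube N) x)"
        by (intro AE_I2) (simp add: indicator_def)
    qed auto
  qed
  have "(LINT u|lborel. indicator (cube N) u * (cmod (g u - (\<Sum>k\<in>K. b k * cnj (fexp N k u))))\<^sup>2)
    = (LINT u|lborel. indicator (cube N) u * (Re (g u) - p u)\<^sup>2 + indicator (cube N) u * (Im (g u) - q u)\<^sup>2)"
    unfolding K2 by (simp add: cmod_power2 distrib_left)
  also have "\<dots> < e" 
    using p q bd[OF p(1) _ int(1)] bd[OF q(1) _ int(2)] by simp
  finally have *: "sq_norm g - real N ^ CARD('n) * (\<Sum>k\<in>K. (cmod (ft g (real N *\<^sub>R ivec k)))\<^sup>2) 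
       + (\<Sum>k\<in>K. (cmod (b k - real N ^ CARD('n) * ft g (real N *\<^sub>R ivec k)))\<^sup>2) / real N ^ CARD('n) < e"
    unfolding sq_norm_residual[OF N g K(1)] .
  have "0 \<le> (\<Sum>k\<in>K. (cmod (b k - real N ^ CARD('n) * ft g (real N *\<^sub>R ivec k)))\<^sup>2) / real N ^ CARD('n)"
    by (intro divide_nonneg_nonneg sum_nonneg) auto
  moreover have "real N ^ CARD('n) * (\<Sum>k\<in>K. (cmod (ft g (real N *\<^sub>R ivec k)))\<^sup>2) \<le> real N ^ CARD('n) * B"
    by (intro mult_left_mono bound K) auto
  ultimately show "sq_norm g \<le> real N ^ CARD('n) * B + e" using * by linarith
qed

section \<open>Folding along a grid of cubes\<close>


lemma
  fixes f :: "real ^ 'n \<Rightarrow> 'b :: {banach, second_countable_topology}"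
  assumes f: "f \<in> borel_measurable borel"
  shows integral_shift: "(LINT x|lborel. f (x + c)) = (LINT x|lborel. f x)"
    and integrable_shift: "integrable lborel (\<lambda>x. f (x + c)) \<longleftrightarrow> integrable lborel f"
proof -
  have *: "distr lborel borel (\<lambda>x. x + c) = lborel"
  proof -
    have "(\<lambda>x. x + c) = (+) c" by (simp add: fun_eq_iff add.commute)
    then show ?thesis using lborel_distr_plus[of c] by simp
  qed
  have "(LINT x|lborel. f (x + c)) = (LINT x|distr lborel borel (\<lambda>x. x + c). f x)"
    using f by (subst integral_distr) auto
  then show "(LINT x|lborel. f (x + c)) = (LINT x|lborel. f x)" by (simp add: *)
  have "integrable lborel (\<lambda>x. f (x + c)) \<longleftrightarrow> integrable (distr lborel borel (\<lambda>x. x + c)) f"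
    using f by (subst integrable_distr_eq) auto
  then show "integrable lborel (\<lambda>x. f (x + c)) \<longleftrightarrow> integrable lborel f" by (simp add: *)
qed

text \<open>
  The grid with mesh \<open>1 / N\<close>: \<open>corner N a\<close> is the lower corner of the cube with index \<open>a\<close>, and \<open>cell N x\<close>
  is the index of the cube that contains \<open>x\<close>.
\<close>

definition corner :: "nat \<Rightarrow> int ^ 'n \<Rightarrow> real ^ 'n" where
  "corner N a = (1 / real N) *\<^sub>R ivec a"

definition cell :: "nat \<Rightarrow> real ^ 'n \<Rightarrow> int ^ 'n" where
  "cell N x = (\<chi> i. \<lfloor>real N * x $ i\<rfloor>)"

definition tile :: "nat \<Rightarrow> (int ^ 'n) set \<Rightarrow> (real ^ 'n) set" where
  "tile N A = {x. cell N x \<in> A}"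

lemma corner_nth [simp]: "corner N a $ i = of_int (a $ i) / real N"
  by (simp add: corner_def)

lemma cell_eq_iff:
  assumes "N > 0" shows "cell N x = a \<longleftrightarrow> x - corner N a \<in> cube N"
proof -
  have "\<lfloor>real N * t\<rfloor> = b \<longleftrightarrow> 0 \<le> t - of_int b / real N \<and> t - of_int b / real N < 1 / real N" for t b
    using assms by (simp add: floor_eq_iff pos_less_divide_eq pos_divide_le_eq diff_less_eq le_diff_eq
        mult.commute add.commute flip: add_divide_distrib)
  then show ?thesis by (simp add: cell_def vec_eq_iff cube_def)
qed

lemma cell_shift: "N > 0 \<Longrightarrow> u \<in> cube N \<Longrightarrow> cell N (u + corner N a) = a"
  by (simp add: cell_eq_iff)

lemma minus_corner_cell: "N > 0 \<Longrightarrow> x - corner N (cell N x) \<in> cube N"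
  using cell_eq_iff by blast

lemma E_fexp_corner: "N > 0 \<Longrightarrow> fexp N k (corner N a) = 1"
  using E_ivec_ivec[of k a] by (simp add: E_def corner_def)

lemma tile_borel [measurable]:
  assumes N: "N > 0" and A: "finite A" shows "tile N A \<in> sets borel"
proof -
  have "tile N A = (\<Union>a\<in>A. (\<lambda>x. x - corner N a) -` cube N)"
    by (auto simp: tile_def simp flip: cell_eq_iff[OF N])
  also have "\<dots> \<in> sets borel"
  proof (intro sets.finite_UN A)
    fix a 
    have "(\<lambda>x. x - corner N a) -` cube N \<inter> space borel \<in> sets borel"
      by (rule measurable_sets[where A=borel]) auto
    then show "(\<lambda>x. x - corner N a) -` cube N \<in> sets borel" by simp
  qed
  finally show ?thesis .
qed

lemma bounded_tile [simp]:
  assumes N: "N > 0" and A: "finite A" shows "bounded (tile N A)"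
proof -
  have "tile N A \<subseteq> (\<Union>a\<in>A. (\<lambda>u. corner N a + u) ` cube N)"
  proof
    fix x assume "x \<in> tile N A"
    then have "cell N x \<in> A" "x = corner N (cell N x) + (x - corner N (cell N x))" by (auto simp: tile_def)
    then show "x \<in> (\<Union>a\<in>A. (\<lambda>u. corner N a + u) ` cube N)" using minus_corner_cell[OF N, of x] by blast
  qed
  moreover have "bounded (\<Union>a\<in>A. (\<lambda>u. corner N a + u) ` cube N)"
    using A by (intro bounded_UN) (auto intro: bounded_translation)
  ultimately show ?thesis using bounded_subset by blast
qed

lemma integral_tile:
  fixes F :: "real ^ 'n \<Rightarrow> 'b :: {banach, second_countable_topology}"
  assumes N: "N > 0" and A: "finite A" and F: "integrable lborel F" "\<And>x. x \<notin> tile N A \<Longrightarrow> F x = 0"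
  shows "(LINT x|lborel. F x) = (\<Sum>a\<in>A. LINT u|lborel. indicator (cube N) u *\<^sub>R F (u + corner N a))"
    and "integrable lborel (\<lambda>u. indicator (cube N) u *\<^sub>R F (u + corner N a))"
proof -
  have Fm[measurable]: "F \<in> borel_measurable borel" using F(1) by auto
  let ?f = "\<lambda>a x. indicator (cube N) (x - corner N a) *\<^sub>R F x"
  have [measurable]: "?f a \<in> borel_measurable borel" for a by measurable
  have int: "integrable lborel (?f a)" for a
    by (rule Bochner_Integration.integrable_bound[OF F(1)]) (auto simp: indicator_def)
  show "integrable lborel (\<lambda>u. indicator (cube N) u *\<^sub>R F (u + corner N a))"
    using int[of a] integrable_shift[of "?f a" "corner N a"] by simp
  have "F x = (\<Sum>a\<in>A. ?f a x)" for x
  proof -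
    have "(\<Sum>a\<in>A. ?f a x) = (\<Sum>a\<in>A. if a = cell N x then F x else 0)"
      by (intro sum.cong refl) (auto simp: indicator_def cell_eq_iff[OF N, symmetric])
    also have "\<dots> = F x" using A F(2)[of x] by (auto simp: tile_def)
    finally show ?thesis by simp
  qed
  then have "(LINT x|lborel. F x) = (LINT x|lborel. (\<Sum>a\<in>A. ?f a x))" by simp
  also have "\<dots> = (\<Sum>a\<in>A. LINT x|lborel. ?f a x)"
    by (rule Bochner_Integration.integral_sum) (rule int)
  also have "\<dots> = (\<Sum>a\<in>A. LINT u|lborel. ?f a (u + corner N a))"
    by (intro sum.cong refl integral_shift[symmetric]) auto
  finally show "(LINT x|lborel. F x) = (\<Sum>a\<in>A. LINT u|lborel. indicator (cube N) u *\<^sub>R F (u + corner N a))" by simp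
qed

definition piece :: "nat \<Rightarrow> (real ^ 'n \<Rightarrow> complex) \<Rightarrow> int ^ 'n \<Rightarrow> real ^ 'n \<Rightarrow> complex" where
  "piece N G a u = indicator (cube N) u * G (u + corner N a)"

lemma cmod_piece: "(cmod (piece N G a u))\<^sup>2 = indicator (cube N) u *\<^sub>R (cmod (G (u + corner N a)))\<^sup>2"
  by (simp add: piece_def indicator_def)

context
  fixes N :: nat and A :: "(int ^ 'n) set" and G :: "real ^ 'n \<Rightarrow> complex"
  assumes N: "N > 0" and A: "finite A" and G: "L2on (tile N A) G"
begin

lemma L2on_piece: "L2on (cube N) (piece N G a)"
proof -
  have [measurable]: "G \<in> borel_measurable borel" using L2onD(1)[OF G] .
  have "integrable lborel (\<lambda>u. (cmod (piece N G a u))\<^sup>2)"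
    unfolding cmod_piece by (rule integral_tile(2)[OF N A L2onD(2)[OF G]]) (use L2onD(3)[OF G] in auto)
  moreover have "piece N G a \<in> borel_measurable borel" unfolding piece_def by measurable
  ultimately show ?thesis by (auto simp: L2on_def piece_def)
qed

lemma sq_norm_pieces: "sq_norm G = (\<Sum>a\<in>A. sq_norm (piece N G a))"
  unfolding sq_norm_def cmod_piece
  by (rule integral_tile(1)[OF N A L2onD(2)[OF G]]) (use L2onD(3)[OF G] in auto)

definition fold_tile :: "real ^ 'n \<Rightarrow> real ^ 'n \<Rightarrow> complex" where
  "fold_tile w u = (\<Sum>a\<in>A. E w (u + corner N a) * piece N G a u)"

lemma L2on_fold: "L2on (cube N) (fold_tile w)"
  unfolding fold_tile_def by (intro L2on_sum L2on_mult(1)[where B=1] L2on_piece) auto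

text \<open>
  The exponential with frequency \<open>N k\<close> has period \<open>1 / N\<close> in every coordinate, so it takes the same value at
  corresponding points of all cubes and can be taken out of the sum over the cubes.
\<close>

lemma ft_fold: "ft G (w + real N *\<^sub>R ivec k) = ft (fold_tile w) (real N *\<^sub>R ivec k)"
proof -
  let ?t = "w + real N *\<^sub>R ivec k"
  have "ft G ?t = (\<Sum>a\<in>A. LINT u|lborel. indicator (cube N) u *\<^sub>R (E ?t (u + corner N a) * G (u + corner N a)))"
    unfolding ft_def
    by (rule integral_tile(1)[OF N A integrable_E_mult[OF G bounded_tile[OF N A]]]) (use L2onD(3)[OF G] in auto)
  also have "\<dots> = (\<Sum>a\<in>A. LINT u|lborel. fexp N k u * (E w (u + corner N a) * piece N G a u))"
  proof (intro sum.cong refl Bochner_Integration.integral_cong)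
    fix a u
    have "E ?t (u + corner N a) = fexp N k u * E w (u + corner N a)"
      unfolding E_add_left by (simp add: E_add_right E_fexp_corner[OF N])
    then show "indicator (cube N) u *\<^sub>R (E ?t (u + corner N a) * G (u + corner N a)) = fexp N k u * (E w (u + corner N a) * piece N G a u)"
      by (simp add: piece_def indicator_def)
  qed
  also have "\<dots> = (\<Sum>a\<in>A. ft (\<lambda>u. E w (u + corner N a) * piece N G a u) (real N *\<^sub>R ivec k))"
    by (simp add: ft_def)
  also have "\<dots> = ft (fold_tile w) (real N *\<^sub>R ivec k)"
    unfolding fold_tile_def
    by (rule ft_sum[symmetric, where S="cube N"]) (auto intro!: L2on_mult(1)[where B=1] L2on_piece)
  finally show ?thesis .
qed

end

lemma sq_norm_sum_le:
  assumes "finite I" "\<And>i. i \<in> I \<Longrightarrow> L2on S (F i)"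
  shows "sq_norm (\<lambda>x. \<Sum>i\<in>I. F i x) \<le> card I * (\<Sum>i\<in>I. sq_norm (F i))"
proof -
  have le: "(cmod (\<Sum>i\<in>I. F i x))\<^sup>2 \<le> card I * (\<Sum>i\<in>I. (cmod (F i x))\<^sup>2)" for x
  proof -
    have "(cmod (\<Sum>i\<in>I. F i x))\<^sup>2 \<le> (\<Sum>i\<in>I. cmod (F i x))\<^sup>2"
      by (intro power_mono norm_sum) auto
    also have "\<dots> \<le> card I * (\<Sum>i\<in>I. (cmod (F i x))\<^sup>2)"
      using sum_squared_le_sum_of_squares[of "\<lambda>i. cmod (F i x)" I] by (simp add: mult.commute)
    finally show ?thesis .
  qed
  have "sq_norm (\<lambda>x. \<Sum>i\<in>I. F i x) \<le> (LINT x|lborel. card I * (\<Sum>i\<in>I. (cmod (F i x))\<^sup>2))"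
    unfolding sq_norm_def 
    by (intro integral_mono le integrable_mult_right Bochner_Integration.integrable_sum L2onD(2)[OF L2on_sum] L2onD(2))
      (use assms(2) in auto)
  also have "\<dots> = card I * (\<Sum>i\<in>I. sq_norm (F i))"
    using assms(2) unfolding sq_norm_def
    by (subst integral_mult_right_zero, subst Bochner_Integration.integral_sum) (auto simp: L2on_def)
  finally show ?thesis .
qed

lemma bessel_tile:
  fixes G :: "real ^ 'n \<Rightarrow> complex"
  assumes N: "N > 0" and A: "finite A" and G: "L2on (tile N A) G" and K: "finite K"
  shows "real N ^ CARD('n) * (\<Sum>k\<in>K. (cmod (ft G (w + real N *\<^sub>R ivec k)))\<^sup>2) \<le> card A * sq_norm G"
proof -
  have "real N ^ CARD('n) * (\<Sum>k\<in>K. (cmod (ft G (w + real N *\<^sub>R ivec k)))\<^sup>2) \<le> sq_norm (fold_tile N A G w)"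
    unfolding ft_fold[OF N A G] by (rule bessel_cube[OF N L2on_fold[OF N A G] K])
  also have "\<dots> \<le> card A * (\<Sum>a\<in>A. sq_norm (\<lambda>u. E w (u + corner N a) * piece N G a u))"
    unfolding fold_tile_def[OF N A G, abs_def]
    by (rule sq_norm_sum_le[OF A, where S="cube N"]) (auto intro!: L2on_mult(1)[where B=1] L2on_piece[OF N A G])
  also have "(\<Sum>a\<in>A. sq_norm (\<lambda>u. E w (u + corner N a) * piece N G a u)) = sq_norm G"
    unfolding sq_norm_pieces[OF N A G] by (simp add: sq_norm_def norm_mult)
  finally show ?thesis .
qed

lemma cmod_cis_minus_one: "cmod (cis t - 1) \<le> \<bar>t\<bar>"
proof (rule power2_le_imp_le)
  have "(cmod (cis t - 1))\<^sup>2 = 2 - 2 * cos t"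
    using sin_cos_squared_add[of t] unfolding cmod_power2 by (simp add: power2_eq_square algebra_simps)
  also have "cos t = 1 - 2 * (sin (t/2))\<^sup>2" using cos_double_sin[of "t/2"] by simp
  finally have "(cmod (cis t - 1))\<^sup>2 = 4 * (sin (t/2))\<^sup>2" by simp
  also have "(sin (t/2))\<^sup>2 \<le> (t/2)\<^sup>2"
    using abs_sin_x_le_abs_x[of "t/2"] by (simp only: abs_le_square_iff)
  finally show "(cmod (cis t - 1))\<^sup>2 \<le> \<bar>t\<bar>\<^sup>2" by (simp add: power_divide)
qed simp

text \<open>
  The difference of the two values is the transform, at a point of the second
  progression, of \<open>G\<close> multiplied by \<open>E (w' - w) - 1\<close>. This factor is small on bounded sets, and the
  Bessel inequality applies. All points of the progression are displaced by the same vector, which is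
  enough for periodic perturbations.
\<close>

lemma perturbed_tile:
  fixes G :: "real ^ 'n \<Rightarrow> complex"
  assumes N: "N > 0" and A: "finite A" and G: "L2on (tile N A) G" and K: "finite K"
    and R: "\<And>y. y \<in> tile N A \<Longrightarrow> norm y \<le> R"
  shows "real N ^ CARD('n) * (\<Sum>k\<in>K. (cmod (ft G (w' + real N *\<^sub>R ivec k) - ft G (w + real N *\<^sub>R ivec k)))\<^sup>2) 
    \<le> card A * (2 * pi * norm (w' - w) * R)\<^sup>2 * sq_norm G"
proof -
  let ?b = "\<lambda>y. E (w' - w) y - 1"
  let ?H = "\<lambda>y. ?b y * G y"
  have b: "cmod (?b y) \<le> 2 * pi * norm (w' - w) * R" if "y \<in> tile N A" for y
  proof -
    have "cmod (?b y) \<le> 2 * pi * \<bar>(w' - w) \<bullet> y\<bar>"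
      unfolding E_def by (rule order_trans[OF cmod_cis_minus_one]) (simp add: abs_mult)
    also have "\<dots> \<le> 2 * pi * (norm (w' - w) * norm y)"
      by (intro mult_left_mono Cauchy_Schwarz_ineq2) auto
    also have "\<dots> \<le> 2 * pi * (norm (w' - w) * R)"
      by (intro mult_left_mono R that) auto
    finally show ?thesis by (simp add: mult_ac)
  qed
  have H: "L2on (tile N A) ?H" "sq_norm ?H \<le> (2 * pi * norm (w' - w) * R)\<^sup>2 * sq_norm G"
    using L2on_mult[OF G _ b] by auto
  have eq: "ft ?H (w + t) = ft G (w' + t) - ft G (w + t)" for t
  proof -
    have "ft ?H (w + t) = (LINT y|lborel. E (w' + t) y * G y - E (w + t) y * G y)"
      unfolding ft_def by (intro Bochner_Integration.integral_cong refl) 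
        (simp add: left_diff_distrib right_diff_distrib flip: E_add_left mult.assoc, simp add: algebra_simps)
    also have "\<dots> = ft G (w' + t) - ft G (w + t)"
      unfolding ft_def by (intro Bochner_Integration.integral_diff integrable_E_mult[OF G bounded_tile[OF N A]])
    finally show ?thesis .
  qed
  have "real N ^ CARD('n) * (\<Sum>k\<in>K. (cmod (ft ?H (w + real N *\<^sub>R ivec k)))\<^sup>2) \<le> card A * sq_norm ?H"
    by (rule bessel_tile[OF N A H(1) K])
  also have "\<dots> \<le> card A * ((2 * pi * norm (w' - w) * R)\<^sup>2 * sq_norm G)"
    by (intro mult_left_mono H(2)) simp
  finally show ?thesis unfolding eq by (simp add: mult_ac)
qed

section \<open>Generic points for finitely many frequencies\<close>


lemma E_diff_left: "E (s - t) y = E s y * E (- t) y"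
  using E_add_left[of s "- t" y] by simp

lemma E_nonzero [simp]: "E t y \<noteq> 0"
  by (simp add: E_def)

text \<open>
  Induction on the number of terms: subtracting a multiple of the sum from its translate by \<open>h\<close> removes the term
  with frequency \<open>q b\<close> and multiplies the other coefficients by \<open>E h (q a) - E h (q b)\<close>, which is
  nonzero for a suitable small \<open>h\<close>.
\<close>

lemma exp_sum_vanishing:
  fixes q :: "'a \<Rightarrow> real ^ 'n"
  assumes "finite A" "inj_on q A" "\<eta> > 0"
    and "\<And>x. dist x x0 < \<eta> \<Longrightarrow> (\<Sum>a\<in>A. c a * E x (q a)) = 0"
  shows "\<forall>a\<in>A. c a = 0"
  using assms
proof (induction A arbitrary: c \<eta> rule: finite_induct)
  case empty
  then show ?case by simp
next
  case (insert b A)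
  let ?p = "\<lambda>x. \<Sum>a\<in>insert b A. c a * E x (q a)"
  have coeff: "c a = 0" if a: "a \<in> A" for a
  proof -
    define v where "v = q a - q b"
    have v: "v \<noteq> 0" using insert.prems(1) insert.hyps a by (auto simp: v_def inj_on_def)
    \<comment> \<open>The bounds keep \<open>h\<close> inside half of the ball and the phase \<open>2 \<pi> h \<bullet> v\<close> inside \<open>(0, \<pi>)\<close>, where the sine is positive.\<close>
    define t where "t = min (\<eta> / (4 * norm v)) (1 / (4 * (v \<bullet> v)))"
    have t: "t > 0" using v \<open>\<eta> > 0\<close> by (simp add: t_def)
    define h where "h = t *\<^sub>R v"
    have "t * norm v \<le> \<eta> / (4 * norm v) * norm v"
      using v by (intro mult_right_mono) (auto simp: t_def)
    then have nh: "norm h < \<eta> / 2" using v t \<open>\<eta> > 0\<close> by (simp add: h_def)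
    have "t * (v \<bullet> v) \<le> 1 / (4 * (v \<bullet> v)) * (v \<bullet> v)"
      using v by (intro mult_right_mono) (auto simp: t_def)
    then have tv: "t * (v \<bullet> v) \<le> 1 / 4" using v by simp
    have "0 < t * (v \<bullet> v)" using t v by simp
    then have "sin (2 * pi * (t * (v \<bullet> v))) > 0"
      using tv pi_gt_zero by (intro sin_gt_zero) (auto intro: mult_pos_pos simp: mult_less_cancel_left)
    then have Ev: "E h v \<noteq> 1"
      unfolding E_def h_def by (auto simp: complex_eq_iff)
    have Eab: "E h (q a) = E h (q b) * E h v"
      by (simp add: v_def flip: E_add_right)
    have ne: "E h (q a) - E h (q b) \<noteq> 0" using Ev Eab by simp
    have "\<forall>a\<in>A. c a * (E h (q a) - E h (q b)) = 0"
    proof (rule insert.IH)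
      show "inj_on q A" using insert.prems(1) by auto
      show "\<eta> / 2 > 0" using \<open>\<eta> > 0\<close> by simp
      fix x assume x: "dist x x0 < \<eta> / 2"
      have "dist (x + h) x0 \<le> dist x x0 + norm h"
        by (metis add.commute add_diff_cancel_left' dist_norm dist_triangle2 dist_commute dist_triangle)
      then have p1: "?p (x + h) = 0" using nh x by (intro insert.prems(3)) linarith
      have p2: "?p x = 0" using x \<open>\<eta> > 0\<close> by (intro insert.prems(3)) linarith
      have "0 = ?p (x + h) - E h (q b) * ?p x" using p1 p2 by simp
      also have "\<dots> = (\<Sum>a\<in>insert b A. c a * (E h (q a) - E h (q b)) * E x (q a))"
        by (simp add: E_add_left sum_distrib_left sum_subtractf[symmetric] algebra_simps del: sum.insert)
      also have "\<dots> = (\<Sum>a\<in>A. c a * (E h (q a) - E h (q b)) * E x (q a))"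
        using insert.hyps by simp
      finally show "(\<Sum>a\<in>A. c a * (E h (q a) - E h (q b)) * E x (q a)) = 0" by simp
    qed
    then show "c a = 0" using a ne by auto
  qed
  have "?p x0 = 0" by (rule insert.prems(3)) (use \<open>\<eta> > 0\<close> in simp)
  then have "c b * E x0 (q b) = 0" using insert.hyps coeff by simp
  then show ?case using coeff by auto
qed

lemma avoid_finitely_many_zero_sets:
  fixes F :: "('a :: metric_space \<Rightarrow> complex) set"
  assumes "finite F" "\<And>f. f \<in> F \<Longrightarrow> continuous_on UNIV f"
    and "\<And>f x0 \<eta>. f \<in> F \<Longrightarrow> \<eta> > 0 \<Longrightarrow> \<exists>x. dist x x0 < \<eta> \<and> f x \<noteq> 0" and "\<eta> > 0"
  shows "\<exists>x. dist x x0 < \<eta> \<and> (\<forall>f\<in>F. f x \<noteq> 0)"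
  using assms
proof (induction F arbitrary: x0 \<eta> rule: finite_induct)
  case empty
  then show ?case by (auto intro!: exI[of _ x0])
next
  case (insert f F)
  obtain x1 where x1: "dist x1 x0 < \<eta>" "f x1 \<noteq> 0" using insert.prems(2)[of f \<eta> x0] insert.prems(3) by auto
  have "open (f -` (- {0}))" using insert.prems(1)[of f] by (auto simp: continuous_on_open_vimage)
  then have "open (f -` (- {0}) \<inter> ball x0 \<eta>)" by auto
  moreover have "x1 \<in> f -` (- {0}) \<inter> ball x0 \<eta>" using x1 by (auto simp: dist_commute)
  ultimately obtain e where e: "e > 0" "\<And>x. dist x x1 < e \<Longrightarrow> x \<in> f -` (- {0}) \<inter> ball x0 \<eta>"
    unfolding open_dist by metis
  have "\<exists>x. dist x x1 < e \<and> (\<forall>f\<in>F. f x \<noteq> 0)"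
    using insert.prems e(1) by (intro insert.IH) auto
  then obtain x where "dist x x1 < e" "\<forall>f\<in>F. f x \<noteq> 0" by blast
  then show ?case using e(2)[of x] by (auto simp: dist_commute)
qed

text \<open>
  Values at the points \<open>x r\<close> determine an exponential sum with frequencies \<open>q a\<close>, and can be
  prescribed: the matrix \<open>E (x r) (q a)\<close> is invertible. In this form the property
  can be extended by one point and one frequency at a time.
\<close>

definition unisolvent :: "('a \<Rightarrow> real ^ 'n) \<Rightarrow> 'r set \<Rightarrow> 'a set \<Rightarrow> ('r \<Rightarrow> real ^ 'n) \<Rightarrow> bool" where
  "unisolvent q R A x \<longleftrightarrow> (\<forall>v. \<exists>c. \<forall>r\<in>R. (\<Sum>a\<in>A. c a * E (x r) (q a)) = v r) \<and>
     (\<forall>c. (\<forall>r\<in>R. (\<Sum>a\<in>A. c a * E (x r) (q a)) = 0) \<longrightarrow> (\<forall>a\<in>A. c a = 0))"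

lemma unisolventD1: "unisolvent q R A x \<Longrightarrow> \<exists>c. \<forall>r\<in>R. (\<Sum>a\<in>A. c a * E (x r) (q a)) = v r"
  by (simp add: unisolvent_def)

lemma unisolventD2:
  "unisolvent q R A x \<Longrightarrow> \<forall>r\<in>R. (\<Sum>a\<in>A. c a * E (x r) (q a)) = 0 \<Longrightarrow> \<forall>a\<in>A. c a = 0"
  unfolding unisolvent_def by (elim conjE allE[of _ c]) (erule mp)

text \<open>
  The exponential sum with coefficients \<open>d\<close> on \<open>A\<close> and coefficient 1 at \<open>b\<close> vanishes at the old points but
  not at \<open>y\<close>. Adding a multiple of it adjusts the value at \<open>y\<close>; conversely every sum that vanishes at the old points
  is a multiple of it.
\<close>

lemma unisolvent_extend:
  assumes U: "unisolvent q R A x" and A: "finite A" "b \<notin> A" and s: "s \<notin> R"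
    and p: "\<And>r. r \<in> R \<Longrightarrow> (\<Sum>a\<in>A. d a * E (x r) (q a)) = - E (x r) (q b)"
    and y: "E y (q b) + (\<Sum>a\<in>A. d a * E y (q a)) \<noteq> 0"
  shows "unisolvent q (insert s R) (insert b A) (x(s := y))"
proof -
  let ?p = "\<lambda>x. E x (q b) + (\<Sum>a\<in>A. d a * E x (q a))"
  have pr: "?p (x r) = 0" if "r \<in> R" for r using p[OF that] by simp
  have xs: "(x(s := y)) r = x r" if "r \<in> R" for r using s that by auto
  show ?thesis unfolding unisolvent_def
  proof (intro conjI allI impI)
    fix v
    obtain c where c: "\<And>r. r \<in> R \<Longrightarrow> (\<Sum>a\<in>A. c a * E (x r) (q a)) = v r"
      using unisolventD1[OF U, of v] by blast
    define t where "t = (v s - (\<Sum>a\<in>A. c a * E y (q a))) / ?p y"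
    define c' where "c' = (\<lambda>a. if a = b then t else c a + t * d a)"
    have sum: "(\<Sum>a\<in>insert b A. c' a * E z (q a)) = (\<Sum>a\<in>A. c a * E z (q a)) + t * ?p z" for z
    proof -
      have "(\<Sum>a\<in>A. c' a * E z (q a)) = (\<Sum>a\<in>A. (c a + t * d a) * E z (q a))"
        using A by (intro sum.cong refl) (auto simp: c'_def)
      then show ?thesis using A
        by (simp add: sum.distrib sum_distrib_left algebra_simps) (simp add: c'_def)
    qed
    have "(\<Sum>a\<in>insert b A. c' a * E ((x(s := y)) r) (q a)) = v r" if "r \<in> insert s R" for r
    proof (cases "r = s")
      case True
      then show ?thesis unfolding sum using y by (simp add: t_def)
    next
      case False
      then show ?thesis unfolding sum using that c pr by auto
    qed
    then show "\<exists>c. \<forall>r\<in>insert s R. (\<Sum>a\<in>insert b A. c a * E ((x(s := y)) r) (q a)) = v r" by blast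
  next
    fix c assume c: "\<forall>r\<in>insert s R. (\<Sum>a\<in>insert b A. c a * E ((x(s := y)) r) (q a)) = 0"
    have split: "(\<Sum>a\<in>insert b A. c a * E z (q a)) = c b * ?p z + (\<Sum>a\<in>A. (c a - c b * d a) * E z (q a))" for z
      using A by (simp add: left_diff_distrib sum_subtractf sum_distrib_left algebra_simps)
    have "\<forall>r\<in>R. (\<Sum>a\<in>A. (c a - c b * d a) * E (x r) (q a)) = 0"
    proof
      fix r assume r: "r \<in> R"
      have "(\<Sum>a\<in>insert b A. c a * E (x r) (q a)) = 0" using c r xs[OF r] by (metis insertI2)
      then show "(\<Sum>a\<in>A. (c a - c b * d a) * E (x r) (q a)) = 0" unfolding split using pr[OF r] by simp
    qed
    from unisolventD2[OF U this] have 0: "\<forall>a\<in>A. c a - c b * d a = 0" .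
    have "(\<Sum>a\<in>insert b A. c a * E y (q a)) = 0" using c by (metis fun_upd_same insertI1)
    then have "c b * ?p y = 0" unfolding split using 0 by simp
    then have "c b = 0" using y by simp
    then show "\<forall>a\<in>insert b A. c a = 0" using 0 by simp
  qed
qed

text \<open>
  The points are chosen one after another. For every set \<open>A\<close> of frequencies of the right size and
  every further frequency \<open>b\<close>, the new point has to avoid the zero set of one nontrivial exponential sum; there are
  finitely many of these closed sets, each with empty interior.
\<close>

lemma generic_points:
  fixes q :: "'a \<Rightarrow> real ^ 'n" and x0 :: "'r \<Rightarrow> real ^ 'n"
  assumes \<Phi>: "finite \<Phi>" "inj_on q \<Phi>" and "finite R" and \<eta>: "\<eta> > 0"
  shows "\<exists>x. (\<forall>r\<in>R. dist (x r) (x0 r) < \<eta>) \<and> (\<forall>A. A \<subseteq> \<Phi> \<and> card A = card R \<longrightarrow> unisolvent q R A x)"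
  using \<open>finite R\<close>
proof (induction R rule: finite_induct)
  case empty
  have "unisolvent q {} A x" if "A \<subseteq> \<Phi>" "card A = 0" for A and x :: "'r \<Rightarrow> real ^ 'n"
  proof -
    have "A = {}" using that \<Phi>(1) finite_subset by fastforce
    then show ?thesis by (simp add: unisolvent_def)
  qed
  then show ?case by auto
next
  case (insert s R)
  then obtain x where x: "\<And>r. r \<in> R \<Longrightarrow> dist (x r) (x0 r) < \<eta>"
    "\<And>A. A \<subseteq> \<Phi> \<Longrightarrow> card A = card R \<Longrightarrow> unisolvent q R A x" by auto
  define I where "I = {(b, A). b \<in> \<Phi> \<and> A \<subseteq> \<Phi> \<and> b \<notin> A \<and> card A = card R}"
  have "I \<subseteq> \<Phi> \<times> Pow \<Phi>" by (auto simp: I_def)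
  then have I: "finite I" using \<Phi>(1) finite_subset by blast
  have "\<exists>d. \<forall>r\<in>R. (\<Sum>a\<in>A. d a * E (x r) (q a)) = - E (x r) (q b)" if "(b, A) \<in> I" for b A
    using unisolventD1[OF x(2)[of A]] that unfolding I_def by auto
  then have "\<exists>d. \<forall>bA\<in>I. \<forall>r\<in>R. (\<Sum>a\<in>snd bA. d bA a * E (x r) (q a)) = - E (x r) (q (fst bA))"
    by (intro bchoice) auto
  then obtain d where d: "\<And>b A r. (b, A) \<in> I \<Longrightarrow> r \<in> R \<Longrightarrow> (\<Sum>a\<in>A. d (b, A) a * E (x r) (q a)) = - E (x r) (q b)"
    by fastforce
  define P where "P = (\<lambda>(b, A) y. E y (q b) + (\<Sum>a\<in>A. d (b, A) a * E y (q a)))"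
  have "\<exists>y. dist y (x0 s) < \<eta> \<and> (\<forall>f\<in>P ` I. f y \<noteq> 0)"
  proof (rule avoid_finitely_many_zero_sets)
    show "finite (P ` I)" using I by simp
    show "continuous_on UNIV f" if "f \<in> P ` I" for f
      using that by (auto simp: P_def intro!: continuous_intros)
    fix f and y0 :: "real ^ 'n" and e :: real assume "f \<in> P ` I" "e > 0"
    then obtain b A where bA: "(b, A) \<in> I" "f = P (b, A)" by auto
    show "\<exists>y. dist y y0 < e \<and> f y \<noteq> 0"
    proof (rule ccontr)
      assume "\<not> ?thesis"
      then have 0: "P (b, A) y = 0" if "dist y y0 < e" for y using that bA by blast
      have A: "finite A" "b \<notin> A" "insert b A \<subseteq> \<Phi>"
        using bA(1) \<Phi>(1) finite_subset unfolding I_def by auto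
      have inj: "inj_on q (insert b A)" using inj_on_subset[OF \<Phi>(2) A(3)] .
      let ?c = "\<lambda>a. if a = b then 1 else d (b, A) a"
      have "(\<Sum>a\<in>insert b A. ?c a * E y (q a)) = P (b, A) y" for y
      proof -
        have "(\<Sum>a\<in>A. ?c a * E y (q a)) = (\<Sum>a\<in>A. d (b, A) a * E y (q a))"
          using A by (intro sum.cong refl) auto
        then show ?thesis using A by (simp add: P_def)
      qed
      then have "\<forall>a\<in>insert b A. ?c a = 0"
        using A inj 0 \<open>e > 0\<close> by (intro exp_sum_vanishing[of _ q e y0]) auto
      then show False by simp
    qed
  qed fact
  then obtain y where y: "dist y (x0 s) < \<eta>" "\<And>b A. (b, A) \<in> I \<Longrightarrow> P (b, A) y \<noteq> 0" by auto
  have "unisolvent q (insert s R) A' (x(s := y))" if A': "A' \<subseteq> \<Phi>" "card A' = card (insert s R)" for A'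
  proof -
    have "card A' = Suc (card R)" using A' insert.hyps by simp
    then obtain b A where bA: "A' = insert b A" "b \<notin> A" "card A = card R"
      by (auto simp: card_Suc_eq)
    then have I: "(b, A) \<in> I" using A' by (auto simp: I_def)
    have "finite A" using A'(1) bA(1) \<Phi>(1) finite_subset by auto
    then show ?thesis unfolding bA(1)
      using x(2)[of A] bA A'(1) insert.hyps d[OF I] y(2)[OF I]
      by (intro unisolvent_extend[where d="d (b, A)"]) (auto simp: P_def)
  qed
  moreover have "\<forall>r\<in>insert s R. dist ((x(s := y)) r) (x0 r) < \<eta>" using x(1) y(1) by auto
  ultimately show ?case by blast
qed

lemma unisolvent_inverse:
  assumes U: "unisolvent q R A x" and A: "finite A" and R: "finite R"
  shows "\<exists>B. (\<forall>r\<in>R. \<forall>s\<in>R. (\<Sum>a\<in>A. E (x r) (q a) * B a s) = (if r = s then 1 else 0)) \<and>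
     (\<forall>a\<in>A. \<forall>b\<in>A. (\<Sum>r\<in>R. B a r * E (x r) (q b)) = (if a = b then 1 else 0))"
proof -
  have "\<forall>s. \<exists>c. \<forall>r\<in>R. (\<Sum>a\<in>A. c a * E (x r) (q a)) = (if r = s then 1 else 0)"
    by (intro allI unisolventD1[OF U])
  then obtain C where C: "\<And>s r. r \<in> R \<Longrightarrow> (\<Sum>a\<in>A. C s a * E (x r) (q a)) = (if r = s then 1 else 0)"
    by metis
  have left: "(\<Sum>r\<in>R. C r a * E (x r) (q b)) = (if a = b then 1 else 0)" if ab: "a \<in> A" "b \<in> A" for a b
  proof -
    let ?d = "\<lambda>a. (\<Sum>r\<in>R. C r a * E (x r) (q b)) - (if a = b then 1 else 0)"
    have "(\<Sum>a\<in>A. ?d a * E (x s) (q a)) = 0" if s: "s \<in> R" for s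
    proof -
      have "(\<Sum>a\<in>A. (\<Sum>r\<in>R. C r a * E (x r) (q b)) * E (x s) (q a)) 
          = (\<Sum>r\<in>R. (\<Sum>a\<in>A. C r a * E (x s) (q a)) * E (x r) (q b))"
        unfolding sum_distrib_right by (subst sum.swap) (simp add: mult_ac)
      also have "\<dots> = (\<Sum>r\<in>R. if r = s then E (x r) (q b) else 0)"
        using C[OF s] by (intro sum.cong refl) auto
      also have "\<dots> = E (x s) (q b)" using R s by simp
      also have "\<dots> = (\<Sum>a\<in>A. (if a = b then 1 else 0) * E (x s) (q a))"
        using A ab by (simp add: if_distrib[of "\<lambda>z. z * _"] cong: if_cong)
      finally show ?thesis by (simp add: left_diff_distrib sum_subtractf)
    qed
    then have "\<forall>s\<in>R. (\<Sum>a\<in>A. ?d a * E (x s) (q a)) = 0" by (intro ballI)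
    from unisolventD2[OF U this] have "\<forall>a\<in>A. ?d a = 0" .
    then have "?d a = 0" using ab(1) by (rule bspec)
    then show ?thesis by simp
  qed
  show ?thesis
    using C left by (intro exI[of _ "\<lambda>a s. C s a"]) (auto simp: mult.commute)
qed

section \<open>Sampling and interpolation for periodic point sets\<close>


lemma card_vec_set:
  fixes X :: "'b set"
  assumes "finite X"
  shows "finite {v :: 'b ^ 'n. \<forall>i. v $ i \<in> X}" "card {v :: 'b ^ 'n. \<forall>i. v $ i \<in> X} = card X ^ CARD('n)"
proof -
  have bij: "bij_betw vec_nth {v :: 'b ^ 'n. \<forall>i. v $ i \<in> X} (PiE UNIV (\<lambda>_. X))"
    by (rule bij_betwI[where g=vec_lambda]) (auto simp: PiE_def)
  have fin: "finite (PiE (UNIV :: 'n set) (\<lambda>_. X))" using assms by (intro finite_PiE) auto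
  show "finite {v :: 'b ^ 'n. \<forall>i. v $ i \<in> X}" using bij_betw_finite[OF bij] fin by simp
  show "card {v :: 'b ^ 'n. \<forall>i. v $ i \<in> X} = card X ^ CARD('n)"
    using bij_betw_same_card[OF bij] by (simp add: card_PiE)
qed

definition res :: "nat \<Rightarrow> (int ^ 'n) set" where
  "res N = {r. \<forall>i. r $ i \<in> {0..<int N}}"

lemma finite_res [simp]: "finite (res N)"
  unfolding res_def by (rule card_vec_set) simp

lemma card_res: "card (res N :: (int ^ 'n) set) = N ^ CARD('n)"
  unfolding res_def by (subst card_vec_set) simp_all

text \<open>
  The decomposition of \<open>z\<close> into its residue \<open>zmod N z\<close> modulo \<open>N\<close> and the quotient \<open>zdiv N z\<close>,
  inverted by \<open>zshift\<close>.
\<close>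

definition zshift :: "nat \<Rightarrow> int ^ 'n \<Rightarrow> int ^ 'n \<Rightarrow> int ^ 'n" where
  "zshift N r k = (\<chi> i. r $ i + int N * k $ i)"

definition zmod :: "nat \<Rightarrow> int ^ 'n \<Rightarrow> int ^ 'n" where
  "zmod N z = (\<chi> i. z $ i mod int N)"

definition zdiv :: "nat \<Rightarrow> int ^ 'n \<Rightarrow> int ^ 'n" where
  "zdiv N z = (\<chi> i. z $ i div int N)"

lemma zshift_zmod_zdiv [simp]: "zshift N (zmod N z) (zdiv N z) = z"
  by (simp add: zshift_def zmod_def zdiv_def vec_eq_iff)

lemma zmod_res [simp]: "N > 0 \<Longrightarrow> zmod N z \<in> res N"
  by (simp add: res_def zmod_def)

lemma
  assumes "r \<in> res N"
  shows zdiv_zshift [simp]: "zdiv N (zshift N r k) = k"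
    and zmod_zshift [simp]: "zmod N (zshift N r k) = r"
proof -
  have r: "0 \<le> r $ i" "r $ i < int N" for i using assms by (auto simp: res_def)
  then have "int N > 0" by (meson le_less_trans)
  then show "zdiv N (zshift N r k) = k" "zmod N (zshift N r k) = r"
    using r by (auto simp: zdiv_def zmod_def zshift_def vec_eq_iff)
qed

lemma ivec_zshift: "ivec (zshift N r k) = ivec r + real N *\<^sub>R ivec k"
  by (simp add: vec_eq_iff zshift_def)

lemma zshift_inj: "N > 0 \<Longrightarrow> inj (zshift N r)"
  by (auto simp: inj_def zshift_def vec_eq_iff)

definition periodic :: "nat \<Rightarrow> (int ^ 'n \<Rightarrow> real ^ 'n) \<Rightarrow> bool" where
  "periodic N p \<longleftrightarrow> (\<forall>z k. p (zshift N z k) = p z + real N *\<^sub>R ivec k)"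

lemma periodicD: "periodic N p \<Longrightarrow> p (zshift N z k) = p z + real N *\<^sub>R ivec k"
  by (simp add: periodic_def)

text \<open>
  The sampling inequality, with the sum of the squared samples represented by an upper bound of its finite
  partial sums.
\<close>

definition stable_on :: "(int ^ 'n \<Rightarrow> real ^ 'n) \<Rightarrow> (real ^ 'n) set \<Rightarrow> real \<Rightarrow> bool" where
  "stable_on p S \<beta> \<longleftrightarrow> (\<forall>G K. L2on S G \<longrightarrow> (\<forall>F. finite F \<longrightarrow> (\<Sum>z\<in>F. (cmod (ft G (p z)))\<^sup>2) \<le> K) \<longrightarrow> \<beta> * sq_norm G \<le> K)"

definition solvable_on :: "(int ^ 'n \<Rightarrow> real ^ 'n) \<Rightarrow> (real ^ 'n) set \<Rightarrow> real \<Rightarrow> bool" where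
  "solvable_on p S \<beta> \<longleftrightarrow> (\<forall>c. finite {z. c z \<noteq> 0} \<longrightarrow> 
     (\<exists>G. L2on S G \<and> (\<forall>z. ft G (p z) = c z) \<and> \<beta> * sq_norm G \<le> (\<Sum>z | c z \<noteq> 0. (cmod (c z))\<^sup>2)))"

lemma sq_norm_combination_le:
  assumes "finite I" "\<And>i. i \<in> I \<Longrightarrow> L2on S (F i)"
  shows "sq_norm (\<lambda>u. \<Sum>i\<in>I. b i * (E (t i) u * F i u)) \<le> card I * (\<Sum>i\<in>I. (cmod (b i))\<^sup>2 * sq_norm (F i))"
proof -
  have *: "L2on S (\<lambda>u. (b i * E (t i) u) * F i u)" "sq_norm (\<lambda>u. (b i * E (t i) u) * F i u) \<le> (cmod (b i))\<^sup>2 * sq_norm (F i)"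
    if "i \<in> I" for i
    using L2on_mult[OF assms(2)[OF that], of "\<lambda>u. b i * E (t i) u" "cmod (b i)"] by (auto simp: norm_mult)
  have "sq_norm (\<lambda>u. \<Sum>i\<in>I. (b i * E (t i) u) * F i u) \<le> card I * (\<Sum>i\<in>I. sq_norm (\<lambda>u. (b i * E (t i) u) * F i u))"
    by (rule sq_norm_sum_le[OF assms(1) *(1)])
  also have "\<dots> \<le> card I * (\<Sum>i\<in>I. (cmod (b i))\<^sup>2 * sq_norm (F i))"
    by (intro mult_left_mono sum_mono *(2)) auto
  finally show ?thesis by (simp add: mult.assoc)
qed

context
  fixes N :: nat and A :: "(int ^ 'n) set" and p :: "int ^ 'n \<Rightarrow> real ^ 'n" and B :: "int ^ 'n \<Rightarrow> int ^ 'n \<Rightarrow> complex"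
  assumes N: "N > 0" and A: "finite A" and p: "periodic N p"
    and right: "\<And>r s. r \<in> res N \<Longrightarrow> s \<in> res N \<Longrightarrow> (\<Sum>a\<in>A. E (p r) (corner N a) * B a s) = (if r = s then 1 else 0)"
    and left: "\<And>a b. a \<in> A \<Longrightarrow> b \<in> A \<Longrightarrow> (\<Sum>r\<in>res N. B a r * E (p r) (corner N b)) = (if a = b then 1 else 0)"
begin

text \<open>
  The factors are the squared Frobenius norm of the inverse matrix \<open>B\<close>, the number of rows
  from the Cauchy-Schwarz inequality, and the factor of the Parseval identity on the cube.
\<close>

definition Bnorm :: real where
  "Bnorm = real (card (res N :: (int ^ 'n) set)) * (\<Sum>a\<in>A. \<Sum>r\<in>res N. (cmod (B a r))\<^sup>2) * real N ^ CARD('n)"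

lemma Bnorm_nonneg: "Bnorm \<ge> 0"
  unfolding Bnorm_def by (intro mult_nonneg_nonneg sum_nonneg) auto

text \<open>
  The function \<open>H r\<close> on the cube has the samples of \<open>G\<close> on the residue class of \<open>r\<close> as Fourier coefficients, so
  it is bounded by them; the left inverse recovers the pieces of \<open>G\<close> from the functions \<open>H r\<close>.
\<close>

lemma stable_tile: "stable_on p (tile N A) (1 / (Bnorm + 1))"
  unfolding stable_on_def
proof (intro allI impI)
  fix G K assume G: "L2on (tile N A) G" and K: "\<forall>F. finite F \<longrightarrow> (\<Sum>z\<in>F. (cmod (ft G (p z)))\<^sup>2) \<le> K"
  define H where "H = (\<lambda>r. fold_tile N A G (p r))"
  have LH: "L2on (cube N) (H r)" for r unfolding H_def by (rule L2on_fold[OF N A G])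
  have K0: "K \<ge> 0" using K by (metis finite.emptyI sum.empty)
  have H: "sq_norm (H r) \<le> real N ^ CARD('n) * K" for r
  proof (rule parseval_cube[OF N LH])
    fix k :: "(int ^ 'n) set" assume k: "finite k"
    have "(\<Sum>k\<in>k. (cmod (ft (H r) (real N *\<^sub>R ivec k)))\<^sup>2) = (\<Sum>k\<in>k. (cmod (ft G (p (zshift N r k))))\<^sup>2)"
      unfolding H_def ft_fold[OF N A G, symmetric] periodicD[OF p] ..
    also have "\<dots> = (\<Sum>z\<in>zshift N r ` k. (cmod (ft G (p z)))\<^sup>2)"
      using inj_on_subset[OF zshift_inj[OF N]] by (subst sum.reindex) auto
    also have "\<dots> \<le> K" using K k by blast
    finally show "(\<Sum>k\<in>k. (cmod (ft (H r) (real N *\<^sub>R ivec k)))\<^sup>2) \<le> K" .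
  qed
  have piece: "piece N G a = (\<lambda>u. \<Sum>r\<in>res N. B a r * (E (- p r) u * H r u))" if a: "a \<in> A" for a
  proof
    fix u
    have "(\<Sum>r\<in>res N. B a r * (E (- p r) u * H r u)) 
        = (\<Sum>r\<in>res N. \<Sum>b\<in>A. B a r * E (p r) (corner N b) * piece N G b u)"
    proof (rule sum.cong[OF refl])
      fix r
      have "E (- p r) u * (E (p r) (u + corner N b) * w) = E (p r) (corner N b) * w" for b w
        unfolding E_add_right by (simp add: E_minus_mult flip: mult.assoc)
      then show "B a r * (E (- p r) u * H r u) = (\<Sum>b\<in>A. B a r * E (p r) (corner N b) * piece N G b u)"
        unfolding H_def fold_tile_def[OF N A G] sum_distrib_left
        by (intro sum.cong refl) (simp add: mult.assoc)
    qed
    also have "\<dots> = (\<Sum>b\<in>A. (\<Sum>r\<in>res N. B a r * E (p r) (corner N b)) * piece N G b u)"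
      by (subst sum.swap) (simp add: sum_distrib_right)
    also have "\<dots> = (\<Sum>b\<in>A. if a = b then piece N G b u else 0)"
      using left[OF a] by (intro sum.cong refl) auto
    also have "\<dots> = piece N G a u" using A a by simp
    finally show "piece N G a u = (\<Sum>r\<in>res N. B a r * (E (- p r) u * H r u))" by simp
  qed
  have "sq_norm G = (\<Sum>a\<in>A. sq_norm (piece N G a))" by (rule sq_norm_pieces[OF N A G])
  also have "\<dots> \<le> (\<Sum>a\<in>A. real (card (res N :: (int ^ 'n) set)) * (\<Sum>r\<in>res N. (cmod (B a r))\<^sup>2 * (real N ^ CARD('n) * K)))"
  proof (intro sum_mono)
    fix a assume a: "a \<in> A"
    have "sq_norm (piece N G a) \<le> real (card (res N :: (int ^ 'n) set)) * (\<Sum>r\<in>res N. (cmod (B a r))\<^sup>2 * sq_norm (H r))"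
      unfolding piece[OF a] using LH by (intro sq_norm_combination_le) auto
    also have "\<dots> \<le> real (card (res N :: (int ^ 'n) set)) * (\<Sum>r\<in>res N. (cmod (B a r))\<^sup>2 * (real N ^ CARD('n) * K))"
      by (intro mult_left_mono sum_mono H) auto
    finally show "sq_norm (piece N G a) \<le> \<dots>" .
  qed
  also have "\<dots> = Bnorm * K"
    by (simp add: Bnorm_def sum_distrib_left sum_distrib_right mult_ac)
  also have "\<dots> \<le> (Bnorm + 1) * K" using K0 by (simp add: distrib_right)
  finally show "1 / (Bnorm + 1) * sq_norm G \<le> K" using Bnorm_nonneg by (simp add: field_simps)
qed

text \<open>
  The data on the residue class of \<open>r\<close> prescribe the Fourier coefficients of a trigonometric polynomial \<open>H r\<close> on
  the cube. The right inverse produces pieces whose foldings are the given \<open>H r\<close>.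
\<close>

lemma solvable_tile: "solvable_on p (tile N A) (1 / (Bnorm + 1))"
  unfolding solvable_on_def
proof (intro allI impI)
  fix c :: "int ^ 'n \<Rightarrow> complex" assume fin: "finite {z. c z \<noteq> 0}"
  define Z where "Z = {z. c z \<noteq> 0}"
  define S where "S = (\<Sum>z\<in>Z. (cmod (c z))\<^sup>2)"
  define L where "L = zdiv N ` Z"
  have Z: "finite Z" "finite L" using fin by (auto simp: Z_def L_def)
  define W where "W = real N ^ CARD('n)"
  have W: "W > 0" using N by (simp add: W_def)
  let ?I = "indicator (cube N) :: real ^ 'n \<Rightarrow> real"
  define b where "b = (\<lambda>r k. of_real W * c (zshift N r k))"
  define h where "h = (\<lambda>r u. \<Sum>k\<in>L. b r k * cnj (fexp N k u))"
  define H where "H = (\<lambda>r u. of_real (?I u) * h r u)"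
  have intI: "integrable lborel ?I" by (rule finite_indicator_bounded) auto
  have LI: "L2on (cube N) (\<lambda>u. of_real (?I u))"
    using intI by (intro L2on_bound[where w="?I"]) (auto simp: indicator_def)
  have LH: "L2on (cube N) (H r)" for r
  proof -
    have "L2on (cube N) (\<lambda>u. \<Sum>k\<in>L. (b r k * cnj (fexp N k u)) * of_real (?I u))"
      unfolding cnj_E by (intro L2on_sum L2on_mult(1)[OF LI, where B="cmod (b r _)"]) (auto simp: norm_mult)
    moreover have "(\<lambda>u. \<Sum>k\<in>L. (b r k * cnj (fexp N k u)) * of_real (?I u)) = H r"
      unfolding H_def h_def by (intro ext) (simp only: sum_distrib_left mult.commute)
    ultimately show ?thesis by (simp only:)
  qed
  have ftH: "ft (H r) (real N *\<^sub>R ivec k) = c (zshift N r k)" if r: "r \<in> res N" for r k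
  proof -
    have fe: "fexp N (k - l) u = fexp N k u * cnj (fexp N l u)" for l u
      by (simp add: cnj_E scaleR_diff_right E_diff_left)
    have "fexp N k u * H r u = (\<Sum>l\<in>L. b r l * (?I u *\<^sub>R fexp N (k - l) u))" for u
      unfolding H_def h_def sum_distrib_left
      by (intro sum.cong refl) (simp only: fe scaleR_conv_of_real[where 'a=complex] mult_ac)
    then have "ft (H r) (real N *\<^sub>R ivec k) = (LINT u|lborel. (\<Sum>l\<in>L. b r l * (?I u *\<^sub>R fexp N (k - l) u)))"
      by (simp add: ft_def)
    also have "\<dots> = (\<Sum>l\<in>L. LINT u|lborel. b r l * (?I u *\<^sub>R fexp N (k - l) u))"
    proof (rule Bochner_Integration.integral_sum)
      fix l
      have "integrable lborel (\<lambda>u. ?I u *\<^sub>R fexp N (k - l) u)"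
        using integrable_E_mult[OF LI bounded_cube, of "real N *\<^sub>R ivec (k - l)"] by (simp only: scaleR_conv_of_real[where 'a=complex] mult.commute)
      then show "integrable lborel (\<lambda>u. b r l * (?I u *\<^sub>R fexp N (k - l) u))" by (rule integrable_mult_right)
    qed
    also have "\<dots> = (\<Sum>l\<in>L. b r l * (LINT u|lborel. ?I u *\<^sub>R fexp N (k - l) u))"
      by (intro sum.cong refl integral_mult_right_zero)
    also have "\<dots> = (\<Sum>l\<in>L. if l = k then c (zshift N r k) else 0)"
      unfolding orthogonality[OF N] using W by (intro sum.cong refl) (auto simp: b_def W_def power_one_over)
    also have "\<dots> = c (zshift N r k)"
    proof (cases "k \<in> L")
      case False
      then have "zshift N r k \<notin> Z" unfolding L_def by (metis imageI zdiv_zshift[OF r])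
      then show ?thesis using False Z by (simp add: Z_def)
    qed (use Z in simp)
    finally show ?thesis .
  qed
  have sqnH: "sq_norm (H r) \<le> W * S" for r
  proof -
    have "sq_norm (H r) = (LINT u|lborel. ?I u * (cmod (0 - h r u))\<^sup>2)"
      unfolding sq_norm_def by (intro Bochner_Integration.integral_cong refl) (simp add: H_def indicator_def)
    also have "\<dots> = (\<Sum>k\<in>L. (cmod (b r k))\<^sup>2) / W"
      unfolding h_def using sq_norm_residual[OF N L2on_zero Z(2), of "b r"] by (simp add: sq_norm_def ft_def W_def)
    also have "\<dots> = W * (\<Sum>k\<in>L. (cmod (c (zshift N r k)))\<^sup>2)"
      using W by (simp add: b_def norm_mult power_mult_distrib power2_eq_square sum_divide_distrib sum_distrib_left mult_ac)
    also have "(\<Sum>k\<in>L. (cmod (c (zshift N r k)))\<^sup>2) = (\<Sum>z\<in>zshift N r ` L. (cmod (c z))\<^sup>2)"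
      using inj_on_subset[OF zshift_inj[OF N]] by (subst sum.reindex) auto
    also have "\<dots> = (\<Sum>z\<in>zshift N r ` L \<inter> Z. (cmod (c z))\<^sup>2)"
      using Z by (intro sum.mono_neutral_right) (auto simp: Z_def)
    also have "\<dots> \<le> S" unfolding S_def using Z by (intro sum_mono2) auto
    finally show ?thesis using W by (simp add: mult_left_mono)
  qed
  define P where "P = (\<lambda>a u. \<Sum>r\<in>res N. B a r * (E (- p r) u * H r u))"
  have LP: "L2on (cube N) (P a)" for a
    unfolding P_def using L2on_mult(1)[OF LH, where B="cmod (B a _)" and b="\<lambda>u. B a _ * E (- p _) u"]
    by (intro L2on_sum) (auto simp: norm_mult mult.assoc)
  define G where "G = (\<lambda>y. \<Sum>a\<in>A. P a (y - corner N a))"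
  have LG: "L2on (tile N A) G"
    unfolding G_def
  proof (rule L2on_sum)
    fix a assume a: "a \<in> A"
    have [measurable]: "P a \<in> borel_measurable borel" using L2onD(1)[OF LP] .
    have "integrable lborel (\<lambda>x. (cmod (P a (x - corner N a)))\<^sup>2)"
      using integrable_shift[of "\<lambda>x. (cmod (P a x))\<^sup>2" "- corner N a"] L2onD(2)[OF LP] by simp
    moreover have "P a (x - corner N a) = 0" if "x \<notin> tile N A" for x
      using that a cell_eq_iff[OF N, of x a] by (intro L2onD(3)[OF LP]) (auto simp: tile_def)
    ultimately show "L2on (tile N A) (\<lambda>y. P a (y - corner N a))"
      unfolding L2on_def by auto
  qed
  have piece: "piece N G a = P a" if a: "a \<in> A" for a
  proof
    fix u
    show "piece N G a u = P a u"
    proof (cases "u \<in> cube N")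
      case True
      have "P b (u + corner N a - corner N b) = (if b = a then P a u else 0)" for b
        using L2onD(3)[OF LP, of "u + corner N a - corner N b" b] cell_eq_iff[OF N, of "u + corner N a" b] cell_shift[OF N True, of a]
        by auto
      then show ?thesis using True A a by (simp add: piece_def G_def)
    next
      case False
      then show ?thesis using L2onD(3)[OF LP] by (simp add: piece_def)
    qed
  qed
  have fold: "fold_tile N A G (p s) = H s" if s: "s \<in> res N" for s
  proof
    fix u
    have "fold_tile N A G (p s) u = (\<Sum>a\<in>A. \<Sum>r\<in>res N. E (p s) (corner N a) * B a r * (E (p s) u * E (- p r) u * H r u))"
      unfolding fold_tile_def[OF N A LG] 
      by (intro sum.cong refl) (simp add: piece P_def E_add_right sum_distrib_left mult_ac)
    also have "\<dots> = (\<Sum>r\<in>res N. (\<Sum>a\<in>A. E (p s) (corner N a) * B a r) * (E (p s) u * E (- p r) u * H r u))"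
      by (subst sum.swap) (simp add: sum_distrib_right)
    also have "\<dots> = (\<Sum>r\<in>res N. if s = r then H r u else 0)"
      using right[OF s] by (intro sum.cong refl) (auto simp: E_minus_mult)
    also have "\<dots> = H s u" using s by simp
    finally show "fold_tile N A G (p s) u = H s u" .
  qed
  have "ft G (p z) = c z" for z
  proof -
    have "p z = p (zmod N z) + real N *\<^sub>R ivec (zdiv N z)"
      using periodicD[OF p, of "zmod N z" "zdiv N z"] by simp
    then have "ft G (p z) = ft (fold_tile N A G (p (zmod N z))) (real N *\<^sub>R ivec (zdiv N z))"
      using ft_fold[OF N A LG] by simp
    then show ?thesis using N by (simp add: fold ftH)
  qed
  moreover have "1 / (Bnorm + 1) * sq_norm G \<le> S"
  proof -
    have "sq_norm G = (\<Sum>a\<in>A. sq_norm (P a))" unfolding sq_norm_pieces[OF N A LG] using piece by simp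
    also have "\<dots> \<le> (\<Sum>a\<in>A. real (card (res N :: (int ^ 'n) set)) * (\<Sum>r\<in>res N. (cmod (B a r))\<^sup>2 * (W * S)))"
    proof (intro sum_mono)
      fix a assume a: "a \<in> A"
      have "sq_norm (P a) \<le> real (card (res N :: (int ^ 'n) set)) * (\<Sum>r\<in>res N. (cmod (B a r))\<^sup>2 * sq_norm (H r))"
        unfolding P_def using LH by (intro sq_norm_combination_le) auto
      also have "\<dots> \<le> real (card (res N :: (int ^ 'n) set)) * (\<Sum>r\<in>res N. (cmod (B a r))\<^sup>2 * (W * S))"
        by (intro mult_left_mono sum_mono sqnH) auto
      finally show "sq_norm (P a) \<le> \<dots>" .
    qed
    also have "\<dots> = Bnorm * S"
      by (simp add: Bnorm_def W_def sum_distrib_left sum_distrib_right mult_ac)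
    also have "\<dots> \<le> (Bnorm + 1) * S" by (simp add: distrib_right S_def sum_nonneg)
    finally show ?thesis using Bnorm_nonneg by (simp add: field_simps)
  qed
  ultimately show "\<exists>G. L2on (tile N A) G \<and> (\<forall>z. ft G (p z) = c z) \<and> 1 / (Bnorm + 1) * sq_norm G \<le> (\<Sum>z | c z \<noteq> 0. (cmod (c z))\<^sup>2)"
    using LG unfolding S_def Z_def by blast
qed

end

lemma stable_on_mono:
  assumes "stable_on p S \<beta>" "\<beta>' \<le> \<beta>" shows "stable_on p S \<beta>'"
  unfolding stable_on_def
proof (intro allI impI)
  fix G K assume "L2on S G" "\<forall>F. finite F \<longrightarrow> (\<Sum>z\<in>F. (cmod (ft G (p z)))\<^sup>2) \<le> K"
  then have "\<beta> * sq_norm G \<le> K" using assms(1) unfolding stable_on_def by blast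
  moreover have "\<beta>' * sq_norm G \<le> \<beta> * sq_norm G" using assms(2) by (intro mult_right_mono) auto
  ultimately show "\<beta>' * sq_norm G \<le> K" by linarith
qed

lemma solvable_on_mono:
  assumes "solvable_on p S \<beta>" "\<beta>' \<le> \<beta>" shows "solvable_on p S \<beta>'"
  unfolding solvable_on_def
proof (intro allI impI)
  fix c :: "int ^ 'a \<Rightarrow> complex" assume "finite {z. c z \<noteq> 0}"
  then obtain G where G: "L2on S G" "\<forall>z. ft G (p z) = c z" "\<beta> * sq_norm G \<le> (\<Sum>z | c z \<noteq> 0. (cmod (c z))\<^sup>2)"
    using assms(1) unfolding solvable_on_def by blast
  have "\<beta>' * sq_norm G \<le> \<beta> * sq_norm G" using assms(2) by (intro mult_right_mono) auto
  then show "\<exists>G. L2on S G \<and> (\<forall>z. ft G (p z) = c z) \<and> \<beta>' * sq_norm G \<le> (\<Sum>z | c z \<noteq> 0. (cmod (c z))\<^sup>2)"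
    using G by (intro exI[of _ G]) auto
qed

lemma corner_inj: "N > 0 \<Longrightarrow> inj (corner N)"
  by (auto simp: inj_def corner_def)

lemma stage_constant:
  fixes p :: "int ^ 'n \<Rightarrow> real ^ 'n"
  assumes N: "N > 0" and \<Phi>: "finite \<Phi>" and p: "periodic N p"
    and U: "\<And>A. A \<subseteq> \<Phi> \<Longrightarrow> card A = N ^ CARD('n) \<Longrightarrow> unisolvent (corner N) (res N) A p"
  shows "\<exists>\<beta>>0. \<forall>A. A \<subseteq> \<Phi> \<longrightarrow> card A = N ^ CARD('n) \<longrightarrow> stable_on p (tile N A) \<beta> \<and> solvable_on p (tile N A) \<beta>"
proof -
  define \<A> where "\<A> = {A. A \<subseteq> \<Phi> \<and> card A = N ^ CARD('n)}"
  have fin: "finite \<A>" using \<Phi> unfolding \<A>_def by auto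
  have "\<exists>\<beta>>0. stable_on p (tile N A) \<beta> \<and> solvable_on p (tile N A) \<beta>" if "A \<in> \<A>" for A
  proof -
    have A: "finite A" "unisolvent (corner N) (res N) A p" 
      using that \<Phi> finite_subset U unfolding \<A>_def by auto
    obtain B where B: "\<And>r s. r \<in> res N \<Longrightarrow> s \<in> res N \<Longrightarrow> (\<Sum>a\<in>A. E (p r) (corner N a) * B a s) = (if r = s then 1 else 0)"
      "\<And>a b. a \<in> A \<Longrightarrow> b \<in> A \<Longrightarrow> (\<Sum>r\<in>res N. B a r * E (p r) (corner N b)) = (if a = b then 1 else 0)"
      using unisolvent_inverse[OF A(2) A(1) finite_res] by blast
    show ?thesis
      using stable_tile[OF N A(1) p B] solvable_tile[OF N A(1) p B] Bnorm_nonneg[OF N A(1) p B] 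
      by (intro exI[of _ "1 / (Bnorm N A B + 1)"]) auto
  qed
  then have "\<forall>A\<in>\<A>. \<exists>\<beta>. \<beta> > 0 \<and> stable_on p (tile N A) \<beta> \<and> solvable_on p (tile N A) \<beta>" by blast
  from bchoice[OF this] obtain b where b: "\<And>A. A \<in> \<A> \<Longrightarrow> b A > 0 \<and> stable_on p (tile N A) (b A) \<and> solvable_on p (tile N A) (b A)"
    by blast
  define \<beta> where "\<beta> = Min (insert 1 (b ` \<A>))"
  have "\<beta> > 0" unfolding \<beta>_def using fin b by (subst Min_gr_iff) auto
  moreover have "stable_on p (tile N A) \<beta> \<and> solvable_on p (tile N A) \<beta>" if A: "A \<in> \<A>" for A
  proof -
    have "\<beta> \<le> b A" unfolding \<beta>_def using fin A by (intro Min_le) auto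
    then show ?thesis using b[OF A] stable_on_mono solvable_on_mono by blast
  qed
  ultimately show ?thesis unfolding \<A>_def by (intro exI[of _ \<beta>]) simp
qed

section \<open>From approximate to exact interpolation\<close>

text \<open>
  Solvability of a finitely supported problem up to the relative error \<open>1/16\<close> in squared norm. Together with an error of
  the same size from truncating \<open>l2\<close> data it gives \<open>2/16 + 2/16 = 1/4\<close> in \<open>approx_solve_step\<close>.
\<close>

definition approx_solvable_on :: "(int ^ 'n \<Rightarrow> real ^ 'n) \<Rightarrow> (real ^ 'n) set \<Rightarrow> real \<Rightarrow> bool" where
  "approx_solvable_on p S \<beta> \<longleftrightarrow> (\<forall>c. finite {z. c z \<noteq> 0} \<longrightarrow> 
     (\<exists>G. L2on S G \<and> \<beta> * sq_norm G \<le> (\<Sum>z | c z \<noteq> 0. (cmod (c z))\<^sup>2) \<and>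
       (\<forall>F. finite F \<longrightarrow> (\<Sum>z\<in>F. (cmod (c z - ft G (p z)))\<^sup>2) \<le> (\<Sum>z | c z \<noteq> 0. (cmod (c z))\<^sup>2) / 16)))"

definition l2_bound :: "('a \<Rightarrow> complex) \<Rightarrow> real \<Rightarrow> bool" where
  "l2_bound c B \<longleftrightarrow> (\<forall>F. finite F \<longrightarrow> (\<Sum>z\<in>F. (cmod (c z))\<^sup>2) \<le> B)"

lemma l2_boundD: "l2_bound c B \<Longrightarrow> finite F \<Longrightarrow> (\<Sum>z\<in>F. (cmod (c z))\<^sup>2) \<le> B"
  by (simp add: l2_bound_def)

lemma l2_bound_nonneg: "l2_bound c B \<Longrightarrow> B \<ge> 0"
  using l2_boundD[of c B "{}"] by simp

lemma l2_bound_tail: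
  assumes "l2_bound c B" "e > 0"
  shows "\<exists>F0. finite F0 \<and> (\<forall>F. finite F \<longrightarrow> F \<inter> F0 = {} \<longrightarrow> (\<Sum>z\<in>F. (cmod (c z))\<^sup>2) \<le> e)"
proof -
  let ?s = "\<lambda>F. \<Sum>z\<in>F. (cmod (c z))\<^sup>2"
  let ?X = "?s ` {F. finite F}"
  have bdd: "bdd_above ?X" using l2_boundD[OF assms(1)] by (intro bdd_aboveI[of _ B]) auto
  have "\<exists>x\<in>?X. Sup ?X - e < x" using assms(2) by (intro less_cSup_iff[THEN iffD1, OF _ bdd]) auto
  then obtain F0 where F0: "finite F0" "Sup ?X - e < ?s F0" by auto
  have "?s F \<le> e" if F: "finite F" "F \<inter> F0 = {}" for F
  proof -
    have "?s F + ?s F0 = ?s (F \<union> F0)" using F F0 by (simp add: sum.union_disjoint)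
    also have "\<dots> \<le> Sup ?X" using F F0 by (intro cSup_upper[OF _ bdd]) auto
    finally show ?thesis using F0 by linarith
  qed
  then show ?thesis using F0 by blast
qed

lemma approx_solve_step:
  assumes A: "approx_solvable_on p S \<beta>" and \<beta>: "\<beta> > 0" and c: "l2_bound c B"
  shows "\<exists>G. L2on S G \<and> sq_norm G \<le> B / \<beta> \<and> l2_bound (\<lambda>z. c z - ft G (p z)) (B / 4)"
proof (cases "B = 0")
  case True
  have "c z = 0" for z using l2_boundD[OF c, of "{z}"] True by simp
  then show ?thesis using True by (intro exI[of _ "\<lambda>_. 0"]) (auto simp: L2on_zero sq_norm_def ft_def l2_bound_def)
next
  case False
  then have B: "B > 0" using l2_bound_nonneg[OF c] by simp
  obtain F0 where F0: "finite F0" "\<And>F. finite F \<Longrightarrow> F \<inter> F0 = {} \<Longrightarrow> (\<Sum>z\<in>F. (cmod (c z))\<^sup>2) \<le> B / 16"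
    using l2_bound_tail[OF c, of "B / 16"] B by auto
  define c1 where "c1 = (\<lambda>z. if z \<in> F0 then c z else 0)"
  define s where "s = (\<Sum>z | c1 z \<noteq> 0. (cmod (c1 z))\<^sup>2)"
  have sub: "{z. c1 z \<noteq> 0} \<subseteq> F0" by (auto simp: c1_def)
  then have fin: "finite {z. c1 z \<noteq> 0}" using F0(1) finite_subset by blast
  have "s = (\<Sum>z | c1 z \<noteq> 0. (cmod (c z))\<^sup>2)"
    unfolding s_def using sub by (intro sum.cong) (auto simp: c1_def)
  also have "\<dots> \<le> B" by (rule l2_boundD[OF c fin])
  finally have s: "s \<le> B" .
  obtain G where G: "L2on S G" "\<beta> * sq_norm G \<le> s" 
    "\<And>F. finite F \<Longrightarrow> (\<Sum>z\<in>F. (cmod (c1 z - ft G (p z)))\<^sup>2) \<le> s / 16"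
    using A fin unfolding approx_solvable_on_def s_def by blast
  have "l2_bound (\<lambda>z. c z - ft G (p z)) (B / 4)"
    unfolding l2_bound_def
  proof (intro allI impI)
    fix F :: "(int ^ 'a) set" assume F: "finite F"
    have "(\<Sum>z\<in>F. (cmod (c z - ft G (p z)))\<^sup>2) \<le> (\<Sum>z\<in>F. 2 * (cmod (c z - c1 z))\<^sup>2 + 2 * (cmod (c1 z - ft G (p z)))\<^sup>2)"
    proof (intro sum_mono)
      fix z show "(cmod (c z - ft G (p z)))\<^sup>2 \<le> 2 * (cmod (c z - c1 z))\<^sup>2 + 2 * (cmod (c1 z - ft G (p z)))\<^sup>2"
        using sum_sq_le[of "c z - c1 z" "c1 z - ft G (p z)"] by simp
    qed
    also have "\<dots> = 2 * (\<Sum>z\<in>F. (cmod (c z - c1 z))\<^sup>2) + 2 * (\<Sum>z\<in>F. (cmod (c1 z - ft G (p z)))\<^sup>2)"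
      by (simp add: sum.distrib sum_distrib_left)
    also have "(\<Sum>z\<in>F. (cmod (c z - c1 z))\<^sup>2) = (\<Sum>z\<in>F - F0. (cmod (c z))\<^sup>2)"
      using F by (intro sum.mono_neutral_cong_right) (auto simp: c1_def)
    also have "\<dots> \<le> B / 16" using F by (intro F0(2)) auto
    also have "(\<Sum>z\<in>F. (cmod (c1 z - ft G (p z)))\<^sup>2) \<le> B / 16" using G(3)[OF F] s by simp
    finally show "(\<Sum>z\<in>F. (cmod (c z - ft G (p z)))\<^sup>2) \<le> B / 4" by simp
  qed
  moreover have "sq_norm G \<le> B / \<beta>" using G(2) s \<beta> by (simp add: field_simps)
  ultimately show ?thesis using G(1) by blast
qed

lemma AE_summable:
  fixes f :: "nat \<Rightarrow> 'a \<Rightarrow> real"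
  assumes f: "\<And>k. integrable M (f k)" "\<And>k x. f k x \<ge> 0" and s: "summable (\<lambda>k. LINT x|M. f k x)"
  shows "AE x in M. summable (\<lambda>k. f k x)"
proof -
  have [measurable]: "f k \<in> borel_measurable M" for k using f(1) by auto
  have "(\<integral>\<^sup>+x. (\<Sum>k. ennreal (f k x)) \<partial>M) = (\<Sum>k. \<integral>\<^sup>+x. ennreal (f k x) \<partial>M)"
    by (rule nn_integral_suminf) auto
  also have "\<dots> = (\<Sum>k. ennreal (LINT x|M. f k x))"
    using f by (simp add: nn_integral_eq_integral)
  also have "\<dots> \<noteq> \<infinity>"
    using s f(2) by (simp add: ennreal_suminf_neq_top Bochner_Integration.integral_nonneg)
  finally have "AE x in M. (\<Sum>k. ennreal (f k x)) \<noteq> \<infinity>"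
    by (intro nn_integral_PInf_AE) auto
  then show ?thesis by eventually_elim (auto intro: summable_suminf_not_top f(2))
qed

text \<open>
  The Cauchy-Schwarz inequality for the factors \<open>2 ^ (-k/2)\<close> and \<open>2 ^ (k/2) * a k\<close>.
\<close>

lemma weighted_sum_square:
  "(\<Sum>k<n. a k)\<^sup>2 \<le> 2 * (\<Sum>k<n. 2 ^ k * (a k :: real)\<^sup>2)"
proof -
  have "(\<Sum>k<n. a k) = (\<Sum>k<n. sqrt ((1/2) ^ k) * (sqrt (2 ^ k) * a k))"
    by (intro sum.cong refl) (simp add: real_sqrt_divide power_one_over flip: mult.assoc real_sqrt_mult power_mult_distrib)
  then have "(\<Sum>k<n. a k)\<^sup>2 \<le> (\<Sum>k<n. (sqrt ((1/2) ^ k))\<^sup>2) * (\<Sum>k<n. (sqrt (2 ^ k) * a k)\<^sup>2)"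
    using Cauchy_Schwarz_ineq_sum by metis
  also have "(\<Sum>k<n. (sqrt ((1/2) ^ k))\<^sup>2) = (\<Sum>k<n. (1/2 :: real) ^ k)"
    by simp
  also have "\<dots> \<le> 2" by (subst geometric_sum) auto
  also have "(\<Sum>k<n. (sqrt (2 ^ k) * a k)\<^sup>2) = (\<Sum>k<n. 2 ^ k * (a k)\<^sup>2)"
    by (simp add: power_mult_distrib)
  finally show ?thesis by (simp add: mult_right_mono sum_nonneg)
qed

text \<open>
  A series whose squared norms decay like \<open>4 ^ (-k)\<close> converges absolutely almost everywhere, because
  the weighted series of squares \<open>2 ^ k * |G k|\<^sup>2\<close> has a finite integral; the same series dominates the
  square of the sum.
\<close>

lemma L2on_series:
  fixes G :: "nat \<Rightarrow> real ^ 'n \<Rightarrow> complex"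
  assumes G: "\<And>k. L2on S (G k)" and S: "bounded S" and C: "\<And>k. sq_norm (G k) \<le> C / 4 ^ k"
  shows "L2on S (\<lambda>x. \<Sum>k. G k x)" "(\<lambda>k. ft (G k) t) sums ft (\<lambda>x. \<Sum>k. G k x) t"
proof -
  have [measurable]: "G k \<in> borel_measurable borel" for k using L2onD(1)[OF G] .
  obtain a b where ab: "S \<subseteq> cbox a b" using S bounded_subset_cbox_symmetric by metis
  let ?h = "\<lambda>k x. 2 ^ k * (cmod (G k x))\<^sup>2"
  have h: "integrable lborel (?h k)" for k using L2onD(2)[OF G] by simp
  have inth: "(LINT x|lborel. ?h k x) = 2 ^ k * sq_norm (G k)" for k by (simp add: sq_norm_def)
  have hle: "2 ^ k * sq_norm (G k) \<le> C * (1/2) ^ k" for k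
  proof -
    have "2 ^ k * sq_norm (G k) \<le> 2 ^ k * (C / 4 ^ k)" by (intro mult_left_mono C) auto
    also have "\<dots> = C * (1/2) ^ k"
      by (simp add: power_divide[of 1 2] field_simps flip: power_mult_distrib)
    finally show ?thesis .
  qed
  have geo: "summable (\<lambda>k. D * (1/2 :: real) ^ k)" for D by (intro summable_mult summable_geometric) simp
  have sumh: "summable (\<lambda>k. LINT x|lborel. ?h k x)"
    unfolding inth by (rule summable_comparison_test'[OF geo[of C], of 0]) (use hle in auto)
  have AEh: "AE x in lborel. summable (\<lambda>k. ?h k x)"
    by (rule AE_summable[OF h _ sumh]) auto
  let ?V = "LINT x|lborel. indicator (cbox a b :: (real ^ 'n) set) x"
  have V: "integrable lborel (indicator (cbox a b) :: real ^ 'n \<Rightarrow> real)"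
    by (rule finite_indicator_bounded) auto
  have pt: "cmod (G k x) \<le> (1/2) ^ k * indicator (cbox a b) x + ?h k x" for k x
  proof (cases "x \<in> S")
    case True
    have "0 \<le> ((1/2) ^ k - cmod (G k x))\<^sup>2" by simp
    then have "2 * ((1/2) ^ k * cmod (G k x)) \<le> ((1/2) ^ k)\<^sup>2 + (cmod (G k x))\<^sup>2" by (simp add: power2_diff)
    then have "2 ^ k * (2 * ((1/2) ^ k * cmod (G k x))) \<le> 2 ^ k * (((1/2) ^ k)\<^sup>2 + (cmod (G k x))\<^sup>2)"
      by (intro mult_left_mono) auto
    also have "2 ^ k * (2 * ((1/2) ^ k * cmod (G k x))) = 2 * cmod (G k x)"
      by (simp add: power_one_over)
    also have "2 ^ k * (((1/2) ^ k)\<^sup>2 + (cmod (G k x))\<^sup>2) = (1/2) ^ k + ?h k x"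
      by (simp add: power_one_over distrib_left power2_eq_square)
    finally have "2 * cmod (G k x) \<le> (1/2) ^ k + ?h k x" .
    then have "cmod (G k x) \<le> (1/2) ^ k + ?h k x" using norm_ge_zero[of "G k x"] by linarith
    then show ?thesis using True ab by (auto simp: indicator_def)
  qed (use L2onD(3)[OF G] in auto)
  have intG: "integrable lborel (G k)" for k by (rule L2on_integrable[OF G S])
  have "(LINT x|lborel. cmod (G k x)) \<le> (?V + C) * (1/2) ^ k" for k
  proof -
    have "(LINT x|lborel. cmod (G k x)) \<le> (LINT x|lborel. (1/2) ^ k * indicator (cbox a b) x + ?h k x)"
      using intG h V by (intro integral_mono pt) auto
    also have "\<dots> = (1/2) ^ k * ?V + 2 ^ k * sq_norm (G k)"
      using h V by (simp add: sq_norm_def)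
    also have "\<dots> \<le> (?V + C) * (1/2) ^ k" using hle[of k] by (simp add: algebra_simps)
    finally show ?thesis .
  qed
  then have sumG: "summable (\<lambda>k. LINT x|lborel. cmod (G k x))"
    by (intro summable_comparison_test'[OF geo[of "?V + C"], of 0]) auto
  have AEG: "AE x in lborel. summable (\<lambda>k. cmod (G k x))"
    by (rule AE_summable[OF _ _ sumG]) (use intG in auto)
  have int_h: "integrable lborel (\<lambda>x. \<Sum>k. ?h k x)"
    by (rule integrable_suminf[OF h]) (use AEh sumh in auto)
  have bound: "AE x in lborel. norm ((cmod (\<Sum>k. G k x))\<^sup>2) \<le> norm (2 * (\<Sum>k. ?h k x))"
    using AEh AEG
  proof eventually_elim
    case (elim x)
    have "(\<lambda>n. (\<Sum>k<n. cmod (G k x))\<^sup>2) \<longlonglongrightarrow> (\<Sum>k. cmod (G k x))\<^sup>2"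
      by (intro tendsto_intros summable_LIMSEQ elim)
    moreover have "(\<Sum>k<n. cmod (G k x))\<^sup>2 \<le> 2 * (\<Sum>k. ?h k x)" for n
      by (rule order_trans[OF weighted_sum_square]) 
        (intro mult_left_mono sum_le_suminf elim, auto)
    ultimately have "(\<Sum>k. cmod (G k x))\<^sup>2 \<le> 2 * (\<Sum>k. ?h k x)"
      by (intro LIMSEQ_le_const2) auto
    moreover have "(cmod (\<Sum>k. G k x))\<^sup>2 \<le> (\<Sum>k. cmod (G k x))\<^sup>2"
      by (intro power_mono summable_norm elim) auto
    ultimately show ?case by simp
  qed
  have "integrable lborel (\<lambda>x. (cmod (\<Sum>k. G k x))\<^sup>2)"
    by (rule Bochner_Integration.integrable_bound[OF _ _ bound]) (use int_h in auto)
  then show "L2on S (\<lambda>x. \<Sum>k. G k x)"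
    using L2onD(3)[OF G] by (auto simp: L2on_def)
  have "(\<lambda>k. LINT y|lborel. E t y * G k y) sums (LINT y|lborel. (\<Sum>k. E t y * G k y))"
  proof (rule sums_integral)
    show "integrable lborel (\<lambda>y. E t y * G k y)" for k by (rule integrable_E_mult[OF G S])
  qed (use AEG sumG in \<open>simp_all add: norm_mult\<close>)
  also have "(LINT y|lborel. (\<Sum>k. E t y * G k y)) = (LINT y|lborel. E t y * (\<Sum>k. G k y))"
  proof (rule integral_cong_AE)
    show "AE y in lborel. (\<Sum>k. E t y * G k y) = E t y * (\<Sum>k. G k y)"
      using AEG by eventually_elim (rule suminf_mult[OF summable_norm_cancel])
  qed auto
  finally show "(\<lambda>k. ft (G k) t) sums ft (\<lambda>x. \<Sum>k. G k x) t"
    unfolding ft_def .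
qed

text \<open>
  Each correction solves the problem for the current residual, whose squared norm is
  divided by 4 at every step, so the corrections form a series as in \<open>L2on_series\<close>.
\<close>

lemma approx_solvable_imp_solvable:
  assumes A: "approx_solvable_on p S \<beta>" and \<beta>: "\<beta> > 0" and S: "bounded S" and c: "l2_bound c B"
  shows "\<exists>G. L2on S G \<and> (\<forall>z. ft G (p z) = c z)"
proof -
  \<comment> \<open>A state consists of the current residual and the correction computed for it.\<close>
  define P where "P = (\<lambda>n (x :: (int ^ 'a \<Rightarrow> complex) \<times> (real ^ 'a \<Rightarrow> complex)). 
    (n = 0 \<longrightarrow> fst x = c) \<and> l2_bound (fst x) (B / 4 ^ n) \<and> L2on S (snd x) \<and> sq_norm (snd x) \<le> B / \<beta> / 4 ^ n \<and>
    l2_bound (\<lambda>z. fst x z - ft (snd x) (p z)) (B / 4 ^ Suc n))"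
  define Q where "Q = (\<lambda>(n::nat) (x :: (int ^ 'a \<Rightarrow> complex) \<times> (real ^ 'a \<Rightarrow> complex)) (y :: (int ^ 'a \<Rightarrow> complex) \<times> (real ^ 'a \<Rightarrow> complex)). 
    fst y = (\<lambda>z. fst x z - ft (snd x) (p z)))"
  have step: "\<exists>G. P n (c', G)" if "n = 0 \<longrightarrow> c' = c" "l2_bound c' (B / 4 ^ n)" for n c'
    using approx_solve_step[OF A \<beta> that(2)] that by (auto simp: P_def field_simps)
  have "\<exists>x. \<forall>n. P n (x n) \<and> Q n (x n) (x (Suc n))"
  proof (rule dependent_nat_choice)
    show "\<exists>x. P 0 x" using step[of 0 c] c by auto
    fix x n assume "P n x"
    then have "l2_bound (\<lambda>z. fst x z - ft (snd x) (p z)) (B / 4 ^ Suc n)" by (simp add: P_def)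
    then obtain G where "P (Suc n) (\<lambda>z. fst x z - ft (snd x) (p z), G)" using step[of "Suc n"] by blast
    then show "\<exists>y. P (Suc n) y \<and> Q n x y" unfolding Q_def by (intro exI conjI) auto
  qed
  then obtain x where x: "\<And>n. P n (x n)" "\<And>n. Q n (x n) (x (Suc n))" by auto
  define G where "G = (\<lambda>k. snd (x k))"
  define d where "d = (\<lambda>k. fst (x k))"
  have G: "L2on S (G k)" "sq_norm (G k) \<le> (B / \<beta>) / 4 ^ k" for k using x(1)[of k] by (auto simp: P_def G_def)
  have d: "d 0 = c" "l2_bound (d k) (B / 4 ^ k)" "d (Suc k) z = d k z - ft (G k) (p z)" for k z
    using x(1)[of 0] x(1)[of k] x(2)[of k] by (auto simp: P_def Q_def d_def G_def)
  have eq: "(\<Sum>k<n. ft (G k) (p z)) = c z - d n z" for n z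
    by (induction n) (auto simp: d)
  have lim: "(\<lambda>n. d n z) \<longlonglongrightarrow> 0" for z
  proof -
    have le: "(cmod (d n z))\<^sup>2 \<le> B * (1/4) ^ n" for n
      using l2_boundD[OF d(2), of "{z}" n] by (simp add: power_divide)
    have "(\<lambda>n. B * (1/4 :: real) ^ n) \<longlonglongrightarrow> B * 0"
      by (intro tendsto_mult tendsto_const LIMSEQ_realpow_zero) auto
    then have z: "(\<lambda>n. B * (1/4 :: real) ^ n) \<longlonglongrightarrow> 0" by simp
    have "(\<lambda>n. (cmod (d n z))\<^sup>2) \<longlonglongrightarrow> 0"
      by (rule tendsto_sandwich[OF _ _ tendsto_const z]) (use le in \<open>auto intro!: always_eventually\<close>)
    then have "(\<lambda>n. sqrt ((cmod (d n z))\<^sup>2)) \<longlonglongrightarrow> sqrt 0" by (rule tendsto_real_sqrt)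
    then show ?thesis by (simp add: tendsto_norm_zero_iff)
  qed
  note series = L2on_series[OF G(1) S G(2)]
  have "ft (\<lambda>x. \<Sum>k. G k x) (p z) = c z" for z
  proof (rule sums_unique2[OF series(2)])
    have "(\<lambda>n. c z - d n z) \<longlonglongrightarrow> c z - 0" by (intro tendsto_intros lim)
    then show "(\<lambda>k. ft (G k) (p z)) sums c z" by (simp add: sums_def eq)
  qed
  then show ?thesis using series(1) by blast
qed

section \<open>The limit of the periodic point sets\<close>


lemma ft_LIMSEQ:
  assumes G: "L2on S G" "bounded S" and t: "t \<longlonglongrightarrow> t0"
  shows "(\<lambda>n. ft G (t n)) \<longlonglongrightarrow> ft G t0"
  unfolding ft_def
proof (rule integral_dominated_convergence[where w="\<lambda>y. cmod (G y)"])
  have [measurable]: "G \<in> borel_measurable borel" using L2onD(1)[OF G(1)] .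
  show "(\<lambda>y. E t0 y * G y) \<in> borel_measurable lborel" by measurable
  show "(\<lambda>y. E (t n) y * G y) \<in> borel_measurable lborel" for n by measurable
  show "integrable lborel (\<lambda>y. cmod (G y))" using L2on_integrable[OF G] by simp
  show "AE y in lborel. (\<lambda>n. E (t n) y * G y) \<longlonglongrightarrow> E t0 y * G y"
  proof (intro AE_I2 tendsto_mult tendsto_const)
    fix y
    have "isCont (\<lambda>t. E t y) t0"
      using continuous_on_eq_continuous_at[of UNIV "\<lambda>t. E t y"] by (auto intro!: continuous_intros)
    then show "(\<lambda>n. E (t n) y) \<longlonglongrightarrow> E t0 y" using t by (rule isCont_tendsto_compose)
  qed
  show "AE y in lborel. norm (E (t n) y * G y) \<le> cmod (G y)" for n by (simp add: norm_mult)
qed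

text \<open>
  The indices of the cubes of side \<open>2 ^ (-m)\<close> inside \<open>[-m, m)\<close> in every coordinate; these regions increase
  to the whole space.
\<close>

definition stage_box :: "nat \<Rightarrow> (int ^ 'n) set" where
  "stage_box m = {a. \<forall>i. a $ i \<in> {- int (m * 2 ^ m)..<int (m * 2 ^ m)}}"

lemma finite_stage_box [simp]: "finite (stage_box m)"
  unfolding stage_box_def by (rule card_vec_set) simp

lemma tile_stage_box: "tile (2 ^ m) (stage_box m) = {x. \<forall>i. - real m \<le> x $ i \<and> x $ i < real m}"
proof -
  have "- int (m * 2 ^ m) \<le> \<lfloor>2 ^ m * t\<rfloor> \<longleftrightarrow> - real m \<le> t" for t :: real
    using mult_le_cancel_right_pos[of "2 ^ m" "- real m" t] by (simp add: le_floor_iff mult.commute)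
  moreover have "\<lfloor>2 ^ m * t\<rfloor> < int (m * 2 ^ m) \<longleftrightarrow> t < real m" for t :: real
    using mult_less_cancel_right_pos[of "2 ^ m" t "real m"] by (simp add: floor_less_iff mult.commute)
  ultimately show ?thesis
    unfolding tile_def stage_box_def cell_def by simp
qed

lemma tile_stage_box_mono: "m \<le> m' \<Longrightarrow> tile (2 ^ m) (stage_box m) \<subseteq> tile (2 ^ m') (stage_box m')"
  unfolding tile_stage_box by (auto intro: order_trans[of "- real m'" "- real m"] less_le_trans[of _ "real m" "real m'"])

lemma tile_mono: "A \<subseteq> B \<Longrightarrow> tile N A \<subseteq> tile N B"
  by (auto simp: tile_def)

lemma norm_tile_stage_box: "y \<in> tile (2 ^ m) (stage_box m) \<Longrightarrow> norm (y :: real ^ 'n) \<le> real m * real CARD('n)"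
proof -
  assume "y \<in> tile (2 ^ m) (stage_box m)"
  then have "\<bar>y $ i\<bar> \<le> real m" for i by (auto simp: tile_stage_box abs_le_iff dest: spec[of _ i])
  then have "(\<Sum>i\<in>UNIV. \<bar>y $ i\<bar>) \<le> (\<Sum>i\<in>(UNIV :: 'n set). real m)" by (intro sum_mono)
  then show ?thesis using norm_le_l1_cart[of y] by (simp add: mult.commute)
qed

lemma sum_residues_le:
  fixes f :: "int ^ 'n \<Rightarrow> real"
  assumes N: "N > 0" and F: "finite F" and f: "\<And>z. f z \<ge> 0"
    and C: "\<And>r K. r \<in> res N \<Longrightarrow> finite K \<Longrightarrow> real N ^ CARD('n) * (\<Sum>k\<in>K. f (zshift N r k)) \<le> C"
  shows "(\<Sum>z\<in>F. f z) \<le> C"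
proof -
  let ?P = "res N \<times> zdiv N ` F" and ?g = "\<lambda>(r, k). zshift N r k"
  have inj: "inj_on ?g ?P"
    by (intro inj_onI) (auto, metis zmod_zshift, metis zdiv_zshift)
  have sub: "F \<subseteq> ?g ` ?P"
  proof
    fix z assume "z \<in> F"
    then have "z = ?g (zmod N z, zdiv N z)" "(zmod N z, zdiv N z) \<in> ?P" using N by auto
    then show "z \<in> ?g ` ?P" by (rule image_eqI)
  qed
  have "(\<Sum>z\<in>F. f z) \<le> (\<Sum>z\<in>?g ` ?P. f z)"
    using sub F f by (intro sum_mono2) auto
  also have "\<dots> = (\<Sum>x\<in>?P. f (?g x))" using inj by (subst sum.reindex) auto
  also have "\<dots> = (\<Sum>r\<in>res N. \<Sum>k\<in>zdiv N ` F. f (zshift N r k))"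
    by (simp add: sum.cartesian_product case_prod_unfold)
  also have "\<dots> \<le> (\<Sum>r\<in>(res N :: (int ^ 'n) set). C / real N ^ CARD('n))"
    using C[of _ "zdiv N ` F"] F N by (intro sum_mono) (auto simp: field_simps)
  also have "\<dots> = C" using N by (simp add: card_res)
  finally show ?thesis .
qed

lemma unisolvent_cong:
  assumes "\<And>r. r \<in> R \<Longrightarrow> x r = x' r" shows "unisolvent q R A x = unisolvent q R A x'"
  unfolding unisolvent_def using assms by (simp cong: ball_cong)

text \<open>
  The second component is a constant for which sampling and interpolation hold simultaneously for all
  admissible unions of cubes of the stage. For \<open>m = 0\<close> there is no admissible union, and the points are the
  integer vectors themselves.
\<close>

definition stage :: "nat \<Rightarrow> (int ^ 'n \<Rightarrow> real ^ 'n) \<times> real \<Rightarrow> bool" where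
  "stage m s \<longleftrightarrow> (m = 0 \<longrightarrow> fst s = ivec) \<and> periodic (2 ^ m) (fst s) \<and> snd s > 0 \<and>
     (\<forall>A. A \<subseteq> stage_box m \<longrightarrow> card A = (2 ^ m) ^ CARD('n) \<longrightarrow>
        stable_on (fst s) (tile (2 ^ m) A) (snd s) \<and> solvable_on (fst s) (tile (2 ^ m) A) (snd s))"

text \<open>
  The last condition says that the sampling operators of consecutive stages differ, on the larger box, by at most
  \<open>sqrt \<beta> / 4 * 2 ^ (-m-1)\<close> in operator norm, where \<open>\<beta>\<close> is the constant of the earlier stage.
\<close>

definition refines :: "real \<Rightarrow> nat \<Rightarrow> (int ^ 'n \<Rightarrow> real ^ 'n) \<times> real \<Rightarrow> (int ^ 'n \<Rightarrow> real ^ 'n) \<times> real \<Rightarrow> bool" where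
  "refines \<epsilon> m s s' \<longleftrightarrow> snd s' \<le> snd s \<and> (\<forall>z. norm (fst s' z - fst s z) \<le> \<epsilon> * (1/2) ^ Suc m) \<and>
     (\<forall>G F. L2on (tile (2 ^ Suc m) (stage_box (Suc m))) G \<longrightarrow> finite F \<longrightarrow>
       (\<Sum>z\<in>F. (cmod (ft G (fst s' z) - ft G (fst s z)))\<^sup>2) \<le> snd s * sq_norm G * ((1/4) * (1/2) ^ Suc m)\<^sup>2)"

text \<open>
  A map of period \<open>2 ^ m\<close> also has the period \<open>N = 2 ^ (m+1)\<close>. Its values on the residues modulo \<open>N\<close> are
  moved to generic positions and continued periodically. As the number of residues cancels the factor \<open>N ^ n\<close> of the
  Bessel inequality, the required smallness is a condition on the displacement \<open>\<eta>\<close> alone.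
\<close>

lemma refine_stage:
  fixes s :: "(int ^ 'n \<Rightarrow> real ^ 'n) \<times> real"
  assumes s: "stage m s" and \<epsilon>: "\<epsilon> > 0"
  shows "\<exists>s'. stage (Suc m) s' \<and> refines \<epsilon> m s s'"
proof -
  obtain p \<beta> where sp: "s = (p, \<beta>)" by (cases s)
  have p: "periodic (2 ^ m) p" and \<beta>: "\<beta> > 0" using s by (auto simp: stage_def sp)
  define N :: nat where "N = 2 ^ Suc m"
  have N: "N > 0" by (simp add: N_def)
  have pN: "periodic N p"
    unfolding periodic_def
  proof (intro allI)
    fix z k :: "int ^ 'n"
    have "zshift N z k = zshift (2 ^ m) z (k + k)"
      by (simp add: zshift_def vec_eq_iff N_def algebra_simps)
    moreover have "real (2 ^ m) *\<^sub>R ivec (k + k) = real N *\<^sub>R ivec k" by (simp add: N_def vec_eq_iff)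
    ultimately show "p (zshift N z k) = p z + real N *\<^sub>R ivec k"
      using periodicD[OF p, of z "k + k"] by (simp only:)
  qed
  let ?\<Phi> = "stage_box (Suc m) :: (int ^ 'n) set"
  define R where "R = real (Suc m) * real CARD('n)"
  define D where "D = real (card ?\<Phi>) * (2 * pi * R)\<^sup>2"
  have D: "D \<ge> 0" by (simp add: D_def)
  define tol where "tol = \<beta> * ((1/4) * (1/2) ^ Suc m)\<^sup>2"
  have tol: "tol > 0" using \<beta> by (simp add: tol_def)
  define \<eta> where "\<eta> = min (\<epsilon> * (1/2) ^ Suc m) (sqrt (tol / (D + 1)))"
  have \<eta>: "\<eta> > 0" using \<epsilon> tol D by (simp add: \<eta>_def)
  have \<eta>2: "D * \<eta>\<^sup>2 \<le> tol"
  proof -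
    have "\<eta>\<^sup>2 \<le> (sqrt (tol / (D + 1)))\<^sup>2" using \<eta> by (intro power_mono) (auto simp: \<eta>_def)
    also have "\<dots> = tol / (D + 1)" using tol D by simp
    finally have "D * \<eta>\<^sup>2 \<le> D * (tol / (D + 1))" using D by (intro mult_left_mono)
    also have "\<dots> \<le> tol" using tol D by (simp add: field_simps)
    finally show ?thesis .
  qed
  obtain x where x: "\<And>r. r \<in> res N \<Longrightarrow> dist (x r) (p r) < \<eta>"
    "\<And>A. A \<subseteq> ?\<Phi> \<Longrightarrow> card A = card (res N :: (int ^ 'n) set) \<Longrightarrow> unisolvent (corner N) (res N) A x"
    using generic_points[OF finite_stage_box inj_on_subset[OF corner_inj[OF N]] finite_res \<eta>, of "Suc m" N p] by auto
  define p' where "p' = (\<lambda>z. x (zmod N z) + real N *\<^sub>R ivec (zdiv N z))"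
  have p'r: "p' (zshift N r k) = x r + real N *\<^sub>R ivec k" if "r \<in> res N" for r k
    using that by (simp add: p'_def)
  have zero: "zshift N r 0 = r" for r by (simp add: zshift_def)
  have p'0: "p' r = x r" if "r \<in> res N" for r
    using p'r[OF that, of 0] by (simp add: zero)
  have p': "periodic N p'"
    unfolding periodic_def
  proof (intro allI)
    fix z k :: "int ^ 'n"
    have "zmod N (zshift N z k) = zmod N z" "zdiv N (zshift N z k) = zdiv N z + k"
      using N by (simp_all add: zmod_def zdiv_def zshift_def vec_eq_iff)
    then show "p' (zshift N z k) = p' z + real N *\<^sub>R ivec k" by (simp add: p'_def scaleR_add_right)
  qed
  have pr: "p (zshift N r k) = p r + real N *\<^sub>R ivec k" for r k by (rule periodicD[OF pN])
  have near: "norm (p' z - p z) < \<eta>" for z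
  proof -
    have "p' z - p z = x (zmod N z) - p (zmod N z)"
      using pr[of "zmod N z" "zdiv N z"] by (simp add: p'_def)
    then show ?thesis using x(1)[OF zmod_res[OF N], of z] by (simp add: dist_norm)
  qed
  have U: "unisolvent (corner N) (res N) A p'" if "A \<subseteq> ?\<Phi>" "card A = N ^ CARD('n)" for A
  proof -
    have "unisolvent (corner N) (res N) A x" using x(2)[OF that(1)] that(2) by (simp add: card_res)
    then show ?thesis using unisolvent_cong[of "res N" p' x "corner N" A, OF p'0] by simp
  qed
  obtain \<beta>1 where \<beta>1: "\<beta>1 > 0" "\<And>A. A \<subseteq> ?\<Phi> \<Longrightarrow> card A = N ^ CARD('n) \<Longrightarrow> stable_on p' (tile N A) \<beta>1 \<and> solvable_on p' (tile N A) \<beta>1"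
    using stage_constant[OF N finite_stage_box p' U] by blast
  let ?s' = "(p', min \<beta> \<beta>1)"
  have "stage (Suc m) ?s'"
    unfolding stage_def using p' \<beta> \<beta>1 stable_on_mono[of p' _ \<beta>1 "min \<beta> \<beta>1"] solvable_on_mono[of p' _ \<beta>1 "min \<beta> \<beta>1"]
    by (auto simp: N_def[symmetric] simp del: power_Suc)
  moreover have "refines \<epsilon> m s ?s'"
    unfolding refines_def sp fst_conv snd_conv
  proof (intro conjI allI impI)
    show "norm (p' z - p z) \<le> \<epsilon> * (1/2) ^ Suc m" for z using near[of z] by (simp add: \<eta>_def)
    fix G and F :: "(int ^ 'n) set" assume G: "L2on (tile (2 ^ Suc m) ?\<Phi>) G" and F: "finite F"
    have GN: "L2on (tile N ?\<Phi>) G" using G unfolding N_def .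
    have "(\<Sum>z\<in>F. (cmod (ft G (p' z) - ft G (p z)))\<^sup>2) \<le> D * \<eta>\<^sup>2 * sq_norm G"
    proof (rule sum_residues_le[OF N F])
      fix r :: "int ^ 'n" and K :: "(int ^ 'n) set" assume r: "r \<in> res N" and K: "finite K"
      have "real N ^ CARD('n) * (\<Sum>k\<in>K. (cmod (ft G (x r + real N *\<^sub>R ivec k) - ft G (p r + real N *\<^sub>R ivec k)))\<^sup>2)
         \<le> card ?\<Phi> * (2 * pi * norm (x r - p r) * R)\<^sup>2 * sq_norm G"
        by (rule perturbed_tile[OF N finite_stage_box GN K]) 
          (use norm_tile_stage_box[of _ "Suc m"] in \<open>simp_all add: N_def R_def del: power_Suc of_nat_Suc\<close>)
      also have "\<dots> \<le> card ?\<Phi> * (2 * pi * \<eta> * R)\<^sup>2 * sq_norm G"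
        using x(1)[OF r] by (intro mult_right_mono mult_left_mono power_mono mult_nonneg_nonneg) (auto simp: dist_norm R_def)
      also have "\<dots> = D * \<eta>\<^sup>2 * sq_norm G" by (simp add: D_def power_mult_distrib)
      finally show "real N ^ CARD('n) * (\<Sum>k\<in>K. (cmod (ft G (p' (zshift N r k)) - ft G (p (zshift N r k))))\<^sup>2) \<le> D * \<eta>\<^sup>2 * sq_norm G"
        unfolding p'r[OF r] pr .
    qed auto
    also have "\<dots> \<le> tol * sq_norm G" using \<eta>2 by (intro mult_right_mono) auto
    finally show "(\<Sum>z\<in>F. (cmod (ft G (p' z) - ft G (p z)))\<^sup>2) \<le> \<beta> * sq_norm G * ((1/4) * (1/2) ^ Suc m)\<^sup>2"
      by (simp add: tol_def mult_ac)
  qed auto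
  ultimately show ?thesis by blast
qed

text \<open>
  The constants \<open>b m\<close> decrease, so the sampling operators of all later stages differ from that of stage \<open>m\<close> by
  at most \<open>sqrt (b m) / 4\<close> on the box of stage \<open>m\<close>, and this passes to the limit for each finite set of points.
  A perturbation of this size is absorbed by the lower bound at stage \<open>m\<close>.
\<close>

theorem universal_points:
  fixes \<epsilon> :: real
  assumes \<epsilon>: "\<epsilon> > 0"
  shows "\<exists>p :: int ^ 'n \<Rightarrow> real ^ 'n. (\<forall>z. norm (p z - ivec z) \<le> \<epsilon>) \<and>
    (\<forall>m A. A \<subseteq> stage_box m \<longrightarrow> card A = (2 ^ m) ^ CARD('n) \<longrightarrow> 
      (\<exists>\<beta>>0. stable_on p (tile (2 ^ m) A) \<beta> \<and> approx_solvable_on p (tile (2 ^ m) A) \<beta>))"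
proof -
  have "\<exists>s :: nat \<Rightarrow> (int ^ 'n \<Rightarrow> real ^ 'n) \<times> real. \<forall>m. stage m (s m) \<and> refines \<epsilon> m (s m) (s (Suc m))"
  proof (rule dependent_nat_choice)
    have "stage_box 0 = ({} :: (int ^ 'n) set)" by (auto simp: stage_box_def)
    then have "stage 0 (ivec :: int ^ 'n \<Rightarrow> real ^ 'n, 1)"
      by (auto simp: stage_def periodic_def ivec_zshift)
    then show "\<exists>s :: (int ^ 'n \<Rightarrow> real ^ 'n) \<times> real. stage 0 s" by blast
  qed (rule refine_stage[OF _ \<epsilon>])
  then obtain s :: "nat \<Rightarrow> (int ^ 'n \<Rightarrow> real ^ 'n) \<times> real" 
    where s: "\<And>m. stage m (s m)" "\<And>m. refines \<epsilon> m (s m) (s (Suc m))" by blast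
  define P where "P = (\<lambda>m. fst (s m))"
  define b where "b = (\<lambda>m. snd (s m))"
  have P0: "P 0 = ivec" using s(1)[of 0] by (simp add: stage_def P_def)
  have b: "b m > 0" for m using s(1)[of m] by (simp add: stage_def b_def)
  have bdec: "b (m + j) \<le> b m" for m j
  proof (induction j)
    case (Suc j)
    have "b (Suc (m + j)) \<le> b (m + j)" using s(2)[of "m + j"] by (simp add: refines_def b_def)
    then show ?case using Suc by simp
  qed simp
  have step: "norm (P (Suc m) z - P m z) \<le> \<epsilon> * (1/2) ^ Suc m" for m z
    using s(2)[of m] by (simp add: refines_def P_def)
  have sums: "(\<lambda>m. \<epsilon> * (1/2) ^ Suc m) sums \<epsilon>"
    using sums_mult[OF power_half_series, of \<epsilon>] by simp
  have summ: "summable (\<lambda>m. norm (P (Suc m) z - P m z))" for z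
    by (rule summable_comparison_test'[OF sums_summable[OF sums], of 0]) (use step in auto)
  define p where "p = (\<lambda>z. ivec z + (\<Sum>m. P (Suc m) z - P m z))"
  have lim: "(\<lambda>m. P m z) \<longlonglongrightarrow> p z" for z
  proof -
    have "(\<lambda>n. ivec z + (\<Sum>m<n. P (Suc m) z - P m z)) \<longlonglongrightarrow> p z"
      unfolding p_def by (intro tendsto_intros summable_LIMSEQ summable_norm_cancel[OF summ])
    moreover have "ivec z + (\<Sum>m<n. P (Suc m) z - P m z) = P n z" for n
      by (simp add: sum_lessThan_telescope[of "\<lambda>m. P m z"] P0)
    ultimately show ?thesis by simp
  qed
  have near: "norm (p z - ivec z) \<le> \<epsilon>" for z
  proof -
    have "norm (p z - ivec z) \<le> (\<Sum>m. norm (P (Suc m) z - P m z))"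
      unfolding p_def using summable_norm[OF summ] by simp
    also have "\<dots> \<le> (\<Sum>m. \<epsilon> * (1/2) ^ Suc m)"
      by (rule suminf_le[OF step summ sums_summable[OF sums]])
    also have "\<dots> = \<epsilon>" using sums by (rule sums_unique[symmetric])
    finally show ?thesis .
  qed
  have diff: "(\<Sum>z\<in>F. (cmod (ft G (p z) - ft G (P m z)))\<^sup>2) \<le> b m * sq_norm G / 16"
    if G: "L2on (tile (2 ^ m) (stage_box m)) G" and F: "finite F" for G m and F :: "(int ^ 'n) set"
  proof -
    define S where "S = sqrt (b m * sq_norm G)"
    have S: "S \<ge> 0" "S\<^sup>2 = b m * sq_norm G" using b[of m] by (simp_all add: S_def less_imp_le)
    have one: "L2_set (\<lambda>z. cmod (ft G (P (Suc (m + j)) z) - ft G (P (m + j) z))) F \<le> S * ((1/4) * (1/2) ^ Suc j)" for j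
    proof -
      have "L2on (tile (2 ^ Suc (m + j)) (stage_box (Suc (m + j)))) G"
        by (rule L2on_mono[OF G tile_stage_box_mono]) simp
      then have "(\<Sum>z\<in>F. (cmod (ft G (P (Suc (m + j)) z) - ft G (P (m + j) z)))\<^sup>2) 
          \<le> b (m + j) * sq_norm G * ((1/4) * (1/2) ^ Suc (m + j))\<^sup>2"
        using s(2)[of "m + j"] F unfolding refines_def P_def b_def by blast
      also have "\<dots> \<le> b m * sq_norm G * ((1/4) * (1/2) ^ Suc j)\<^sup>2"
        using b[of "m + j"] bdec[of m j] 
        by (intro mult_mono power_mono mult_left_mono power_decreasing mult_nonneg_nonneg) (auto simp: less_imp_le)
      also have "\<dots> = (S * ((1/4) * (1/2) ^ Suc j))\<^sup>2" unfolding S(2)[symmetric] by (simp only: power_mult_distrib)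
      finally have "L2_set (\<lambda>z. cmod (ft G (P (Suc (m + j)) z) - ft G (P (m + j) z))) F \<le> sqrt ((S * ((1/4) * (1/2) ^ Suc j))\<^sup>2)"
        unfolding L2_set_def by (rule real_sqrt_le_mono)
      then show ?thesis using S(1) by simp
    qed
    have fin: "L2_set (\<lambda>z. cmod (ft G (P (m + j) z) - ft G (P m z))) F \<le> S / 4 * (1 - (1/2) ^ j)" for j
    proof (induction j)
      case 0
      then show ?case by (simp add: L2_set_def)
    next
      case (Suc j)
      have "L2_set (\<lambda>z. cmod (ft G (P (m + Suc j) z) - ft G (P m z))) F 
          \<le> L2_set (\<lambda>z. cmod (ft G (P (Suc (m + j)) z) - ft G (P (m + j) z)) + cmod (ft G (P (m + j) z) - ft G (P m z))) F"
      proof (rule L2_set_mono)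
        fix z
        show "cmod (ft G (P (m + Suc j) z) - ft G (P m z)) 
          \<le> cmod (ft G (P (Suc (m + j)) z) - ft G (P (m + j) z)) + cmod (ft G (P (m + j) z) - ft G (P m z))"
          using norm_triangle_ineq[of "ft G (P (Suc (m + j)) z) - ft G (P (m + j) z)" "ft G (P (m + j) z) - ft G (P m z)"] by simp
      qed simp
      also have "\<dots> \<le> S * ((1/4) * (1/2) ^ Suc j) + S / 4 * (1 - (1/2) ^ j)"
        by (rule order_trans[OF L2_set_triangle_ineq add_mono[OF one Suc]])
      also have "\<dots> = S / 4 * (1 - (1/2) ^ Suc j)" by (simp add: algebra_simps)
      finally show ?case .
    qed
    have "(\<Sum>z\<in>F. (cmod (ft G (P (m + j) z) - ft G (P m z)))\<^sup>2) \<le> b m * sq_norm G / 16" for j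
    proof -
      have "L2_set (\<lambda>z. cmod (ft G (P (m + j) z) - ft G (P m z))) F \<le> S / 4"
        using order_trans[OF fin mult_left_le[of "1 - (1/2) ^ j" "S/4"]] S(1) by simp
      then have "(L2_set (\<lambda>z. cmod (ft G (P (m + j) z) - ft G (P m z))) F)\<^sup>2 \<le> (S / 4)\<^sup>2"
        by (intro power_mono) auto
      then show ?thesis by (simp add: L2_set_def sum_nonneg power_divide S(2))
    qed
    moreover have "(\<lambda>j. \<Sum>z\<in>F. (cmod (ft G (P (m + j) z) - ft G (P m z)))\<^sup>2) \<longlonglongrightarrow> (\<Sum>z\<in>F. (cmod (ft G (p z) - ft G (P m z)))\<^sup>2)"
    proof (intro tendsto_intros ft_LIMSEQ[OF G])
      show "bounded (tile (2 ^ m) (stage_box m :: (int ^ 'n) set))" by simp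
      show "(\<lambda>j. P (m + j) z) \<longlonglongrightarrow> p z" for z
        using LIMSEQ_ignore_initial_segment[OF lim[of z], of m] by (simp add: add.commute)
    qed
    ultimately show ?thesis by (intro LIMSEQ_le_const2) auto
  qed
  have main: "stable_on p (tile (2 ^ m) A) (b m / 4) \<and> approx_solvable_on p (tile (2 ^ m) A) (b m / 4)"
    if A: "A \<subseteq> stage_box m" "card A = (2 ^ m) ^ CARD('n)" for m and A :: "(int ^ 'n) set"
  proof
    have st: "stable_on (P m) (tile (2 ^ m) A) (b m)" and so: "solvable_on (P m) (tile (2 ^ m) A) (b m)"
      using s(1)[of m] A unfolding stage_def P_def b_def by auto
    have LG: "L2on (tile (2 ^ m) (stage_box m)) G" if "L2on (tile (2 ^ m) A) G" for G
      by (rule L2on_mono[OF that tile_mono[OF A(1)]])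
    show "stable_on p (tile (2 ^ m) A) (b m / 4)"
      unfolding stable_on_def
    proof (intro allI impI)
      fix G K assume G: "L2on (tile (2 ^ m) A) G" and K: "\<forall>F. finite F \<longrightarrow> (\<Sum>z\<in>F. (cmod (ft G (p z)))\<^sup>2) \<le> K"
      have "(\<Sum>z\<in>F. (cmod (ft G (P m z)))\<^sup>2) \<le> 2 * K + b m * sq_norm G / 8" if F: "finite F" for F
      proof -
        have "(\<Sum>z\<in>F. (cmod (ft G (P m z)))\<^sup>2) \<le> (\<Sum>z\<in>F. 2 * (cmod (ft G (p z)))\<^sup>2 + 2 * (cmod (ft G (p z) - ft G (P m z)))\<^sup>2)"
        proof (rule sum_mono)
          fix z
          show "(cmod (ft G (P m z)))\<^sup>2 \<le> 2 * (cmod (ft G (p z)))\<^sup>2 + 2 * (cmod (ft G (p z) - ft G (P m z)))\<^sup>2"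
            using sum_sq_le[of "ft G (p z)" "ft G (P m z) - ft G (p z)"] by (simp add: norm_minus_commute)
        qed
        also have "\<dots> = 2 * (\<Sum>z\<in>F. (cmod (ft G (p z)))\<^sup>2) + 2 * (\<Sum>z\<in>F. (cmod (ft G (p z) - ft G (P m z)))\<^sup>2)"
          by (simp add: sum.distrib sum_distrib_left)
        also have "\<dots> \<le> 2 * K + 2 * (b m * sq_norm G / 16)"
          using K F diff[OF LG[OF G] F] by (intro add_mono mult_left_mono) auto
        finally show ?thesis by (simp add: mult.commute)
      qed
      then have "b m * sq_norm G \<le> 2 * K + b m * sq_norm G / 8" using st G unfolding stable_on_def by blast
      moreover have "b m * sq_norm G \<ge> 0" using b[of m] by simp
      moreover have "b m / 4 * sq_norm G = b m * sq_norm G / 4" by simp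
      ultimately show "b m / 4 * sq_norm G \<le> K" by linarith
    qed
    show "approx_solvable_on p (tile (2 ^ m) A) (b m / 4)"
      unfolding approx_solvable_on_def
    proof (intro allI impI)
      fix c :: "int ^ 'n \<Rightarrow> complex" assume "finite {z. c z \<noteq> 0}"
      then obtain G where G: "L2on (tile (2 ^ m) A) G" "\<And>z. ft G (P m z) = c z" "b m * sq_norm G \<le> (\<Sum>z | c z \<noteq> 0. (cmod (c z))\<^sup>2)"
        using so unfolding solvable_on_def by blast
      have "b m * sq_norm G \<ge> 0" using b[of m] by simp
      moreover have "b m / 4 * sq_norm G = b m * sq_norm G / 4" by simp
      ultimately have "b m / 4 * sq_norm G \<le> (\<Sum>z | c z \<noteq> 0. (cmod (c z))\<^sup>2)" using G(3) by linarith
      moreover have "(\<Sum>z\<in>F. (cmod (c z - ft G (p z)))\<^sup>2) \<le> (\<Sum>z | c z \<noteq> 0. (cmod (c z))\<^sup>2) / 16" if "finite F" for F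
        using diff[OF LG[OF G(1)] that] G(2,3) by (simp add: norm_minus_commute)
      ultimately show "\<exists>G. L2on (tile (2 ^ m) A) G \<and> b m / 4 * sq_norm G \<le> (\<Sum>z | c z \<noteq> 0. (cmod (c z))\<^sup>2) \<and>
          (\<forall>F. finite F \<longrightarrow> (\<Sum>z\<in>F. (cmod (c z - ft G (p z)))\<^sup>2) \<le> (\<Sum>z | c z \<noteq> 0. (cmod (c z))\<^sup>2) / 16)"
        using G(1) by blast
    qed
  qed
  show ?thesis
  proof (intro exI[of _ p] conjI allI impI near)
    fix m and A :: "(int ^ 'n) set" assume "A \<subseteq> stage_box m" "card A = (2 ^ m) ^ CARD('n)"
    from main[OF this] b[of m] show "\<exists>\<beta>>0. stable_on p (tile (2 ^ m) A) \<beta> \<and> approx_solvable_on p (tile (2 ^ m) A) \<beta>"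
      by (intro exI[of _ "b m / 4"]) auto
  qed
qed

section \<open>Unions of grid cubes and Lebesgue measure\<close>


lemma measure_tile:
  fixes A :: "(int ^ 'n) set"
  assumes N: "N > 0" and A: "finite A"
  shows "measure lebesgue (tile N A) = card A / real N ^ CARD('n)"
proof -
  have T[measurable]: "tile N A \<in> sets borel" by (rule tile_borel[OF N A])
  have int: "integrable lborel (\<lambda>x. of_real (indicator (tile N A) x) :: complex)"
    using finite_indicator_bounded[OF T bounded_tile[OF N A]] by simp
  have pt: "indicator (cube N) u *\<^sub>R complex_of_real (indicator (tile N A) (u + corner N a)) = indicator (cube N) u *\<^sub>R fexp N (0 :: int ^ 'n) u"
    if "a \<in> A" for a u
    using that cell_shift[OF N, of u a] by (cases "u \<in> cube N") (simp_all add: tile_def)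
  have "complex_of_real (measure lborel (tile N A)) = (LINT x|lborel. of_real (indicator (tile N A) x))"
    by simp
  also have "\<dots> = (\<Sum>a\<in>A. LINT u|lborel. indicator (cube N) u *\<^sub>R complex_of_real (indicator (tile N A) (u + corner N a)))"
    by (rule integral_tile(1)[OF N A int]) auto
  also have "\<dots> = (\<Sum>a\<in>A. LINT u|lborel. indicator (cube N) u *\<^sub>R fexp N (0 :: int ^ 'n) u)"
    by (intro sum.cong refl Bochner_Integration.integral_cong) (rule pt)
  also have "\<dots> = of_real (card A / real N ^ CARD('n))"
    unfolding orthogonality[OF N] by (simp add: power_one_over)
  finally have "measure lborel (tile N A) = card A / real N ^ CARD('n)" unfolding of_real_eq_iff .
  then show ?thesis by (simp add: measure_completion)
qed

lemma cell_eq_dist: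
  assumes N: "N > 0" and "cell N x = cell N y"
  shows "dist x (y :: real ^ 'n) \<le> CARD('n) / real N"
proof -
  have "\<bar>x $ i - y $ i\<bar> \<le> 1 / real N" for i
  proof -
    have "x - corner N (cell N x) \<in> cube N" "y - corner N (cell N x) \<in> cube N"
      using minus_corner_cell[OF N, of x] minus_corner_cell[OF N, of y] assms(2) by auto
    then have "0 \<le> x $ i - corner N (cell N x) $ i" "x $ i - corner N (cell N x) $ i < 1 / real N"
      "0 \<le> y $ i - corner N (cell N x) $ i" "y $ i - corner N (cell N x) $ i < 1 / real N"
      unfolding cube_def by (simp_all only: mem_Collect_eq vector_minus_component)
    then show ?thesis by linarith
  qed
  then have "(\<Sum>i\<in>UNIV. \<bar>(x - y) $ i\<bar>) \<le> (\<Sum>i\<in>(UNIV :: 'n set). 1 / real N)"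
    by (intro sum_mono) simp
  then show ?thesis using norm_le_l1_cart[of "x - y"] by (simp add: dist_norm)
qed

text \<open>
  For a fine grid, the cubes that meet \<open>K\<close> stay within the distance between \<open>K\<close> and the complement of \<open>V\<close>.
\<close>

lemma fine_tiling:
  fixes K :: "(real ^ 'n) set"
  assumes K: "compact K" and V: "open V" "K \<subseteq> V"
  shows "\<exists>m A. m \<ge> 1 \<and> A \<subseteq> stage_box m \<and> K \<subseteq> tile (2 ^ m) A \<and> tile (2 ^ m) A \<subseteq> V"
proof -
  obtain e where e0: "e > 0" "(\<Union>x\<in>K. ball x e) \<subseteq> V"
    using compact_subset_open_imp_ball_epsilon_subset[OF K V] by blast
  then have e: "e > 0" "\<And>x y. x \<in> K \<Longrightarrow> dist x y < e \<Longrightarrow> y \<in> V"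
    using subsetD[OF e0(2) UN_I] by auto
  obtain b where b: "\<And>x. x \<in> K \<Longrightarrow> norm x \<le> b"
    using compact_imp_bounded[OF K] by (auto simp: bounded_iff)
  obtain m1 :: nat where m1: "b < real m1" using reals_Archimedean2 by blast
  obtain m2 :: nat where m2: "CARD('n) / e < real m2" using reals_Archimedean2 by blast
  define m where "m = max 1 (max m1 m2)"
  have m: "m \<ge> 1" "b < real m" "CARD('n) / e < real m" using m1 m2 by (auto simp: m_def)
  have "real m < 2 ^ m" using of_nat_less_two_power by blast
  then have "CARD('n) / e < 2 ^ m" using m by linarith
  then have small: "CARD('n) / real (2 ^ m) < e" using e(1) by (simp add: field_simps)
  let ?A = "cell (2 ^ m) ` K"
  have "K \<subseteq> tile (2 ^ m) ?A" by (auto simp: tile_def)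
  moreover have "tile (2 ^ m) ?A \<subseteq> V"
  proof
    fix x assume "x \<in> tile (2 ^ m) ?A"
    then obtain y where y: "y \<in> K" "cell (2 ^ m) y = cell (2 ^ m) x" by (auto simp: tile_def)
    then show "x \<in> V" using cell_eq_dist[of "2 ^ m" y x] small by (intro e(2)[OF y(1)]) simp
  qed
  moreover have "?A \<subseteq> stage_box m"
  proof -
    have "x \<in> tile (2 ^ m) (stage_box m)" if "x \<in> K" for x
    proof -
      have "\<bar>x $ i\<bar> < real m" for i using b[OF that] m(2) component_le_norm_cart[of x i] by linarith
      then have "- real m < x $ i \<and> x $ i < real m" for i by (simp add: abs_less_iff minus_less_iff)
      then have "- real m \<le> x $ i \<and> x $ i < real m" for i using less_imp_le by blast
      then show ?thesis unfolding tile_stage_box by blast 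
    qed
    then show ?thesis by (auto simp: tile_def)
  qed
  ultimately show ?thesis using m(1) by blast
qed

lemma card_stage_box: "m \<ge> 1 \<Longrightarrow> (2 ^ m) ^ CARD('n) \<le> card (stage_box m :: (int ^ 'n) set)"
proof -
  assume m: "m \<ge> 1"
  have "2 ^ m \<le> m * 2 ^ m" using m by simp
  then have "2 ^ m \<le> card {- int (m * 2 ^ m)..<int (m * 2 ^ m)}" by simp
  then show ?thesis unfolding stage_box_def by (subst card_vec_set) (auto intro: power_mono)
qed

text \<open>
  The cubes meeting \<open>K\<close> lie in an open set of measure less than 1, so there are at most \<open>2 ^ (m n)\<close> of them; further
  cubes of the box fill up the number.
\<close>

lemma compact_in_tiles:
  fixes K :: "(real ^ 'n) set"
  assumes K: "compact K" and lt: "measure lebesgue K < 1"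
  shows "\<exists>m A. A \<subseteq> stage_box m \<and> card A = (2 ^ m) ^ CARD('n) \<and> K \<subseteq> tile (2 ^ m) A"
proof -
  have KL: "K \<in> lmeasurable" using K by (rule lmeasurable_compact)
  obtain V where V: "open V" "K \<subseteq> V" "V - K \<in> lmeasurable" "emeasure lebesgue (V - K) < ennreal (1 - measure lebesgue K)"
    using sets_lebesgue_outer_open[of K "1 - measure lebesgue K"] KL lt by (auto simp: fmeasurableD)
  have VL: "V \<in> lmeasurable"
    using fmeasurable.Un[OF KL V(3)] V(2) by (simp add: Un_absorb1)
  have "measure lebesgue V = measure lebesgue K + measure lebesgue (V - K)"
    using measure_Un2[OF KL VL] V(2) KL by (simp add: Un_absorb1)
  moreover have "measure lebesgue (V - K) < 1 - measure lebesgue K"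
    using V(4) lt emeasure_eq_measure2[OF V(3)] by (simp add: ennreal_less_iff)
  ultimately have V1: "measure lebesgue V < 1" by simp
  obtain m A where A: "m \<ge> 1" "A \<subseteq> stage_box m" "K \<subseteq> tile (2 ^ m) A" "tile (2 ^ m) A \<subseteq> V"
    using fine_tiling[OF K V(1,2)] by blast
  have fin: "finite A" using A(2) finite_subset finite_stage_box by blast
  have "card A / real (2 ^ m) ^ CARD('n) \<le> measure lebesgue V"
    using measure_tile[of "2 ^ m", OF _ fin] measure_mono_fmeasurable[OF A(4) _ VL] tile_borel[of "2 ^ m", OF _ fin] by simp
  then have "card A / real (2 ^ m) ^ CARD('n) < 1" using V1 by linarith
  then have "real (card A) < real ((2 ^ m) ^ CARD('n))" by (simp add: field_simps)
  then have "card A \<le> (2 ^ m) ^ CARD('n)" by linarith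
  then obtain A' where "A \<subseteq> A'" "A' \<subseteq> stage_box m" "card A' = (2 ^ m) ^ CARD('n)"
    using exists_subset_between[OF _ card_stage_box[OF A(1)] A(2) finite_stage_box] by blast
  then show ?thesis using A(3) tile_mono by blast
qed

text \<open>
  A compact subset of measure greater than 1 is met by at least \<open>2 ^ (m n)\<close> cubes, all of them inside \<open>U\<close>.
\<close>

lemma open_contains_tiles:
  fixes U :: "(real ^ 'n) set"
  assumes U: "open U" "bounded U" and gt: "measure lebesgue U > 1"
  shows "\<exists>m A. A \<subseteq> stage_box m \<and> card A = (2 ^ m) ^ CARD('n) \<and> tile (2 ^ m) A \<subseteq> U"
proof -
  have UL: "U \<in> lmeasurable" using U by (intro lmeasurable_open)
  obtain K where K: "closed K" "K \<subseteq> U" "U - K \<in> lmeasurable" "emeasure lebesgue (U - K) < ennreal (measure lebesgue U - 1)"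
    using sets_lebesgue_inner_closed[of U "measure lebesgue U - 1"] UL gt by (auto simp: fmeasurableD)
  have Kc: "compact K" using K(1,2) U(2) bounded_subset compact_eq_bounded_closed by blast
  have KL: "K \<in> lmeasurable" using Kc by (rule lmeasurable_compact)
  have "measure lebesgue U = measure lebesgue K + measure lebesgue (U - K)"
    using measure_Un2[OF KL UL] K(2) KL by (simp add: Un_absorb1)
  moreover have "measure lebesgue (U - K) < measure lebesgue U - 1"
    using K(4) gt emeasure_eq_measure2[OF K(3)] by (simp add: ennreal_less_iff)
  ultimately have K1: "measure lebesgue K > 1" by simp
  obtain m A where A: "m \<ge> 1" "A \<subseteq> stage_box m" "K \<subseteq> tile (2 ^ m) A" "tile (2 ^ m) A \<subseteq> U"
    using fine_tiling[OF Kc U(1) K(2)] by blast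
  have fin: "finite A" using A(2) finite_subset finite_stage_box by blast
  have TL: "tile (2 ^ m) A \<in> lmeasurable"
    using bounded_tile[of "2 ^ m", OF _ fin] tile_borel[of "2 ^ m", OF _ fin] by (intro bounded_set_imp_lmeasurable) auto
  have "measure lebesgue K \<le> card A / real (2 ^ m) ^ CARD('n)"
    using measure_tile[of "2 ^ m", OF _ fin] measure_mono_fmeasurable[OF A(3) _ TL] KL by (simp add: fmeasurableD)
  then have "card A / real (2 ^ m) ^ CARD('n) > 1" using K1 by linarith
  then have "real (card A) > real ((2 ^ m) ^ CARD('n))" by (simp add: field_simps)
  then have "(2 ^ m) ^ CARD('n) \<le> card A" by linarith
  then obtain A' where "A' \<subseteq> A" "card A' = (2 ^ m) ^ CARD('n)"
    using obtain_subset_with_card_n by metis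
  then show ?thesis using A(2,4) tile_mono[of A' A] by blast
qed

section \<open>Linear maps and Lebesgue measure\<close>

text \<open>
  The factor \<open>c\<close> is the absolute value of the determinant of \<open>f\<close>, characterized by its effect on volumes.
\<close>

definition scales :: "(real ^ 'n \<Rightarrow> real ^ 'n) \<Rightarrow> real \<Rightarrow> bool" where
  "scales f c \<longleftrightarrow> (\<forall>S\<in>lmeasurable. f ` S \<in> lmeasurable \<and> measure lebesgue (f ` S) = c * measure lebesgue S)"

lemma scales_compose: "scales f c \<Longrightarrow> scales g d \<Longrightarrow> scales (f \<circ> g) (c * d)"
  unfolding scales_def image_comp[symmetric] by simp

lemma scales_boxes:
  assumes "linear f" "\<And>a b. measure lebesgue (f ` cbox a b) = c * measure lebesgue (cbox a b)"
  shows "scales f c"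
  unfolding scales_def
proof (intro ballI)
  fix S :: "(real ^ 'a) set" assume "S \<in> lmeasurable"
  from measure_linear_sufficient[OF assms(1) this assms(2)]
  show "f ` S \<in> lmeasurable \<and> measure lebesgue (f ` S) = c * measure lebesgue S" by simp
qed

lemma scales_singular: "linear f \<Longrightarrow> \<not> inj f \<Longrightarrow> scales f 0"
  unfolding scales_def
proof (intro ballI)
  fix S :: "(real ^ 'a) set" assume "linear f" "\<not> inj f"
  from negligible_linear_singular_image[OF this, of S]
  show "f ` S \<in> lmeasurable \<and> measure lebesgue (f ` S) = 0 * measure lebesgue S"
    unfolding negligible_iff_measure by simp
qed

lemma scales_stretch: "scales (\<lambda>x. \<chi> i. m i * x $ i) \<bar>prod m UNIV\<bar>"
  unfolding scales_def by (simp add: measurable_stretch measure_stretch)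

lemma scales_swap: "scales (\<lambda>x :: real ^ 'n. \<chi> i. x $ Transposition.transpose m n i) 1"
proof (rule scales_boxes)
  let ?h = "\<lambda>x :: real ^ 'n. \<chi> i. x $ Transposition.transpose m n i"
  show "linear ?h" by (rule linearI) (simp_all add: vec_eq_iff)
  fix a b :: "real ^ 'n"
  have hh: "?h (?h x) = x" for x by (simp add: vec_eq_iff)
  have mem: "?h x \<in> cbox (?h u) (?h v) \<longleftrightarrow> x \<in> cbox u v" for x u v
    unfolding mem_box_cart by (auto, (metis transpose_involutory)+)
  have "?h ` cbox a b = cbox (?h a) (?h b)"
  proof (intro equalityI subsetI)
    fix y assume "y \<in> cbox (?h a) (?h b)"
    then have "?h y \<in> cbox a b" using mem[of "?h y" a b] hh by simp
    then show "y \<in> ?h ` cbox a b" using hh[of y] by (metis image_eqI)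
  qed (use mem in auto)
  moreover have "measure lborel (cbox (?h a) (?h b)) = measure lborel (cbox a b)"
  proof (cases "cbox a b = {}")
    case True
    then show ?thesis using \<open>?h ` cbox a b = cbox (?h a) (?h b)\<close> by simp
  next
    case False
    then have "cbox (?h a) (?h b) \<noteq> {}" using \<open>?h ` cbox a b = cbox (?h a) (?h b)\<close> by blast
    then show ?thesis using False prod.permute[OF permutes_swap_id, of m UNIV n "\<lambda>i. b $ i - a $ i"]
      by (simp add: content_cbox_cart o_def)
  qed
  ultimately show "measure lebesgue (?h ` cbox a b) = 1 * measure lebesgue (cbox a b)"
    by simp
qed

text \<open>
  A translation moves a box to one with lower corner 0, to which the volume formula for shears applies.
\<close>

lemma scales_shear:
  fixes m n :: "'n :: finite"
  assumes "m \<noteq> n" shows "scales (\<lambda>x :: real ^ 'n. \<chi> i. if i = m then x $ m + x $ n else x $ i) 1"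
proof (rule scales_boxes)
  let ?h = "\<lambda>x :: real ^ 'n. \<chi> i. if i = m then x $ m + x $ n else x $ i"
  show lin: "linear ?h"
    by (rule linearI) (auto simp: vec_eq_iff distrib_left)
  fix a b :: "real ^ 'n"
  show "measure lebesgue (?h ` cbox a b) = 1 * measure lebesgue (cbox a b)"
  proof (cases "cbox a b = {}")
    case False
    have eq: "cbox a b = (+) a ` cbox 0 (b - a)" using cbox_translation[of a 0 "b - a"] by simp
    have "?h ` cbox a b = (+) (?h a) ` (?h ` cbox 0 (b - a))"
      unfolding eq image_image by (intro image_cong refl linear_add[OF lin])
    then have "measure lebesgue (?h ` cbox a b) = measure lebesgue (?h ` cbox 0 (b - a))"
      by (simp add: measure_translation)
    also have "\<dots> = measure lebesgue (cbox 0 (b - a))"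
      using False eq assms by (intro measure_shear_interval) auto
    also have "\<dots> = measure lebesgue (cbox a b)" by (simp add: eq measure_translation del: measure_completion)
    finally show ?thesis by simp
  qed simp
qed

text \<open>
  Decomposition into elementary maps: stretchings and transpositions are self-adjoint, the adjoint of a shear
  is a shear, and shears preserve volume. A singular map and its adjoint both have a null set as their range.
\<close>

lemma linear_scaling:
  fixes f :: "real ^ 'n \<Rightarrow> real ^ 'n"
  assumes "linear f"
  shows "\<exists>c. scales f c \<and> scales (adjoint f) c"
proof (rule induct_linear_elementary[OF assms])
  fix f g :: "real ^ 'n \<Rightarrow> real ^ 'n"
  assume f: "linear f" and g: "linear g" and ex: "\<exists>c. scales f c \<and> scales (adjoint f) c" "\<exists>c. scales g c \<and> scales (adjoint g) c"
  obtain c where "scales f c" "scales (adjoint f) c" using ex(1) by (elim exE conjE)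
  moreover obtain d where "scales g d" "scales (adjoint g) d" using ex(2) by (elim exE conjE)
  moreover have "adjoint (f \<circ> g) = adjoint g \<circ> adjoint f"
    by (rule adjoint_unique) (simp add: adjoint_works[OF f] adjoint_works[OF g])
  ultimately show "\<exists>c. scales (f \<circ> g) c \<and> scales (adjoint (f \<circ> g)) c"
    using scales_compose[of f c g d] scales_compose[of "adjoint g" d "adjoint f" c] by (auto simp: mult.commute)
next
  fix f :: "real ^ 'n \<Rightarrow> real ^ 'n" and i assume f: "linear f" and 0: "\<And>x. f x $ i = 0"
  have "\<not> surj f"
  proof
    assume "surj f"
    then obtain x where "f x = axis i 1" by (metis surjD)
    then show False using 0[of x] by simp
  qed
  then have "\<not> inj f" using linear_injective_imp_surjective[OF f] by blast
  moreover have "\<not> inj (adjoint f)"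
  proof
    assume "inj (adjoint f)"
    moreover have "adjoint f (axis i 1) = 0"
      using adjoint_works[OF f, of "adjoint f (axis i 1)" "axis i 1"] 0 by (simp add: inner_axis)
    ultimately have "axis i (1::real) = 0" using linear_injective_0[OF adjoint_linear[OF f]] by blast
    then show False by simp
  qed
  ultimately show "\<exists>c. scales f c \<and> scales (adjoint f) c"
    using scales_singular f adjoint_linear by blast
next
  fix c :: "'n \<Rightarrow> real"
  have "adjoint (\<lambda>x :: real ^ 'n. \<chi> i. c i * x $ i) = (\<lambda>x. \<chi> i. c i * x $ i)"
    by (rule adjoint_unique) (simp add: inner_vec_def mult_ac)
  then show "\<exists>d. scales (\<lambda>x. \<chi> i. c i * x $ i) d \<and> scales (adjoint (\<lambda>x. \<chi> i. c i * x $ i)) d"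
    using scales_stretch by auto
next
  fix m n :: 'n
  have "adjoint (\<lambda>x :: real ^ 'n. \<chi> i. x $ Transposition.transpose m n i) = (\<lambda>x. \<chi> i. x $ Transposition.transpose m n i)"
  proof (rule adjoint_unique, intro allI)
    fix x y :: "real ^ 'n"
    show "(\<chi> i. x $ Transposition.transpose m n i) \<bullet> y = x \<bullet> (\<chi> i. y $ Transposition.transpose m n i)"
      unfolding inner_vec_def 
      using prod.permute sum.permute[OF permutes_swap_id, of m UNIV n "\<lambda>i. x $ Transposition.transpose m n i * y $ i"]
      by (simp add: o_def)
  qed
  then show "\<exists>c. scales (\<lambda>x :: real ^ 'n. \<chi> i. x $ Transposition.transpose m n i) c \<and> scales (adjoint (\<lambda>x :: real ^ 'n. \<chi> i. x $ Transposition.transpose m n i)) c"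
    using scales_swap by auto
next
  fix m n :: 'n assume mn: "m \<noteq> n"
  have sum: "(\<Sum>i\<in>UNIV. (if i = p then x $ p + x $ q else x $ i) * y $ i) = (\<Sum>i\<in>UNIV. x $ i * y $ i) + x $ q * y $ p"
    for p q :: 'n and x y :: "real ^ 'n"
  proof -
    have "(\<Sum>i\<in>UNIV. (if i = p then x $ p + x $ q else x $ i) * y $ i) = (\<Sum>i\<in>UNIV. x $ i * y $ i + (if i = p then x $ q * y $ p else 0))"
      by (intro sum.cong refl) (auto simp: algebra_simps)
    then show ?thesis by (simp add: sum.distrib)
  qed
  have "adjoint (\<lambda>x :: real ^ 'n. \<chi> i. if i = m then x $ m + x $ n else x $ i) = (\<lambda>x. \<chi> i. if i = n then x $ n + x $ m else x $ i)"
  proof (rule adjoint_unique, intro allI)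
    fix x y :: "real ^ 'n"
    show "(\<chi> i. if i = m then x $ m + x $ n else x $ i) \<bullet> y = x \<bullet> (\<chi> i. if i = n then y $ n + y $ m else y $ i)"
      using sum[of m x n y] sum[of n y m x] by (simp add: inner_vec_def mult.commute)
  qed
  then show "\<exists>c. scales (\<lambda>x :: real ^ 'n. \<chi> i. if i = m then x $ m + x $ n else x $ i) c \<and> 
      scales (adjoint (\<lambda>x :: real ^ 'n. \<chi> i. if i = m then x $ m + x $ n else x $ i)) c"
    using scales_shear[OF mn] scales_shear[of n m] mn by auto
qed

lemma linear_inv:
  assumes "linear J" "bij J" shows "linear (inv J)"
proof (rule linearI)
  fix x y r
  have J: "J (inv J z) = z" for z using assms(2) by (simp add: bij_is_surj surj_f_inv_f)
  show "inv J (x + y) = inv J x + inv J y"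
    by (rule inv_f_eq[OF bij_is_inj[OF assms(2)]]) (simp add: linear_add[OF assms(1)] J)
  show "inv J (r *\<^sub>R x) = r *\<^sub>R inv J x"
    by (rule inv_f_eq[OF bij_is_inj[OF assms(2)]]) (simp add: linear_scale[OF assms(1)] J)
qed

lemma lmeasurable_cbox_one: "measure lebesgue (cbox 0 1 :: (real ^ 'n) set) = 1"
  by (simp add: content_cbox_cart interval_ne_empty_cart)

lemma scales_pos:
  assumes J: "linear J" "bij J" "scales J c" shows "c > 0"
proof -
  have "linear (inv J)" using linear_inv[OF J(1,2)] .
  then obtain d where d: "scales (inv J) d" using linear_scaling by blast
  have "J ` (inv J ` cbox 0 1) = cbox 0 1" using J(2) by (simp add: bij_is_surj image_f_inv_f)
  then have 1: "c * measure lebesgue (inv J ` cbox 0 1) = 1"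
    using J(3) d unfolding scales_def by (metis lmeasurable_cbox lmeasurable_cbox_one)
  moreover have "measure lebesgue (inv J ` cbox 0 1) \<ge> 0" by simp
  ultimately show ?thesis by (metis mult_nonpos_nonneg not_less not_one_le_zero)
qed

lemma lborel_linear:
  fixes J :: "real ^ 'n \<Rightarrow> real ^ 'n"
  assumes J: "linear J" "bij J" "scales J c"
  shows "lborel = density (distr lborel borel J) (\<lambda>_. ennreal c)"
proof (rule lborel_eqI)
  have Jm[measurable]: "J \<in> borel_measurable borel"
    using J(1) by (intro borel_measurable_continuous_onI linear_continuous_on linear_conv_bounded_linear[THEN iffD1])
  have c: "c > 0" using scales_pos[OF J] .
  show "sets (density (distr lborel borel J) (\<lambda>_. ennreal c)) = sets borel" by simp
  fix l u :: "real ^ 'n" assume lu: "\<And>b. b \<in> Basis \<Longrightarrow> l \<bullet> b \<le> u \<bullet> b"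
  have lin: "linear (inv J)" using linear_inv[OF J(1,2)] .
  have pre: "J -` box l u = inv J ` box l u" using J(2) by (simp add: bij_vimage_eq_inv_image)
  have "bounded (J -` box l u)" unfolding pre by (intro bounded_linear_image bounded_box linear_conv_bounded_linear[THEN iffD1] lin)
  moreover have sets: "J -` box l u \<in> sets borel" using measurable_sets[OF Jm, of "box l u"] by simp
  ultimately have lm: "J -` box l u \<in> lmeasurable" by (intro bounded_set_imp_lmeasurable) auto
  have "J ` (J -` box l u) = box l u" using J(2) by (simp add: bij_is_surj surj_image_vimage_eq)
  then have eq: "measure lebesgue (box l u) = c * measure lebesgue (J -` box l u)"
    using J(3) lm unfolding scales_def by metis
  have "emeasure (density (distr lborel borel J) (\<lambda>_. ennreal c)) (box l u) = ennreal c * emeasure lborel (J -` box l u)"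
    by (simp add: emeasure_density_const emeasure_distr)
  also have "emeasure lborel (J -` box l u) = ennreal (measure lebesgue (J -` box l u))"
    using emeasure_eq_measure2[OF lm] sets by simp
  also have "ennreal c * \<dots> = ennreal (measure lebesgue (box l u))"
    unfolding eq using c by (simp add: ennreal_mult')
  also have "\<dots> = (\<Prod>b\<in>Basis. (u - l) \<bullet> b)"
    using lu by (simp add: measure_lborel_box)
  finally show "emeasure (density (distr lborel borel J) (\<lambda>_. ennreal c)) (box l u) = (\<Prod>b\<in>Basis. (u - l) \<bullet> b)" .
qed

lemma linear_borel: "linear (J :: real ^ 'n \<Rightarrow> real ^ 'n) \<Longrightarrow> J \<in> borel_measurable borel"
  by (intro borel_measurable_continuous_onI linear_continuous_on linear_conv_bounded_linear[THEN iffD1])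

lemma nn_integral_linear:
  fixes J :: "real ^ 'n \<Rightarrow> real ^ 'n"
  assumes J: "linear J" "bij J" "scales J c" and [measurable]: "h \<in> borel_measurable borel"
  shows "(\<integral>\<^sup>+x. h x \<partial>lborel) = ennreal c * (\<integral>\<^sup>+x. h (J x) \<partial>lborel)"
proof -
  have [measurable]: "J \<in> borel_measurable borel" by (rule linear_borel[OF J(1)])
  show ?thesis
    by (subst lborel_linear[OF J]) (simp add: nn_integral_density nn_integral_distr nn_integral_cmult)
qed

lemma
  fixes J :: "real ^ 'n \<Rightarrow> real ^ 'n" and h :: "real ^ 'n \<Rightarrow> 'b :: {banach, second_countable_topology}"
  assumes J: "linear J" "bij J" "scales J c" and [measurable]: "h \<in> borel_measurable borel"
  shows integral_linear: "(LINT x|lborel. h x) = c *\<^sub>R (LINT x|lborel. h (J x))"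
    and integrable_linear: "integrable lborel h \<longleftrightarrow> integrable lborel (\<lambda>x. h (J x))"
proof -
  have [measurable]: "J \<in> borel_measurable borel" by (rule linear_borel[OF J(1)])
  have c: "c > 0" using scales_pos[OF J] .
  show "(LINT x|lborel. h x) = c *\<^sub>R (LINT x|lborel. h (J x))"
    using c by (subst lborel_linear[OF J]) (simp add: integral_density integral_distr)
  have "integrable lborel h \<longleftrightarrow> integrable (density (distr lborel borel J) (\<lambda>_. ennreal c)) h"
    by (subst lborel_linear[OF J]) simp
  also have "\<dots> \<longleftrightarrow> integrable lborel (\<lambda>x. c *\<^sub>R h (J x))"
    using c by (simp add: integrable_density integrable_distr_eq)
  also have "\<dots> \<longleftrightarrow> integrable lborel (\<lambda>x. h (J x))"
  proof
    assume "integrable lborel (\<lambda>x. c *\<^sub>R h (J x))"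
    then have "integrable lborel (\<lambda>x. (1 / c) *\<^sub>R (c *\<^sub>R h (J x)))" by (rule integrable_scaleR_right)
    then show "integrable lborel (\<lambda>x. h (J x))" using c by simp
  qed (rule integrable_scaleR_right)
  finally show "integrable lborel h \<longleftrightarrow> integrable lborel (\<lambda>x. h (J x))" .
qed

section \<open>Plancherel bound, density, Borel representatives\<close>


lemma ft_measurable:
  assumes "L2on S G" "bounded S" shows "ft G \<in> borel_measurable borel"
proof (rule borel_measurable_continuous_onI)
  show "continuous_on UNIV (ft G)"
    using ft_LIMSEQ[OF assms] by (auto simp: continuous_on_sequentially o_def)
qed

definition unit_box :: "nat \<Rightarrow> (int ^ 'n) set" where
  "unit_box m = {a. \<forall>i. a $ i \<in> {- int m..<int m}}"

lemma finite_unit_box [simp]: "finite (unit_box m)"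
  unfolding unit_box_def by (rule card_vec_set) simp

lemma tile_unit_box: "tile 1 (unit_box m) = {x. \<forall>i. - real m \<le> x $ i \<and> x $ i < real m}"
proof -
  have "- int m \<le> \<lfloor>t\<rfloor> \<longleftrightarrow> - real m \<le> t" "\<lfloor>t\<rfloor> < int m \<longleftrightarrow> t < real m" for t :: real
    by (simp_all add: le_floor_iff floor_less_iff)
  then show ?thesis unfolding tile_def unit_box_def cell_def by simp
qed

lemma bounded_in_unit_box:
  assumes "bounded (S :: (real ^ 'n) set)" shows "\<exists>m. S \<subseteq> tile 1 (unit_box m)"
proof -
  obtain b where b: "\<And>x. x \<in> S \<Longrightarrow> norm x \<le> b" using assms by (auto simp: bounded_iff)
  obtain m :: nat where m: "b < real m" using reals_Archimedean2 by blast
  have "x \<in> tile 1 (unit_box m)" if "x \<in> S" for x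
  proof -
    have "\<bar>x $ i\<bar> < real m" for i using component_le_norm_cart[of x i] b[OF that] m by linarith
    then have "- real m < x $ i \<and> x $ i < real m" for i by (simp add: abs_less_iff minus_less_iff)
    then show ?thesis unfolding tile_unit_box using less_imp_le by blast
  qed
  then show ?thesis by blast
qed

text \<open>
  Integrating over the whole space means integrating, over the unit cube, the sum over its integer translates, and each
  of these sums is bounded by the Bessel inequality.
\<close>

lemma plancherel_upper:
  fixes S :: "(real ^ 'n) set"
  assumes S: "bounded S"
  shows "\<exists>C\<ge>0. \<forall>G. L2on S G \<longrightarrow> (\<integral>\<^sup>+t. ennreal ((cmod (ft G t))\<^sup>2) \<partial>lborel) \<le> ennreal (C * sq_norm G)"
proof -
  obtain k where k: "S \<subseteq> tile 1 (unit_box k)" using bounded_in_unit_box[OF S] by blast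
  define C where "C = real (card (unit_box k :: (int ^ 'n) set))"
  have "(\<integral>\<^sup>+t. ennreal ((cmod (ft G t))\<^sup>2) \<partial>lborel) \<le> ennreal (C * sq_norm G)" if G0: "L2on S G" for G
  proof -
    have G: "L2on (tile 1 (unit_box k)) G" by (rule L2on_mono[OF G0 k])
    have bt: "bounded (tile 1 (unit_box k :: (int ^ 'n) set))" by simp
    have [measurable]: "ft G \<in> borel_measurable borel" by (rule ft_measurable[OF G bt])
    define V where "V = (LINT y|lborel. cmod (G y))"
    have V: "cmod (ft G t) \<le> V" for t
      unfolding ft_def V_def by (rule order_trans[OF integral_norm_bound]) (simp add: norm_mult)
    let ?h = "\<lambda>t. (cmod (ft G t))\<^sup>2"
    have fin: "(\<integral>\<^sup>+t. ennreal (?h t) * indicator (tile 1 (unit_box m)) t \<partial>lborel) \<le> ennreal (C * sq_norm G)" for m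
    proof -
      let ?A = "unit_box m :: (int ^ 'n) set"
      have A[measurable]: "tile 1 ?A \<in> sets borel" by (rule tile_borel) auto
      let ?F = "\<lambda>t. ?h t * indicator (tile 1 ?A) t :: real"
      have int: "integrable lborel ?F"
      proof (rule Bochner_Integration.integrable_bound[where f="\<lambda>t. V\<^sup>2 * indicator (tile 1 ?A) t"])
        show "integrable lborel (\<lambda>t. V\<^sup>2 * indicator (tile 1 ?A) t :: real)"
          using finite_indicator_bounded[OF A] by simp
        have "?h t \<le> V\<^sup>2" for t using V[of t] by (intro power_mono) auto
        then show "AE t in lborel. norm (?F t) \<le> norm (V\<^sup>2 * indicator (tile 1 ?A) t)"
          by (intro AE_I2) (simp add: indicator_def)
      qed auto
      have one: "integrable lborel (indicator (cube 1) :: real ^ 'n \<Rightarrow> real)" "measure lborel (cube 1 :: (real ^ 'n) set) = 1"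
      proof -
        show "integrable lborel (indicator (cube 1) :: real ^ 'n \<Rightarrow> real)" by (rule finite_indicator_bounded) auto
        have "tile 1 {0 :: int ^ 'n} = cube 1"
          using cell_eq_iff[of 1 _ "0 :: int ^ 'n"] by (auto simp: tile_def corner_def)
        then show "measure lborel (cube 1 :: (real ^ 'n) set) = 1"
          using measure_tile[of 1 "{0 :: int ^ 'n}"] by (simp add: measure_completion)
      qed
      have pieces: "integrable lborel (\<lambda>u. indicator (cube 1) u *\<^sub>R ?F (u + corner 1 a))" for a :: "int ^ 'n"
        by (rule integral_tile(2)[where A = ?A, OF _ finite_unit_box int]) auto
      have "(LINT t|lborel. ?F t) = (\<Sum>a\<in>?A. LINT u|lborel. indicator (cube 1) u *\<^sub>R ?F (u + corner 1 a))"
        by (rule integral_tile(1)[OF _ finite_unit_box int]) auto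
      also have "\<dots> = (LINT u|lborel. (\<Sum>a\<in>?A. indicator (cube 1) u *\<^sub>R ?F (u + corner 1 a)))"
        by (rule Bochner_Integration.integral_sum[symmetric]) (rule pieces)
      also have "\<dots> \<le> (LINT u|lborel. C * sq_norm G * indicator (cube 1) (u :: real ^ 'n))"
      proof (rule integral_mono)
        show "integrable lborel (\<lambda>u. \<Sum>a\<in>?A. indicator (cube 1) u *\<^sub>R ?F (u + corner 1 a))"
          by (intro Bochner_Integration.integrable_sum pieces)
        show "integrable lborel (\<lambda>u. C * sq_norm G * indicator (cube 1) (u :: real ^ 'n))" using one by simp
        fix u :: "real ^ 'n"
        have "(\<Sum>a\<in>?A. indicator (cube 1) u *\<^sub>R ?F (u + corner 1 a)) \<le> (\<Sum>a\<in>?A. indicator (cube 1) u *\<^sub>R ?h (u + real 1 *\<^sub>R ivec a))"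
          by (intro sum_mono) (simp add: corner_def indicator_def)
        also have "\<dots> = indicator (cube 1) u * (\<Sum>a\<in>?A. ?h (u + real 1 *\<^sub>R ivec a))"
          by (simp add: sum_distrib_left)
        also have "\<dots> \<le> indicator (cube 1) u * (C * sq_norm G)"
          using bessel_tile[of 1, OF _ finite_unit_box G, of ?A u] by (intro mult_left_mono) (simp_all add: C_def)
        finally show "(\<Sum>a\<in>?A. indicator (cube 1) u *\<^sub>R ?F (u + corner 1 a)) \<le> C * sq_norm G * indicator (cube 1) u" by (simp add: mult_ac)
      qed
      also have "\<dots> = C * sq_norm G" using one by simp
      finally have le: "(LINT t|lborel. ?F t) \<le> C * sq_norm G" .
      have "(\<integral>\<^sup>+t. ennreal (?h t) * indicator (tile 1 ?A) t \<partial>lborel) = (\<integral>\<^sup>+t. ennreal (?F t) \<partial>lborel)"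
        by (intro nn_integral_cong) (simp add: indicator_def)
      also have "\<dots> = ennreal (LINT t|lborel. ?F t)" by (rule nn_integral_eq_integral[OF int]) simp
      finally show ?thesis using le by (simp add: ennreal_leI)
    qed
    have [measurable]: "tile 1 (unit_box m) \<in> sets (borel :: (real ^ 'n) measure)" for m by (rule tile_borel) auto
    have mono: "incseq (\<lambda>m t. ennreal (?h t) * indicator (tile 1 (unit_box m)) t)"
    proof (rule incseq_SucI, rule le_funI)
      fix m t
      have "tile 1 (unit_box m) \<subseteq> tile 1 (unit_box (Suc m) :: (int ^ 'n) set)"
      proof -
        have "- real (Suc m) \<le> s \<and> s < real (Suc m)" if "- real m \<le> s \<and> s < real m" for s
          using that by simp
        then show ?thesis unfolding tile_unit_box by blast
      qed
      then show "ennreal (?h t) * indicator (tile 1 (unit_box m)) t \<le> ennreal (?h t) * indicator (tile 1 (unit_box (Suc m))) t"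
        by (intro mult_left_mono) (auto simp: indicator_def)
    qed
    have "ennreal (?h t) \<le> (SUP m. ennreal (?h t) * indicator (tile 1 (unit_box m)) t)" for t
    proof -
      obtain m where "t \<in> tile 1 (unit_box m)" using bounded_in_unit_box[of "{t}"] by auto
      then have "ennreal (?h t) = ennreal (?h t) * indicator (tile 1 (unit_box m)) t" by simp
      also have "\<dots> \<le> (SUP m. ennreal (?h t) * indicator (tile 1 (unit_box m)) t)" by (rule SUP_upper) simp
      finally show ?thesis .
    qed
    then have "(\<integral>\<^sup>+t. ennreal (?h t) \<partial>lborel) \<le> (\<integral>\<^sup>+t. (SUP m. ennreal (?h t) * indicator (tile 1 (unit_box m)) t) \<partial>lborel)"
      by (intro nn_integral_mono)
    also have "\<dots> = (SUP m. \<integral>\<^sup>+t. ennreal (?h t) * indicator (tile 1 (unit_box m)) t \<partial>lborel)"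
      by (rule nn_integral_monotone_convergence_SUP[OF mono]) measurable
    also have "\<dots> \<le> ennreal (C * sq_norm G)" by (intro SUP_least fin)
    finally show ?thesis .
  qed
  then show ?thesis by (intro exI[of _ C]) (auto simp: C_def)
qed

text \<open>
  The spectra are transported by changes of variables for Borel functions, and the functions
  in \<open>L2on\<close> vanish outside \<open>S\<close> everywhere. Both are achieved by a change on a null set.
\<close>

lemma borel_representative:
  fixes F :: "real ^ 'n \<Rightarrow> complex"
  assumes F: "F \<in> borel_measurable lebesgue" "integrable lebesgue (\<lambda>x. (cmod (F x))\<^sup>2)"
    and S: "AE x in lebesgue. x \<notin> S \<longrightarrow> F x = 0" "S \<in> sets borel"
  shows "\<exists>F'. L2on S F' \<and> (AE x in lebesgue. F x = F' x)"
proof -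
  have re: "(\<lambda>x. Re (F x)) \<in> borel_measurable lebesgue" and im: "(\<lambda>x. Im (F x)) \<in> borel_measurable lebesgue"
    using F(1) unfolding borel_measurable_complex_iff by auto
  obtain f g where f: "f \<in> borel_measurable lborel" "AE x in lborel. Re (F x) = f x"
    and g: "g \<in> borel_measurable lborel" "AE x in lborel. Im (F x) = g x"
    using completion_ex_borel_measurable_real[OF re] completion_ex_borel_measurable_real[OF im] by blast
  have [measurable]: "f \<in> borel_measurable borel" "g \<in> borel_measurable borel" using f(1) g(1) by auto
  define F' where "F' = (\<lambda>x. of_real (indicator S x) * Complex (f x) (g x))"
  have meas: "F' \<in> borel_measurable borel"
    unfolding F'_def Complex_eq using S(2) by measurable
  have ae: "AE x in lebesgue. F x = F' x"
    using AE_completion[OF f(2)] AE_completion[OF g(2)] S(1)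
    by eventually_elim (auto simp: F'_def indicator_def complex_eq_iff)
  have ml: "F' \<in> borel_measurable lebesgue" using meas by (simp add: measurable_completion)
  have "integrable lebesgue (\<lambda>x. (cmod (F' x))\<^sup>2)"
    using F(2)
  proof (rule integrable_cong_AE_imp)
    show "(\<lambda>x. (cmod (F' x))\<^sup>2) \<in> borel_measurable lebesgue" using ml by measurable
    show "AE x in lebesgue. (cmod (F x))\<^sup>2 = (cmod (F' x))\<^sup>2" using ae by eventually_elim simp
  qed
  then have "integrable lborel (\<lambda>x. (cmod (F' x))\<^sup>2)"
    using meas by (subst (asm) integrable_completion) auto
  then have "L2on S F'" using meas by (auto simp: L2on_def F'_def)
  then show ?thesis using ae by blast
qed

lemma norm_ivec_ge_one: "z \<noteq> w \<Longrightarrow> norm (ivec z - ivec w) \<ge> 1"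
proof -
  assume "z \<noteq> w"
  then obtain i where "z $ i \<noteq> w $ i" by (auto simp: vec_eq_iff)
  then have "1 \<le> \<bar>of_int (z $ i - w $ i) :: real\<bar>" by linarith
  also have "\<dots> = \<bar>(ivec z - ivec w) $ i\<bar>" by simp
  also have "\<dots> \<le> norm (ivec z - ivec w)" by (rule component_le_norm_cart)
  finally show ?thesis .
qed

text \<open>
  Volume comparison: the images under \<open>T\<close> of the unit cubes have volume \<open>c\<close>, and every point of such an image is
  within the fixed distance \<open>\<rho>\<close> of its sample point. So \<open>c\<close> times the number of points in a ball of radius \<open>r\<close> lies
  between the volumes of the balls of radius \<open>r - \<rho>\<close> and \<open>r + \<rho>\<close>.
\<close>

lemma uniform_density_perturbed:
  fixes T :: "real ^ 'n \<Rightarrow> real ^ 'n" and p :: "int ^ 'n \<Rightarrow> real ^ 'n"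
  assumes T: "linear T" "bij T" "scales T c" and p: "inj p" "\<And>z. norm (p z - ivec z) \<le> 1"
  shows "has_uniform_density (range (T \<circ> p)) (1 / c)"
proof -
  have c: "c > 0" by (rule scales_pos[OF T])
  obtain M where M: "M > 0" "\<And>x. norm (T x) \<le> M * norm x"
    using linear_bounded_pos[OF T(1)] by blast
  define \<rho> where "\<rho> = M * (real CARD('n) + 1)"
  have \<rho>: "\<rho> > 0" using M(1) by (simp add: \<rho>_def add_nonneg_pos)
  have near: "dist (T y) (T (p (cell 1 y))) \<le> \<rho>" for y
  proof -
    have "cell 1 (corner 1 (cell 1 y)) = cell 1 y" by (simp add: cell_eq_iff cube_def)
    then have "dist y (corner 1 (cell 1 y)) \<le> CARD('n) / real 1" by (intro cell_eq_dist) auto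
    then have 1: "norm (y - ivec (cell 1 y)) \<le> CARD('n)" by (simp add: corner_def dist_norm)
    have "norm (y - p (cell 1 y)) \<le> norm (y - ivec (cell 1 y)) + norm (ivec (cell 1 y) - p (cell 1 y))"
      using norm_triangle_ineq[of "y - ivec (cell 1 y)" "ivec (cell 1 y) - p (cell 1 y)"] by simp
    also have "\<dots> \<le> real CARD('n) + 1" using 1 p(2)[of "cell 1 y"] by (simp add: norm_minus_commute)
    finally have "M * norm (y - p (cell 1 y)) \<le> \<rho>" unfolding \<rho>_def using M(1) by (intro mult_left_mono) auto
    then show ?thesis
      using M(2)[of "y - p (cell 1 y)"] by (simp add: dist_norm linear_diff[OF T(1), symmetric])
  qed
  have cell: "T ` tile 1 A \<in> lmeasurable \<and> measure lebesgue (T ` tile 1 A) = c * card A" if "finite A" for A :: "(int ^ 'n) set"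
  proof -
    have "tile 1 A \<in> lmeasurable"
      using bounded_tile[of 1 A] tile_borel[of 1 A] that by (intro bounded_set_imp_lmeasurable) auto
    then show ?thesis using T(3) measure_tile[of 1 A] that by (simp add: scales_def)
  qed
  define Z where "Z = (\<lambda>x r. {z. T (p z) \<in> cball x r})"
  define vol where "vol = (\<lambda>r. measure lebesgue (cball (0 :: real ^ 'n) r))"
  have vol: "measure lebesgue (cball x r) = vol r" if "r \<ge> 0" for x :: "real ^ 'n" and r
    using that by (simp add: vol_def content_cball)
  have volr: "vol r = unit_ball_vol (real CARD('n)) * r ^ CARD('n)" if "r \<ge> 0" for r
    using that by (simp add: vol_def content_cball)
  have upper: "c * card A \<le> vol (r + \<rho>)" if A: "finite A" "A \<subseteq> Z x r" and r: "r \<ge> 0" for A x r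
  proof -
    have "T ` tile 1 A \<subseteq> cball x (r + \<rho>)"
    proof
      fix w assume "w \<in> T ` tile 1 A"
      then obtain y where y: "w = T y" "cell 1 y \<in> A" by (auto simp: tile_def)
      then have "dist x (T (p (cell 1 y))) \<le> r" using A(2) by (auto simp: Z_def)
      then show "w \<in> cball x (r + \<rho>)"
        using near[of y] dist_triangle[of x w "T (p (cell 1 y))"] y(1) by (simp add: dist_commute)
    qed
    then have "measure lebesgue (T ` tile 1 A) \<le> measure lebesgue (cball x (r + \<rho>))"
      using cell[OF A(1)] by (intro measure_mono_fmeasurable) (auto simp: fmeasurableD)
    then show ?thesis using cell[OF A(1)] vol[of "r + \<rho>" x] r \<rho> by simp
  qed
  have finZ: "finite (Z x r)" if r: "r \<ge> 0" for x r
  proof -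
    have "card A \<le> nat \<lceil>vol (r + \<rho>) / c\<rceil>" if "A \<subseteq> Z x r" "finite A" for A
    proof -
      have "real (card A) \<le> vol (r + \<rho>) / c" using upper[OF that(2,1) r] c by (simp add: field_simps)
      then show ?thesis by linarith
    qed
    then show ?thesis using finite_if_finite_subsets_card_bdd[of "Z x r"] by blast
  qed
  have lower: "vol (r - \<rho>) \<le> c * card (Z x r)" if r: "r \<ge> \<rho>" for x r
  proof -
    have fz: "finite (Z x r)" using finZ r \<rho> by auto
    have "cball x (r - \<rho>) \<subseteq> T ` tile 1 (Z x r)"
    proof
      fix w assume w: "w \<in> cball x (r - \<rho>)"
      obtain y where y: "w = T y" using T(2) by (metis bij_is_surj surjD)
      have "dist x (T (p (cell 1 y))) \<le> r"
        using w near[of y] dist_triangle[of x "T (p (cell 1 y))" w] y by simp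
      then show "w \<in> T ` tile 1 (Z x r)" unfolding y by (auto simp: Z_def tile_def)
    qed
    then have "measure lebesgue (cball x (r - \<rho>)) \<le> measure lebesgue (T ` tile 1 (Z x r))"
      using cell[OF fz] by (intro measure_mono_fmeasurable) auto
    then show ?thesis using cell[OF fz] vol[of "r - \<rho>" x] r by simp
  qed
  have injTp: "inj (T \<circ> p)" using T(2) p(1) by (intro inj_compose) (auto simp: bij_is_inj)
  have inter: "range (T \<circ> p) \<inter> cball x r = (T \<circ> p) ` Z x r" for x r by (auto simp: Z_def)
  have card_eq: "card (range (T \<circ> p) \<inter> cball x r) = card (Z x r)" for x r
    unfolding inter by (rule card_image) (rule inj_on_subset[OF injTp subset_UNIV])
  define e where "e = (\<lambda>r x. real (card (Z x r)) / vol r * c - 1)"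
  have volpos: "vol r > 0" if "r > 0" for r using that volr[of r] by simp
  have bnd: "\<bar>e r x\<bar> \<le> \<bar>(1 + \<rho> / r) ^ CARD('n) - 1\<bar> + \<bar>(1 - \<rho> / r) ^ CARD('n) - 1\<bar>" if r: "r > \<rho>" for r x
  proof -
    have r0: "r > 0" using r \<rho> by linarith
    have q: "vol (r + s) / vol r = (1 + s / r) ^ CARD('n)" if "r + s \<ge> 0" for s
    proof -
      have "vol (r + s) / vol r = ((r + s) / r) ^ CARD('n)"
        using r0 that less_imp_neq[OF unit_ball_vol_pos[of "real CARD('n)"]] by (simp add: volr power_divide)
      also have "(r + s) / r = 1 + s / r" using r0 by (simp add: field_simps)
      finally show ?thesis .
    qed
    have "c * card (Z x r) \<le> vol (r + \<rho>)" using finZ[of r x] r0 by (intro upper) auto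
    then have "c * card (Z x r) / vol r \<le> vol (r + \<rho>) / vol r" using volpos[OF r0] by (intro divide_right_mono) auto
    then have 1: "e r x + 1 \<le> (1 + \<rho> / r) ^ CARD('n)" using q[of \<rho>] r0 \<rho> by (simp add: e_def mult.commute)
    have "vol (r - \<rho>) / vol r \<le> c * card (Z x r) / vol r"
      using lower[of r x] r volpos[OF r0] by (intro divide_right_mono) auto
    then have 2: "(1 - \<rho> / r) ^ CARD('n) \<le> e r x + 1" using q[of "- \<rho>"] r by (simp add: e_def mult.commute)
    show ?thesis using 1 2 by linarith
  qed
  have lim: "((\<lambda>r. \<bar>(1 + \<rho> / r) ^ CARD('n) - 1\<bar> + \<bar>(1 - \<rho> / r) ^ CARD('n) - 1\<bar>) \<longlongrightarrow> 0) at_top"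
  proof -
    have "((\<lambda>r. \<rho> / r) \<longlongrightarrow> 0) at_top"
      by (intro tendsto_divide_0[OF tendsto_const] filterlim_at_top_imp_at_infinity filterlim_ident)
    then have "((\<lambda>r. \<bar>(1 + \<rho> / r) ^ CARD('n) - 1\<bar> + \<bar>(1 - \<rho> / r) ^ CARD('n) - 1\<bar>) \<longlongrightarrow> \<bar>(1 + 0) ^ CARD('n) - 1\<bar> + \<bar>(1 - 0) ^ CARD('n) - 1\<bar>) at_top"
      by (intro tendsto_intros)
    then show ?thesis by simp
  qed
  show ?thesis
    unfolding has_uniform_density_def
  proof (intro exI[of _ e] conjI)
    show "uniform_limit UNIV e (\<lambda>_. 0) at_top"
    proof (rule uniform_limitI)
      fix \<delta> :: real assume "\<delta> > 0"
      have "\<forall>\<^sub>F r in at_top. \<bar>(1 + \<rho> / r) ^ CARD('n) - 1\<bar> + \<bar>(1 - \<rho> / r) ^ CARD('n) - 1\<bar> < \<delta>"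
        by (rule order_tendstoD(2)[OF lim \<open>\<delta> > 0\<close>])
      then show "\<forall>\<^sub>F r in at_top. \<forall>x\<in>UNIV. dist (e r x) 0 < \<delta>"
        using eventually_gt_at_top[of \<rho>]
      proof eventually_elim
        case (elim r)
        show ?case
        proof
          fix x
          show "dist (e r x) 0 < \<delta>" using bnd[OF elim(2), of x] elim(1) by (simp add: dist_norm)
        qed
      qed
    qed
    show "\<forall>\<^sub>F r in at_top. \<forall>x. finite (range (T \<circ> p) \<inter> cball x r) \<and>
        real (card (range (T \<circ> p) \<inter> cball x r)) / measure lebesgue (cball (0 :: real ^ 'n) r) = 1 / c * (1 + e r x)"
      using eventually_gt_at_top[of 0]
    proof eventually_elim
      case (elim r)
      show ?case
      proof (intro allI conjI)
        fix x
        show "finite (range (T \<circ> p) \<inter> cball x r)" unfolding inter using finZ[of r x] elim by simp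
        show "real (card (range (T \<circ> p) \<inter> cball x r)) / measure lebesgue (cball (0 :: real ^ 'n) r) = 1 / c * (1 + e r x)"
          unfolding card_eq using c by (simp add: e_def vol_def)
      qed
    qed
  qed
qed

section \<open>Transfer to an arbitrary lattice\<close>

text \<open>
  The substitution \<open>y = J x\<close> turns the phase \<open>T t \<bullet> x\<close> into \<open>2 \<pi> (t \<bullet> y)\<close>.
\<close>

lemma fourier_transform_linear:
  fixes T J :: "real ^ 'n \<Rightarrow> real ^ 'n"
  assumes J: "linear J" "bij J" "scales J d" and TJ: "\<And>t x. T t \<bullet> x = 2 * pi * (t \<bullet> J x)"
    and F: "F \<in> borel_measurable lebesgue" and G: "G \<in> borel_measurable borel"
    and eq: "AE x in lebesgue. F x = G (J x)"
  shows "fourier_transform F (T t) = of_real ((2 * pi) powr (- real CARD('n) / 2) / d) * ft G t"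
proof -
  have d: "d > 0" by (rule scales_pos[OF J])
  have [measurable]: "J \<in> borel_measurable borel" by (rule linear_borel[OF J(1)])
  note [measurable] = G
  have E: "exp (- \<i> * complex_of_real (T t \<bullet> x)) = E t (J x)" for x
    by (simp add: E_def TJ cis_conv_exp mult_ac)
  have m: "(\<lambda>x. E t (J x) * G (J x)) \<in> borel_measurable borel" by measurable
  have mE: "(\<lambda>x. E t (J x)) \<in> borel_measurable lebesgue"
    by (rule measurable_completion) measurable
  have "(LINT x|lebesgue. exp (- \<i> * complex_of_real (T t \<bullet> x)) * F x) = (LINT x|lebesgue. E t (J x) * G (J x))"
    unfolding E
  proof (rule integral_cong_AE)
    show "(\<lambda>x. E t (J x) * F x) \<in> borel_measurable lebesgue" by (rule borel_measurable_times[OF mE F])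
    show "(\<lambda>x. E t (J x) * G (J x)) \<in> borel_measurable lebesgue" by (rule measurable_completion) (use m in simp)
    show "AE x in lebesgue. E t (J x) * F x = E t (J x) * G (J x)" using eq by eventually_elim simp
  qed
  also have "\<dots> = (LINT x|lborel. E t (J x) * G (J x))"
    by (rule integral_completion) (use m in simp)
  also have "\<dots> = (1 / d) *\<^sub>R ft G t"
    using integral_linear[OF J, of "\<lambda>y. E t y * G y"] d unfolding ft_def by simp
  finally show ?thesis by (simp add: fourier_transform_def scaleR_conv_of_real)
qed

lemma L2on_linear:
  fixes J :: "real ^ 'n \<Rightarrow> real ^ 'n"
  assumes J: "linear J" "bij J" "scales J d" and G: "L2on (J ` S) G"
  shows "L2on S (\<lambda>x. G (J x))"
proof -
  have [measurable]: "J \<in> borel_measurable borel" by (rule linear_borel[OF J(1)])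
  have [measurable]: "G \<in> borel_measurable borel" using L2onD(1)[OF G] .
  have "integrable lborel (\<lambda>x. (cmod (G (J x)))\<^sup>2)"
    using integrable_linear[OF J, of "\<lambda>x. (cmod (G x))\<^sup>2"] L2onD(2)[OF G] by simp
  moreover have "G (J x) = 0" if "x \<notin> S" for x
    using that J(2) by (intro L2onD(3)[OF G]) (auto simp: bij_def inj_def)
  ultimately show ?thesis by (auto simp: L2on_def)
qed

lemma L2on_linear_inv:
  fixes J :: "real ^ 'n \<Rightarrow> real ^ 'n"
  assumes J: "linear J" "bij J" "scales J d" and F: "L2on S F"
  shows "L2on (J ` S) (\<lambda>y. F (inv J y))"
proof -
  have i: "linear (inv J)" "bij (inv J)" using linear_inv[OF J(1,2)] bij_imp_bij_inv[OF J(2)] by auto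
  obtain e where e: "scales (inv J) e" using linear_scaling[OF i(1)] by blast
  have "inv J ` (J ` S) = S" using J(2) by (simp add: image_inv_f_f bij_is_inj)
  then show ?thesis using L2on_linear[OF i e, of "J ` S" F] F by simp
qed

lemma finite_sums_le_infsum:
  fixes f :: "'a \<Rightarrow> ennreal"
  assumes "finite F" "F \<subseteq> A" shows "sum f F \<le> infsum f A"
  using assms by (subst nonneg_infsum_complete) (auto intro: SUP_upper)

text \<open>
  Both sides of the sampling inequality are expressed by \<open>ft G\<close>, up to constant factors. If the sum of the
  squared samples is infinite there is nothing to prove; otherwise it bounds all finite partial sums.
\<close>

lemma stable_sampling_transfer:
  fixes T J :: "real ^ 'n \<Rightarrow> real ^ 'n" and p :: "int ^ 'n \<Rightarrow> real ^ 'n"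
  assumes T: "linear T" "bij T" "scales T c" and J: "linear J" "bij J" "scales J d"
    and TJ: "\<And>t x. T t \<bullet> x = 2 * pi * (t \<bullet> J x)"
    and p: "inj p" and S: "S \<in> sets borel" "bounded S"
    and st: "stable_on p (J ` S) \<beta>" and \<beta>: "\<beta> > 0"
  shows "stable_sampling_set S (range (T \<circ> p))"
proof -
  have c: "c > 0" by (rule scales_pos[OF T])
  have d: "d > 0" by (rule scales_pos[OF J])
  have bJ: "bounded (J ` S)" using S(2) J(1) by (simp add: bounded_linear_image linear_conv_bounded_linear)
  obtain C where C: "C \<ge> 0" "\<And>G. L2on (J ` S) G \<Longrightarrow> (\<integral>\<^sup>+t. ennreal ((cmod (ft G t))\<^sup>2) \<partial>lborel) \<le> ennreal (C * sq_norm G)"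
    using plancherel_upper[OF bJ] by blast
  define \<kappa> where "\<kappa> = (2 * pi) powr (- real CARD('n) / 2) / d"
  have \<kappa>: "\<kappa> > 0" using d by (simp add: \<kappa>_def)
  \<comment> \<open>The summand 1 only makes \<open>M\<close> positive when \<open>C = 0\<close>.\<close>
  define M where "M = c * C / \<beta> + 1"
  have M: "M > 0" using c C(1) \<beta> by (simp add: M_def add_nonneg_pos)
  have injTp: "inj (T \<circ> p)" using T(2) p by (intro inj_compose) (auto simp: bij_is_inj)
  show ?thesis
    unfolding stable_sampling_set_def
  proof (intro exI[of _ M] conjI M ballI)
    fix f assume "f \<in> paley_wiener S"
    then obtain F where F: "f = fourier_transform F" "F \<in> borel_measurable lebesgue"
      "integrable lebesgue (\<lambda>x. (cmod (F x))\<^sup>2)" "AE x in lebesgue. x \<notin> S \<longrightarrow> F x = 0"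
      unfolding paley_wiener_def by blast
    obtain F' where F': "L2on S F'" "AE x in lebesgue. F x = F' x"
      using borel_representative[OF F(2,3,4) S(1)] by blast
    define G where "G = (\<lambda>y. F' (inv J y))"
    have G: "L2on (J ` S) G" unfolding G_def by (rule L2on_linear_inv[OF J F'(1)])
    have GJ: "G (J x) = F' x" for x using J(2) by (simp add: G_def bij_is_inj)
    have fT: "f (T t) = of_real \<kappa> * ft G t" for t
      unfolding F(1) \<kappa>_def
      by (rule fourier_transform_linear[OF J TJ F(2) L2onD(1)[OF G]]) (use F'(2) GJ in simp)
    have [measurable]: "ft G \<in> borel_measurable borel" by (rule ft_measurable[OF G bJ])
    have [measurable]: "inv T \<in> borel_measurable borel" using linear_borel[OF linear_inv[OF T(1,2)]] .
    have "f = (\<lambda>t. of_real \<kappa> * ft G (inv T t))"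
    proof
      fix t show "f t = of_real \<kappa> * ft G (inv T t)"
        using fT[of "inv T t"] T(2) by (simp add: bij_is_surj surj_f_inv_f)
    qed
    then have [measurable]: "f \<in> borel_measurable borel" by simp
    have sq: "ennreal ((cmod (f (T t)))\<^sup>2) = ennreal (\<kappa>\<^sup>2) * ennreal ((cmod (ft G t))\<^sup>2)" for t
      using \<kappa> by (simp add: fT norm_mult power_mult_distrib ennreal_mult')
    have "(\<integral>\<^sup>+t. ennreal ((cmod (f t))\<^sup>2) \<partial>lebesgue) = (\<integral>\<^sup>+t. ennreal ((cmod (f t))\<^sup>2) \<partial>lborel)"
      by (rule nn_integral_completion)
    also have "\<dots> = ennreal c * (\<integral>\<^sup>+t. ennreal ((cmod (f (T t)))\<^sup>2) \<partial>lborel)"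
      by (rule nn_integral_linear[OF T]) measurable
    also have "\<dots> = ennreal c * (ennreal (\<kappa>\<^sup>2) * (\<integral>\<^sup>+t. ennreal ((cmod (ft G t))\<^sup>2) \<partial>lborel))"
      unfolding sq by (subst nn_integral_cmult) auto
    also have "\<dots> \<le> ennreal c * (ennreal (\<kappa>\<^sup>2) * ennreal (C * sq_norm G))"
      by (intro mult_left_mono C(2)[OF G]) auto
    also have "\<dots> = ennreal (c * \<kappa>\<^sup>2 * C * sq_norm G)"
      using c C(1) by (simp add: ennreal_mult' mult.assoc)
    finally have I: "(\<integral>\<^sup>+t. ennreal ((cmod (f t))\<^sup>2) \<partial>lebesgue) \<le> ennreal (c * \<kappa>\<^sup>2 * C * sq_norm G)" .
    define \<Sigma> where "\<Sigma> = (\<Sum>\<^sub>\<infinity>x\<in>range (T \<circ> p). ennreal ((cmod (f x))\<^sup>2))"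
    have "(\<integral>\<^sup>+t. ennreal ((cmod (f t))\<^sup>2) \<partial>lebesgue) \<le> ennreal M * \<Sigma>"
    proof (cases \<Sigma>)
      case top
      then show ?thesis using M by (simp add: ennreal_mult_top)
    next
      case (real K)
      have K0: "K \<ge> 0" using real by simp
      have "(\<Sum>z\<in>Z. (cmod (ft G (p z)))\<^sup>2) \<le> K / \<kappa>\<^sup>2" if Z: "finite Z" for Z
      proof -
        have "ennreal (\<kappa>\<^sup>2 * (\<Sum>z\<in>Z. (cmod (ft G (p z)))\<^sup>2)) = (\<Sum>z\<in>Z. ennreal ((cmod (f (T (p z))))\<^sup>2))"
          by (simp add: fT norm_mult power_mult_distrib sum_distrib_left)
        also have "\<dots> = (\<Sum>x\<in>(T \<circ> p) ` Z. ennreal ((cmod (f x))\<^sup>2))"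
          by (subst sum.reindex) (auto intro: inj_on_subset[OF injTp])
        also have "\<dots> \<le> \<Sigma>" unfolding \<Sigma>_def using Z by (intro finite_sums_le_infsum) auto
        finally have "\<kappa>\<^sup>2 * (\<Sum>z\<in>Z. (cmod (ft G (p z)))\<^sup>2) \<le> K" using real by simp
        then show ?thesis using \<kappa> by (simp add: field_simps)
      qed
      then have "\<beta> * sq_norm G \<le> K / \<kappa>\<^sup>2" using st G unfolding stable_on_def by blast
      then have "\<kappa>\<^sup>2 * sq_norm G \<le> K / \<beta>" using \<beta> \<kappa> by (simp add: field_simps)
      then have "c * C * (\<kappa>\<^sup>2 * sq_norm G) \<le> c * C * (K / \<beta>)" using c C(1) by (intro mult_left_mono) auto
      also have "\<dots> \<le> M * K" using K0 by (simp add: M_def distrib_right)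
      finally have "c * \<kappa>\<^sup>2 * C * sq_norm G \<le> M * K" by (simp add: mult_ac)
      then have "ennreal (c * \<kappa>\<^sup>2 * C * sq_norm G) \<le> ennreal M * \<Sigma>"
        using real M by (simp add: ennreal_leI flip: ennreal_mult')
      then show ?thesis using I by (rule order_trans[rotated])
    qed
    then show "(\<integral>\<^sup>+t. ennreal ((cmod (f t))\<^sup>2) \<partial>lebesgue) \<le> ennreal M * (\<Sum>\<^sub>\<infinity>x\<in>range (T \<circ> p). ennreal ((cmod (f x))\<^sup>2))"
      unfolding \<Sigma>_def .
  qed
qed

lemma interpolation_transfer:
  fixes T J :: "real ^ 'n \<Rightarrow> real ^ 'n" and p :: "int ^ 'n \<Rightarrow> real ^ 'n"
  assumes T: "bij T" and J: "linear J" "bij J" "scales J d"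
    and TJ: "\<And>t x. T t \<bullet> x = 2 * pi * (t \<bullet> J x)"
    and p: "inj p" and B: "B \<subseteq> J ` S" "bounded B"
    and so: "approx_solvable_on p B \<beta>" and \<beta>: "\<beta> > 0"
  shows "interpolation_set S (range (T \<circ> p))"
  unfolding interpolation_set_def
proof (intro conjI allI impI)
  have d: "d > 0" by (rule scales_pos[OF J])
  define \<kappa> where "\<kappa> = (2 * pi) powr (- real CARD('n) / 2) / d"
  have \<kappa>: "\<kappa> > 0" using d by (simp add: \<kappa>_def)
  have injTp: "inj (T \<circ> p)" using T p by (intro inj_compose) (auto simp: bij_is_inj)
  show "countable (range (T \<circ> p))" by simp
  fix c :: "real ^ 'n \<Rightarrow> complex" assume c: "(\<lambda>x. (cmod (c x))\<^sup>2) summable_on range (T \<circ> p)"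
  define a where "a = (\<lambda>z. c (T (p z)) / of_real \<kappa>)"
  define B0 where "B0 = (\<Sum>\<^sub>\<infinity>x\<in>range (T \<circ> p). (cmod (c x))\<^sup>2) / \<kappa>\<^sup>2"
  have "l2_bound a B0"
    unfolding l2_bound_def
  proof (intro allI impI)
    fix Z :: "(int ^ 'n) set" assume Z: "finite Z"
    have "(\<Sum>z\<in>Z. (cmod (a z))\<^sup>2) = (\<Sum>z\<in>Z. (cmod (c ((T \<circ> p) z)))\<^sup>2) / \<kappa>\<^sup>2"
      using \<kappa> by (simp add: a_def norm_divide power_divide sum_divide_distrib)
    also have "(\<Sum>z\<in>Z. (cmod (c ((T \<circ> p) z)))\<^sup>2) = (\<Sum>x\<in>(T \<circ> p) ` Z. (cmod (c x))\<^sup>2)"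
      by (subst sum.reindex) (auto intro: inj_on_subset[OF injTp])
    also have "\<dots> \<le> (\<Sum>\<^sub>\<infinity>x\<in>range (T \<circ> p). (cmod (c x))\<^sup>2)"
      using Z by (intro finite_sum_le_infsum[OF c]) auto
    finally show "(\<Sum>z\<in>Z. (cmod (a z))\<^sup>2) \<le> B0" by (simp add: B0_def divide_right_mono)
  qed
  then obtain G where G: "L2on B G" "\<And>z. ft G (p z) = a z"
    using approx_solvable_imp_solvable[OF so \<beta> B(2)] by blast
  define F where "F = (\<lambda>x. G (J x))"
  have F: "L2on S F" unfolding F_def by (rule L2on_linear[OF J L2on_mono[OF G(1) B(1)]])
  have Fm: "F \<in> borel_measurable lebesgue" using L2onD(1)[OF F] by (simp add: measurable_completion)
  have "fourier_transform F (T (p z)) = of_real \<kappa> * ft G (p z)" for z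
    unfolding \<kappa>_def by (rule fourier_transform_linear[OF J TJ Fm L2onD(1)[OF G(1)]]) (simp add: F_def)
  then have val: "fourier_transform F (T (p z)) = c (T (p z))" for z
    using \<kappa> by (simp add: G(2) a_def)
  have "(\<lambda>x. (cmod (F x))\<^sup>2) \<in> borel_measurable borel" using L2onD(1)[OF F] by measurable
  then have "integrable lebesgue (\<lambda>x. (cmod (F x))\<^sup>2)"
    using L2onD(2)[OF F] by (subst integrable_completion) auto
  then have "fourier_transform F \<in> paley_wiener S"
    unfolding paley_wiener_def using Fm L2onD(3)[OF F] by blast
  then show "\<exists>f\<in>paley_wiener S. \<forall>x\<in>range (T \<circ> p). f x = c x"
    using val by (intro bexI[of _ "fourier_transform F"]) auto
qed

lemma stable_on_subset:
  assumes "stable_on p B \<beta>" "S \<subseteq> B" shows "stable_on p S \<beta>"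
  unfolding stable_on_def
proof (intro allI impI)
  fix G K assume "L2on S G" "\<forall>F. finite F \<longrightarrow> (\<Sum>z\<in>F. (cmod (ft G (p z)))\<^sup>2) \<le> K"
  then show "\<beta> * sq_norm G \<le> K"
    using assms(1) L2on_mono[OF _ assms(2), of G] unfolding stable_on_def by blast
qed

lemma perturbation_of_lattice:
  fixes T :: "real ^ 'n \<Rightarrow> real ^ 'n" and p :: "int ^ 'n \<Rightarrow> real ^ 'n"
  assumes T: "linear T" "bij T" and p: "inj p" and near: "\<And>z. norm (T (p z) - T (ivec z)) \<le> \<eta>" and \<eta>: "\<eta> < \<epsilon>"
  shows "eps_perturbation \<epsilon> (range (T \<circ> ivec)) (range (T \<circ> p))"
proof -
  let ?n = "to_nat :: int ^ 'n \<Rightarrow> nat"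
  have inj: "inj (T \<circ> ivec)" "inj (T \<circ> p)"
    using bij_is_inj[OF T(2)] p by (auto intro!: inj_compose simp: inj_def[of ivec])
  have bij: "bij_betw (f \<circ> from_nat) (range ?n) (range f)" if "inj f" for f :: "int ^ 'n \<Rightarrow> real ^ 'n"
  proof (rule bij_betw_imageI)
    show "inj_on (f \<circ> from_nat) (range ?n)" using that by (auto simp: inj_on_def)
    show "(f \<circ> from_nat) ` range ?n = range f" by (auto simp: image_image)
  qed
  have "(SUP k\<in>range ?n. ereal (norm ((T \<circ> ivec \<circ> from_nat) k - (T \<circ> p \<circ> from_nat) k))) \<le> ereal \<eta>"
  proof (intro SUP_least)
    fix k assume "k \<in> range ?n"
    then obtain z where "k = ?n z" by blast
    then show "ereal (norm ((T \<circ> ivec \<circ> from_nat) k - (T \<circ> p \<circ> from_nat) k)) \<le> ereal \<eta>"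
      using near[of z] by (simp add: norm_minus_commute[of "T (ivec z)"])
  qed
  also have "\<dots> < ereal \<epsilon>" using \<eta> by simp
  finally show ?thesis
    unfolding eps_perturbation_def using bij[OF inj(1)] bij[OF inj(2)] by (intro exI conjI)
qed

theorem theorem3p2:
  fixes \<Gamma> :: "(real ^ 'n) set" and \<epsilon> :: real
  assumes "is_lattice \<Gamma>" and "\<epsilon> > 0"
  shows "\<exists>\<Lambda> D. eps_perturbation \<epsilon> \<Gamma> \<Lambda> \<and> has_uniform_density \<Lambda> D \<and>
           (\<forall>S. compact S \<and> measure lebesgue S > 0 \<and>
                measure lebesgue S < D * (2 * pi) ^ CARD('n) \<longrightarrow> stable_sampling_set S \<Lambda>) \<and>
           (\<forall>S. open S \<and> bounded S \<and>
                measure lebesgue S > D * (2 * pi) ^ CARD('n) \<longrightarrow> interpolation_set S \<Lambda>)"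
proof -
  obtain T :: "real ^ 'n \<Rightarrow> real ^ 'n" where T: "linear T" "bij T" and \<Gamma>: "\<Gamma> = T ` {z. \<forall>i. z $ i \<in> \<int>}"
    using assms(1) unfolding is_lattice_def by blast
  have "{z :: real ^ 'n. \<forall>i. z $ i \<in> \<int>} = range ivec"
  proof (intro equalityI subsetI)
    fix z :: "real ^ 'n" assume "z \<in> {z. \<forall>i. z $ i \<in> \<int>}"
    then have "z = ivec (\<chi> i. \<lfloor>z $ i\<rfloor>)" by (simp add: vec_eq_iff)
    then show "z \<in> range ivec" by (rule range_eqI)
  qed auto
  then have \<Gamma>': "\<Gamma> = range (T \<circ> ivec)" by (simp add: \<Gamma> image_comp)
  obtain c where c: "scales T c" "scales (adjoint T) c" using linear_scaling[OF T(1)] by blast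
  have c0: "c > 0" by (rule scales_pos[OF T c(1)])
  define J where "J = (\<lambda>x. (1 / (2 * pi)) *\<^sub>R adjoint T x)"
  define d where "d = (1 / (2 * pi)) ^ CARD('n) * c"
  have TJ: "T t \<bullet> x = 2 * pi * (t \<bullet> J x)" for t x
    by (simp add: J_def adjoint_works[OF T(1)])
  have linJ: "linear J" unfolding J_def by (intro linear_compose_scale_right adjoint_linear T)
  have "inj J"
    unfolding linear_injective_0[OF linJ]
  proof (intro allI impI)
    fix x assume "J x = 0"
    then have "T t \<bullet> x = 0" for t using TJ[of t x] by simp
    then have "y \<bullet> x = 0" for y using T(2) by (metis bij_is_surj surjD)
    then show "x = 0" using inner_eq_zero_iff by blast
  qed
  then have bijJ: "bij J" using linear_injective_imp_surjective[OF linJ] by (simp add: bij_def)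
  have "scales (\<lambda>x :: real ^ 'n. \<chi> i. 1 / (2 * pi) * x $ i) \<bar>\<Prod>i\<in>(UNIV :: 'n set). 1 / (2 * pi)\<bar>"
    by (rule scales_stretch)
  moreover have "(\<lambda>x :: real ^ 'n. \<chi> i. 1 / (2 * pi) * x $ i) \<circ> adjoint T = J"
    by (simp add: J_def fun_eq_iff vec_eq_iff)
  ultimately have scJ: "scales J d"
    using scales_compose[OF _ c(2), of "\<lambda>x. \<chi> i. 1 / (2 * pi) * x $ i" "(1 / (2 * pi)) ^ CARD('n)"]
    by (simp add: d_def abs_of_nonneg)
  note J = linJ bijJ scJ
  have J_measure: "measure lebesgue (J ` S) = measure lebesgue S * c / (2 * pi) ^ CARD('n)" if "S \<in> lmeasurable" for S
    using scJ that by (simp add: scales_def d_def power_one_over mult_ac)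
  have "(s * c / W < 1 \<longleftrightarrow> s < 1 / c * W) \<and> (s * c / W > 1 \<longleftrightarrow> s > 1 / c * W)" if "W > 0" for s W :: real
    using that c0 by (simp add: field_simps)
  then have threshold: "s * c / (2 * pi) ^ CARD('n) < 1 \<longleftrightarrow> s < 1 / c * (2 * pi) ^ CARD('n)"
    "s * c / (2 * pi) ^ CARD('n) > 1 \<longleftrightarrow> s > 1 / c * (2 * pi) ^ CARD('n)" for s
    by simp_all
  obtain M where M: "M > 0" "\<And>x. norm (T x) \<le> M * norm x"
    using linear_bounded_pos[OF T(1)] by blast
  \<comment> \<open>The bound \<open>1/4\<close> keeps the perturbed points distinct.\<close>
  define \<delta> where "\<delta> = min (1/4) (\<epsilon> / (2 * M))"
  have \<delta>: "\<delta> > 0" "\<delta> \<le> 1/4" "M * \<delta> < \<epsilon>"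
  proof -
    show "\<delta> > 0" "\<delta> \<le> 1/4" using M(1) assms(2) by (auto simp: \<delta>_def)
    have "M * \<delta> \<le> M * (\<epsilon> / (2 * M))" using M(1) by (intro mult_left_mono) (auto simp: \<delta>_def)
    also have "\<dots> < \<epsilon>" using M(1) assms(2) by simp
    finally show "M * \<delta> < \<epsilon>" .
  qed
  obtain p :: "int ^ 'n \<Rightarrow> real ^ 'n" where near: "\<And>z. norm (p z - ivec z) \<le> \<delta>"
    and p: "\<And>m A. A \<subseteq> stage_box m \<Longrightarrow> card A = (2 ^ m) ^ CARD('n) \<Longrightarrow>
      \<exists>\<beta>>0. stable_on p (tile (2 ^ m) A) \<beta> \<and> approx_solvable_on p (tile (2 ^ m) A) \<beta>"
    using universal_points[OF \<delta>(1), where 'n='n] by blast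
  have injp: "inj p"
  proof (rule injI, rule ccontr)
    fix z w assume "p z = p w" "z \<noteq> w"
    then have "norm (ivec z - ivec w) \<le> norm (p w - ivec w) + norm (p z - ivec z)"
      using norm_triangle_ineq4[of "p w - ivec w" "p z - ivec z"] by simp
    then show False using norm_ivec_ge_one[OF \<open>z \<noteq> w\<close>] near[of z] near[of w] \<delta>(2) by linarith
  qed
  let ?\<Lambda> = "range (T \<circ> p)"
  have "eps_perturbation \<epsilon> \<Gamma> ?\<Lambda>"
    unfolding \<Gamma>'
  proof (rule perturbation_of_lattice[OF T injp _ \<delta>(3)])
    fix z
    have "norm (T (p z) - T (ivec z)) \<le> M * norm (p z - ivec z)"
      using M(2)[of "p z - ivec z"] by (simp add: linear_diff[OF T(1)])
    also have "\<dots> \<le> M * \<delta>" using near M(1) by (intro mult_left_mono) auto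
    finally show "norm (T (p z) - T (ivec z)) \<le> M * \<delta>" .
  qed
  moreover have "has_uniform_density ?\<Lambda> (1 / c)"
  proof (rule uniform_density_perturbed[OF T c(1) injp])
    show "norm (p z - ivec z) \<le> 1" for z using near[of z] \<delta>(2) by linarith
  qed
  moreover have "stable_sampling_set S ?\<Lambda>"
    if S: "compact S" "measure lebesgue S < 1 / c * (2 * pi) ^ CARD('n)" for S
  proof -
    have Jc: "compact (J ` S)"
      using S(1) by (intro compact_continuous_image linear_continuous_on) (auto simp: linJ linear_conv_bounded_linear[symmetric])
    have Jm: "measure lebesgue (J ` S) < 1"
      unfolding J_measure[OF lmeasurable_compact[OF S(1)]] threshold by (rule S(2))
    obtain m A where A: "A \<subseteq> stage_box m" "card A = (2 ^ m) ^ CARD('n)" "J ` S \<subseteq> tile (2 ^ m) A"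
      using compact_in_tiles[OF Jc Jm] by blast
    obtain \<beta> where \<beta>: "\<beta> > 0" "stable_on p (tile (2 ^ m) A) \<beta>" using p[OF A(1,2)] by blast
    show ?thesis
      by (rule stable_sampling_transfer[OF T c(1) J TJ injp borel_compact[OF S(1)] compact_imp_bounded[OF S(1)]
            stable_on_subset[OF \<beta>(2) A(3)] \<beta>(1)])
  qed
  moreover have "interpolation_set S ?\<Lambda>"
    if S: "open S" "bounded S" "measure lebesgue S > 1 / c * (2 * pi) ^ CARD('n)" for S
  proof -
    have Jo: "open (J ` S)" using S(1) linJ bijJ by (intro open_surjective_linear_image) (auto simp: bij_is_surj)
    have Jb: "bounded (J ` S)" using S(2) linJ by (simp add: bounded_linear_image linear_conv_bounded_linear)
    have Jm: "measure lebesgue (J ` S) > 1"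
      unfolding J_measure[OF lmeasurable_open[OF S(2,1)]] threshold by (rule S(3))
    obtain m A where A: "A \<subseteq> stage_box m" "card A = (2 ^ m) ^ CARD('n)" "tile (2 ^ m) A \<subseteq> J ` S"
      using open_contains_tiles[OF Jo Jb Jm] by blast
    obtain \<beta> where \<beta>: "\<beta> > 0" "approx_solvable_on p (tile (2 ^ m) A) \<beta>" using p[OF A(1,2)] by blast
    have "bounded (tile (2 ^ m) A)" using finite_subset[OF A(1) finite_stage_box] by simp
    then show ?thesis by (rule interpolation_transfer[OF T(2) J TJ injp A(3) _ \<beta>(2,1)])
  qed
  ultimately show ?thesis by (intro exI[of _ ?\<Lambda>] exI[of _ "1 / c"]) blast
qed

end
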